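(* Let $K/k$ be a separable field extension of degree $n$ and let $L/k$ be the Galois closure of $K/k$. Let $G=\mathrm{Gal}(L/k)$, regarded as a transitive subgroup of $S_n$, and let $H=\mathrm{Gal}(L/K)$, so that $[G:H]=n$. Assume that $n=q+1$ where $q=l^e\equiv 1\pmod 4$ is an odd prime power ($l$ prime, $e\geq 1$), and that $$\mathrm{PSL}_2(\mathbb{F}_q)\leq G\leq \mathrm{P\Gamma L}_2(\mathbb{F}_q)\simeq \mathrm{PGL}_2(\mathbb{F}_q)\rtimes C_e$$ as permutation groups of degree $q+1$, where $\mathrm{P\Gamma L}_2(\mathbb{F}_q)$ acts naturally on the projective line $\mathbb{P}^1(\mathbb{F}_q)$. Then the norm one torus $R^{(1)}_{K/k}(\mathbb{G}_m)$ of $K/k$ is not retract $k$-rational.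
   Context: The group $G=\mathrm{Gal}(L/k)$ is regarded as a transitive subgroup of $S_n$ via its faithful transitive action on the $n$ cosets $G/H$ (equivalently, on the $n$ $k$-embeddings of $K$ into $L$). $C_e$ denotes the cyclic group of order $e$, here $\mathrm{Gal}(\mathbb{F}_q/\mathbb{F}_l)$. $\mathrm{PGL}_2(\mathbb{F}_q)$ acts on $\mathbb{P}^1(\mathbb{F}_q)=\mathbb{F}_q\cup\{\infty\}$ by linear fractional transformations. The norm one torus $R^{(1)}_{K/k}(\mathbb{G}_m)$ is the kernel of the norm map $R_{K/k}(\mathbb{G}_m)\to\mathbb{G}_m$, where $R_{K/k}$ is the Weil restriction. It is an algebraic $k$-torus of dimension $n-1$. When $k$ is an infinite field, a finitely generated field extension $F$ of $k$ is retract $k$-rational if there is a $k$-algebra $R\subset F$ whose quotient field is $F$, together with a nonzero $f\in k[x_1,\ldots,x_m]$ and $k$-algebra homomorphisms $\varphi:R\to k[x_1,\ldots,x_m][1/f]$ and $\psi:k[x_1,\ldots,x_m][1/f]\to R$ with $\psi\circ\varphi=1_R$. A $k$-torus is called retract $k$-rational if its function field over $k$ is. (Here $G$ is not cyclic, so $k$ is automatically infinite.) *)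

theory Defs
  imports
    "HOL-Library.Cardinality"
    "HOL-Library.Poly_Mapping"
    "HOL-Number_Theory.Cong"
    "HOL-Computational_Algebra.Polynomial_Factorial"
    "Jordan_Normal_Form.Determinant"
begin

section \<open>Field extensions\<close>

text \<open>
  A field extension of \<open>k\<close> is a type \<open>'l\<close> of class \<open>field\<close> together with an embedding
  \<open>\<iota> :: 'k \<Rightarrow> 'l\<close> (\<open>field_hom \<iota>\<close>); extensions of \<open>k\<close> inside it are subsets of \<open>'l\<close>.
\<close>

definition subextension :: "('k::field \<Rightarrow> 'l::field) \<Rightarrow> 'l set \<Rightarrow> bool" where
  "subextension \<iota> M \<longleftrightarrow> range \<iota> \<subseteq> M \<and>
     (\<forall>x\<in>M. \<forall>y\<in>M. x - y \<in> M \<and> x * y \<in> M \<and> inverse x \<in> M)"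

definition scale_by :: "('k::field \<Rightarrow> 'l::field) \<Rightarrow> 'k \<Rightarrow> 'l \<Rightarrow> 'l" where
  "scale_by \<iota> c v = \<iota> c * v"

lemma vector_space_scale_by:
  assumes "field_hom \<iota>"
  shows "vector_space (scale_by \<iota>)"
proof -
  interpret field_hom \<iota> by fact
  show ?thesis
    by unfold_locales (simp_all add: scale_by_def hom_add hom_mult algebra_simps)
qed

text \<open>\<open>vector_space.dim\<close> is \<open>0\<close> in infinite dimension, so a positive degree is a finite one.\<close>

definition ext_degree :: "('k::field \<Rightarrow> 'l::field) \<Rightarrow> 'l set \<Rightarrow> nat" where
  "ext_degree \<iota> M = vector_space.dim (scale_by \<iota>) M"

definition ordered_basis :: "('k::field \<Rightarrow> 'l::field) \<Rightarrow> 'l set \<Rightarrow> nat \<Rightarrow> (nat \<Rightarrow> 'l) \<Rightarrow> bool" where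
  "ordered_basis \<iota> M n \<omega> \<longleftrightarrow> inj_on \<omega> {..<n} \<and>
     \<not> module.dependent (scale_by \<iota>) (\<omega> ` {..<n}) \<and>
     module.span (scale_by \<iota>) (\<omega> ` {..<n}) = M"

definition is_min_poly :: "('k::field \<Rightarrow> 'l::field) \<Rightarrow> 'l \<Rightarrow> 'k poly \<Rightarrow> bool" where
  "is_min_poly \<iota> \<alpha> p \<longleftrightarrow> lead_coeff p = 1 \<and> poly (map_poly \<iota> p) \<alpha> = 0 \<and>
     (\<forall>r. r \<noteq> 0 \<and> poly (map_poly \<iota> r) \<alpha> = 0 \<longrightarrow> degree p \<le> degree r)"

text \<open>Existence of the minimal polynomial makes the extension algebraic.\<close>

definition separable_ext :: "('k::field \<Rightarrow> 'l::field) \<Rightarrow> 'l set \<Rightarrow> bool" where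
  "separable_ext \<iota> M \<longleftrightarrow> (\<forall>\<alpha>\<in>M. \<exists>p. is_min_poly \<iota> \<alpha> p \<and> coprime p (pderiv p))"

definition normal_ext :: "('k::field \<Rightarrow> 'l::field) \<Rightarrow> 'l set \<Rightarrow> bool" where
  "normal_ext \<iota> M \<longleftrightarrow>
     (\<forall>p. irreducible p \<and> (\<exists>\<alpha>\<in>M. poly (map_poly \<iota> p) \<alpha> = 0) \<longrightarrow>
        (\<exists>c rs. set rs \<subseteq> M \<and> map_poly \<iota> p = smult c (\<Prod>r\<leftarrow>rs. [:- r, 1:])))"

definition galois_ext :: "('k::field \<Rightarrow> 'l::field) \<Rightarrow> 'l set \<Rightarrow> bool" where
  "galois_ext \<iota> M \<longleftrightarrow> subextension \<iota> M \<and> separable_ext \<iota> M \<and> normal_ext \<iota> M"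

text \<open>\<open>L\<close> is a Galois closure of \<open>K/k\<close>: the smallest Galois extension of \<open>k\<close> in \<open>L\<close>
  containing \<open>K\<close> is \<open>L\<close>.\<close>

definition galois_closure :: "('k::field \<Rightarrow> 'l::field) \<Rightarrow> 'l set \<Rightarrow> 'l set \<Rightarrow> bool" where
  "galois_closure \<iota> K L \<longleftrightarrow> K \<subseteq> L \<and> galois_ext \<iota> L \<and>
     (\<forall>M. galois_ext \<iota> M \<and> K \<subseteq> M \<and> M \<subseteq> L \<longrightarrow> M = L)"

text \<open>The group of automorphisms of the whole field \<open>'l\<close> fixing \<open>M\<close> pointwise, with
  composition as the group operation.\<close>

definition Gal :: "'l::field set \<Rightarrow> ('l \<Rightarrow> 'l) set" where
  "Gal M = {\<sigma>. field_hom \<sigma> \<and> bij \<sigma> \<and> (\<forall>x\<in>M. \<sigma> x = x)}"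

section \<open>Permutation groups\<close>

definition left_coset :: "('l \<Rightarrow> 'l) \<Rightarrow> ('l \<Rightarrow> 'l) set \<Rightarrow> ('l \<Rightarrow> 'l) set" where
  "left_coset g X = (\<lambda>h. g \<circ> h) ` X"

definition cosets :: "('l \<Rightarrow> 'l) set \<Rightarrow> ('l \<Rightarrow> 'l) set \<Rightarrow> ('l \<Rightarrow> 'l) set set" where
  "cosets G H = (\<lambda>g. left_coset g H) ` G"

text \<open>\<open>G\<close> as a permutation group on \<open>'p\<close>, its action on \<open>G/H\<close> by left translation being
  transported along a bijection \<open>\<phi> : G/H \<rightarrow> 'p\<close>.\<close>

definition coset_perms ::
  "('l \<Rightarrow> 'l) set \<Rightarrow> ('l \<Rightarrow> 'l) set \<Rightarrow> (('l \<Rightarrow> 'l) set \<Rightarrow> 'p) \<Rightarrow> ('p \<Rightarrow> 'p) set" where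
  "coset_perms G H \<phi> =
     (\<lambda>g P. \<phi> (left_coset g (the_inv_into (cosets G H) \<phi> P))) ` G"

text \<open>The projective line over \<open>'q\<close> is \<open>'q option\<close>, with \<open>None\<close> as the point at infinity.\<close>

definition moebius :: "'q::field \<Rightarrow> 'q \<Rightarrow> 'q \<Rightarrow> 'q \<Rightarrow> 'q option \<Rightarrow> 'q option" where
  "moebius a b c d P = (case P of
       None \<Rightarrow> (if c = 0 then None else Some (a / c))
     | Some x \<Rightarrow> (if c * x + d = 0 then None else Some ((a * x + b) / (c * x + d))))"

definition PSL2 :: "('q::field option \<Rightarrow> 'q option) set" where
  "PSL2 = {moebius a b c d | a b c d. a * d - b * c = 1}"

text \<open>For finite \<open>'q\<close> the prime field is \<open>range of_nat\<close>.\<close>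

definition PGammaL2 :: "('q::{field,finite} option \<Rightarrow> 'q option) set" where
  "PGammaL2 = {moebius a b c d \<circ> map_option \<sigma> | a b c d \<sigma>.
     a * d - b * c \<noteq> 0 \<and> \<sigma> \<in> Gal (range of_nat)}"

section \<open>Algebras over \<open>k\<close> and retract rationality\<close>

definition subalgebra :: "('k::field \<Rightarrow> 'a::comm_ring_1) \<Rightarrow> 'a set \<Rightarrow> bool" where
  "subalgebra \<iota> A \<longleftrightarrow> range \<iota> \<subseteq> A \<and> (\<forall>x\<in>A. \<forall>y\<in>A. x + y \<in> A \<and> x * y \<in> A)"

definition alg_hom :: "('k::field \<Rightarrow> 'a::comm_ring_1) \<Rightarrow> 'a set \<Rightarrow>
    ('k \<Rightarrow> 'b::comm_ring_1) \<Rightarrow> 'b set \<Rightarrow> ('a \<Rightarrow> 'b) \<Rightarrow> bool" where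
  "alg_hom \<iota> A \<kappa> B \<theta> \<longleftrightarrow> (\<forall>x\<in>A. \<theta> x \<in> B) \<and> (\<forall>c. \<theta> (\<iota> c) = \<kappa> c) \<and>
     (\<forall>x\<in>A. \<forall>y\<in>A. \<theta> (x + y) = \<theta> x + \<theta> y \<and> \<theta> (x * y) = \<theta> x * \<theta> y)"

type_synonym 'k mpoly = "(nat \<Rightarrow>\<^sub>0 nat) \<Rightarrow>\<^sub>0 'k"

definition mconst :: "'k::field \<Rightarrow> 'k mpoly" where
  "mconst c = Poly_Mapping.single 0 c"

definition mvar :: "nat \<Rightarrow> 'k::field mpoly" where
  "mvar i = Poly_Mapping.single (Poly_Mapping.single i 1) 1"

definition mpolys :: "nat \<Rightarrow> 'k::field mpoly set" where
  "mpolys m = {p. \<forall>t\<in>Poly_Mapping.keys p. Poly_Mapping.keys t \<subseteq> {..<m}}"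

text \<open>\<open>k[x\<^sub>0, \<dots>, x\<^sub>m\<^sub>-\<^sub>1][1/f]\<close> inside the field of fractions of \<open>k[x\<^sub>0, x\<^sub>1, \<dots>]\<close>.\<close>

definition mpolys_loc :: "nat \<Rightarrow> 'k::field mpoly \<Rightarrow> 'k mpoly fract set" where
  "mpolys_loc m f = {Fract p (f ^ i) | p i. p \<in> mpolys m}"

definition frac_const :: "'k::field \<Rightarrow> 'k mpoly fract" where
  "frac_const c = to_fract (mconst c)"

definition retract_rational :: "('k::field \<Rightarrow> 'f::field) \<Rightarrow> bool" where
  "retract_rational j \<longleftrightarrow>
     (\<exists>R m f \<phi> \<psi>.
        subalgebra j R \<and> (\<forall>z. \<exists>x\<in>R. \<exists>y\<in>R. y \<noteq> 0 \<and> z = x / y) \<and>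
        f \<in> mpolys m \<and> f \<noteq> 0 \<and>
        alg_hom j R frac_const (mpolys_loc m f) \<phi> \<and>
        alg_hom frac_const (mpolys_loc m f) j R \<psi> \<and>
        (\<forall>x\<in>R. \<psi> (\<phi> x) = x))"

section \<open>The norm one torus\<close>

text \<open>
  Let \<open>\<omega>\<close> be a basis of \<open>K/k\<close>. The points of \<open>R\<^bsub>K/k\<^esub>(G\<^sub>m)\<close> in a \<open>k\<close>-algebra \<open>A\<close> are the units
  \<open>\<Sum>\<^sub>i \<omega>\<^sub>i \<otimes> x\<^sub>i\<close> of \<open>K \<otimes> A\<close>. Multiplication by such an element is given in the basis \<open>\<omega>\<close> by the
  matrix below, and its determinant is the norm; the element is a unit iff its norm is.
\<close>

definition generic_mult_mat ::
  "('k::field \<Rightarrow> 'l::field) \<Rightarrow> nat \<Rightarrow> (nat \<Rightarrow> 'l) \<Rightarrow> 'k mpoly mat" where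
  "generic_mult_mat \<iota> n \<omega> = mat n n (\<lambda>(r, s). \<Sum>i<n.
     mvar i * mconst (module.representation (scale_by \<iota>) (\<omega> ` {..<n}) (\<omega> i * \<omega> s) (\<omega> r)))"

definition norm_poly :: "('k::field \<Rightarrow> 'l::field) \<Rightarrow> nat \<Rightarrow> (nat \<Rightarrow> 'l) \<Rightarrow> 'k mpoly" where
  "norm_poly \<iota> n \<omega> = det (generic_mult_mat \<iota> n \<omega>)"

text \<open>
  With \<open>N\<close> the polynomial above and \<open>A = k[x\<^sub>0, \<dots>, x\<^sub>n\<^sub>-\<^sub>1][1/N]\<close>, the coordinate ring of
  \<open>R\<^bsub>K/k\<^esub>(G\<^sub>m)\<close> is \<open>A\<close>, and the norm map to \<open>G\<^sub>m = Spec k[t, 1/t]\<close> is given by \<open>t \<mapsto> N\<close>. Its kernel, the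
  fibre over \<open>t = 1\<close>, has coordinate ring \<open>A/(N - 1)\<close>. The following says that the extension
  \<open>j : k \<rightarrow> 'f\<close> is the field of fractions of \<open>A/(N - 1)\<close>, where \<open>\<theta>\<close> is the composite
  \<open>A \<rightarrow> A/(N - 1) \<rightarrow> 'f\<close>. The choice of \<open>\<omega>\<close> is immaterial, as a change of basis is a linear change
  of the coordinates.
\<close>

definition norm_one_torus_function_field ::
  "('k::field \<Rightarrow> 'l::field) \<Rightarrow> 'l set \<Rightarrow> ('k \<Rightarrow> 'f::field) \<Rightarrow> bool" where
  "norm_one_torus_function_field \<iota> K j \<longleftrightarrow>
     (\<exists>n \<omega> \<theta>. ordered_basis \<iota> K n \<omega> \<and>
        (let N = norm_poly \<iota> n \<omega>; A = mpolys_loc n N in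
           alg_hom frac_const A j UNIV \<theta> \<and>
           {x \<in> A. \<theta> x = 0} = {(to_fract N - 1) * y | y. y \<in> A} \<and>
           (\<forall>z. \<exists>x\<in>A. \<exists>y\<in>A. \<theta> y \<noteq> 0 \<and> z = \<theta> x / \<theta> y)))"

end

theory Submission imports Defs "Jordan_Normal_Form.Char_Poly" begin

text \<open>Since \<open>-1\<close> is a square in \<open>GF(q)\<close>, the group \<open>PSL\<^sub>2\<close> contains the Klein four-group generated by
  \<open>s\<^sub>1: x \<mapsto> -x\<close> and \<open>s\<^sub>2: x \<mapsto> 1/x\<close>. The fixed points of \<open>s\<^sub>1\<close> are \<open>0\<close> and \<open>\<infinity>\<close>, which \<open>s\<^sub>2\<close> exchanges; \<open>s\<^sub>2\<close> fixes
  \<open>\<plusminus>1\<close>, which \<open>s\<^sub>1\<close> exchanges; both exchange \<open>\<plusminus>i\<close>, where \<open>i\<^sup>2 = -1\<close>.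

  Adjoin variables \<open>A, v\<^sub>1, v\<^sub>2, v\<^sub>3\<close> to \<open>L\<close>, put \<open>B = A - 1\<close> and \<open>C = 1/(AB)\<close>, and let the four-group act
  semilinearly, fixing these variables except for \<open>s\<^sub>2 v\<^sub>1 = A/v\<^sub>1\<close>, \<open>s\<^sub>1 v\<^sub>2 = B/v\<^sub>2\<close> and \<open>s\<^sub>1 v\<^sub>3 = s\<^sub>2 v\<^sub>3 = C/v\<^sub>3\<close>.
  The coordinates \<open>v\<^sub>1, A/v\<^sub>1, v\<^sub>2, B/v\<^sub>2, v\<^sub>3, C/v\<^sub>3\<close> at \<open>0, \<infinity>, 1, -1, i, -i\<close> and \<open>1\<close> elsewhere define an
  equivariant point of the torus. If the torus were retract rational, a multiple of this point by a
  point over \<open>k\<close> would be joined to another point over \<open>k\<close> by the image of a line, that is, by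
  equivariant polynomials \<open>Y\<^sub>P\<close> whose product is an \<open>n\<close>-th power. As \<open>n\<close> is even and \<open>0\<close>, \<open>\<infinity>\<close> are the only
  fixed points of \<open>s\<^sub>1\<close>, unique factorization makes \<open>Y\<^sub>0 Y\<^sub>\<infinity>\<close> a constant times \<open>h \<cdot> s\<^sub>1 h\<close> with \<open>s\<^sub>2 h = h\<close>.
  Comparing the two ends of the line, \<open>cA\<close> is such a norm for some nonzero \<open>c\<close> in \<open>L\<close>. Eliminating \<open>v\<^sub>3\<close>,
  \<open>v\<^sub>2\<close>, \<open>v\<^sub>1\<close> in turn, by means of principal ideals of Laurent polynomials, leaves equations over \<open>L(A)\<close>
  that contradict the parity of orders at \<open>A = 0\<close> and \<open>A = 1\<close>.\<close>


section \<open>Semilinear automorphisms of rational function fields\<close>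

text \<open>Each involution of the four-group has exactly two fixed points, and \<open>v_1\<close>,
  \<open>v_2\<close>, \<open>v_3\<close> solve one norm equation for each of the three. The value of
  C is forced, since the coordinates of a point of the torus have product 1. What is followed along
  the line is the class of \<open>Y_0 Y_inf\<close> modulo products \<open>h * s1 h\<close> with
  \<open>s2 h = h\<close>. Factorization controls it only up to a constant \<open>c'\<close> of the
  tower that need not be such a product; hence two points of the line are compared, and
  \<open>c'\<close> cancels. The multiple by a point over k is needed because the section of the
  retraction is a rational map, possibly undefined at the special point. For the elimination, the
  equation for h alone does not pass to a smaller field. It is kept together with the invariance
  under \<open>s2\<close>, as a pair of commuting semilinear operators \<open>b s1\<close>,
  \<open>w s2\<close> with scalar squares; a generator of a stable fractional ideal conjugates both
  to monomials, whose coefficients live one level down. At the bottom, b requires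
  \<open>1 + k\<close> to be even and w requires \<open>k\<close> to be even, with the same
  \<open>k\<close> because both involutions invert \<open>v_3\<close>.\<close>

definition frac_ext :: "('r::idom \<Rightarrow> 'b::field) \<Rightarrow> 'r fract \<Rightarrow> 'b" where
  "frac_ext h x = (SOME y. \<exists>p q. q \<noteq> 0 \<and> x = Fract p q \<and> y = h p / h q)"

lemma frac_ext_Fract:
  assumes "comm_ring_hom h" and inj: "\<And>q. h q = 0 \<Longrightarrow> q = 0" and "q \<noteq> 0"
  shows "frac_ext h (Fract p q) = h p / h q"
proof -
  interpret comm_ring_hom h by fact
  have "\<exists>p' q'. q' \<noteq> 0 \<and> Fract p q = Fract p' q' \<and> frac_ext h (Fract p q) = h p' / h q'"
    unfolding frac_ext_def by (rule someI_ex) (use assms(3) in blast)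
  then obtain p' q' where q': "q' \<noteq> 0" "Fract p q = Fract p' q'"
    and e: "frac_ext h (Fract p q) = h p' / h q'" by blast
  have "p * q' = p' * q" using q' assms(3) by (simp add: eq_fract)
  then have "h p * h q' = h p' * h q" by (metis hom_mult)
  moreover have "h q \<noteq> 0" "h q' \<noteq> 0" using inj q' assms(3) by auto
  ultimately show ?thesis unfolding e by (simp add: field_simps)
qed

lemma frac_ext_to_fract:
  assumes "comm_ring_hom h" and "\<And>q. h q = 0 \<Longrightarrow> q = 0"
  shows "frac_ext h (to_fract p) = h p"
proof -
  interpret comm_ring_hom h by fact
  show ?thesis using frac_ext_Fract[of h 1 p] assms by (simp add: to_fract_def)
qed

lemma field_hom_frac_ext:
  assumes h: "comm_ring_hom h" and inj: "\<And>q. h q = 0 \<Longrightarrow> q = 0"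
  shows "field_hom (frac_ext h)"
proof -
  interpret comm_ring_hom h by fact
  note F = frac_ext_Fract[of h, OF h inj]
  have nz: "h q \<noteq> 0" if "q \<noteq> 0" for q using inj that by blast
  show ?thesis
  proof
    show "frac_ext h 0 = 0" using F[of 1 0] by (simp add: Zero_fract_def)
    show "frac_ext h 1 = 1" using F[of 1 1] by (simp add: One_fract_def)
    fix x y :: "'a fract"
    obtain a b c d where x: "x = Fract a b" "b \<noteq> 0" and y: "y = Fract c d" "d \<noteq> 0"
      by (metis Fract_cases)
    show "frac_ext h (x + y) = frac_ext h x + frac_ext h y"
      using x y by (simp add: F nz hom_add hom_mult field_simps)
    show "frac_ext h (x * y) = frac_ext h x * frac_ext h y"
      using x y by (simp add: F nz hom_mult)
  qed
qed

definition cst :: "'a::field \<Rightarrow> 'a poly fract" where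
  "cst a = to_fract [:a:]"

definition var :: "'a::field poly fract" where
  "var = to_fract [:0, 1:]"

lemma field_hom_cst: "field_hom cst"
  by standard (simp_all add: cst_def flip: one_pCons to_fract_add to_fract_mult)

interpretation cst: field_hom cst by (rule field_hom_cst)

lemma var_nonzero [simp]: "var \<noteq> 0"
  by (simp add: var_def)

lemma to_fract_power: "to_fract (x ^ n) = to_fract x ^ n"
  by (induction n) auto

lemma to_fract_monom: "to_fract (monom c n) = cst c * var ^ n"
  by (simp add: cst_def var_def monom_altdef flip: to_fract_power to_fract_mult)

lemma to_fract_poly: "to_fract p = poly (map_poly cst p) var"
proof -
  have "to_fract p = to_fract (\<Sum>i\<le>degree p. monom (coeff p i) i)"
    by (simp add: poly_as_sum_of_monoms)
  also have "\<dots> = (\<Sum>i\<le>degree p. cst (coeff p i) * var ^ i)"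
    by (simp add: to_fract_sum to_fract_monom)
  also have "\<dots> = poly (map_poly cst p) var"
    by (simp add: poly_altdef coeff_map_poly degree_map_poly)
  finally show ?thesis .
qed

definition evf :: "('a::field \<Rightarrow> 'a) \<Rightarrow> 'a poly fract \<Rightarrow> 'a poly \<Rightarrow> 'a poly fract" where
  "evf g X p = poly (map_poly (\<lambda>a. cst (g a)) p) X"

lemma field_homI:
  assumes "f 1 = 1" "\<And>x y. f (x + y) = f x + f y" "\<And>x y. f (x * y) = f x * f y"
  shows "field_hom f"
proof -
  have "f 0 = 0" using assms(2)[of 0 0]
    by (metis add.right_neutral add_left_cancel)
  then show ?thesis by unfold_locales (use assms in auto)
qed

lemma field_hom_comp:
  assumes "field_hom f" "field_hom g" shows "field_hom (\<lambda>x. f (g x))"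
proof -
  interpret f: field_hom f by fact
  interpret g: field_hom g by fact
  show ?thesis by (rule field_homI) (simp_all add: f.hom_add f.hom_mult g.hom_add g.hom_mult)
qed

lemma comm_ring_hom_poly_map:
  assumes "field_hom f" shows "comm_ring_hom (\<lambda>p. poly (map_poly f p) x)"
proof -
  interpret f: field_hom f by fact
  interpret m: map_poly_comm_ring_hom f by unfold_locales
  show ?thesis
    by unfold_locales (simp_all add: m.hom_add m.hom_mult)
qed

lemma comm_ring_hom_evf: "field_hom g \<Longrightarrow> comm_ring_hom (evf g X)"
  unfolding evf_def by (rule comm_ring_hom_poly_map) (rule field_hom_comp[OF field_hom_cst])

text \<open>The twist is made so that, when \<open>e\<close> holds, the variable times its image is
  \<open>C\<close>: adjoining the variable adjoins a solution of a norm equation.\<close>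

definition tw :: "bool \<Rightarrow> 'a::field \<Rightarrow> 'a poly fract" where
  "tw e C = (if e then cst C / var else var)"

text \<open>Untwisted, the substitution only moves coefficients. Twisted, it reverses the polynomial
  up to a power of the variable, and the leading coefficient, times a power of \<open>C\<close>,
  turns up as the constant term.\<close>

lemma evf_0_imp:
  assumes g: "field_hom g" and C: "C \<noteq> 0" and 0: "evf g (tw e C) p = 0"
  shows "p = 0"
proof (rule ccontr)
  assume p: "p \<noteq> 0"
  interpret g: field_hom g by fact
  let ?n = "degree p"
  have c: "map_poly (\<lambda>a. cst (g a)) p = map_poly cst (map_poly g p)"
    by (simp add: map_poly_map_poly comp_def)
  have deg: "degree (map_poly (\<lambda>a. cst (g a)) p) = ?n"
    by (rule degree_map_poly) simp
  show False
  proof (cases e)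
    case False
    then have "to_fract (map_poly g p) = 0" using 0 by (simp add: tw_def evf_def to_fract_poly c)
    then show False using p by (simp add: map_poly_eq_0_iff)
  next
    case True
    define r where "r = (\<Sum>i\<le>?n. monom (g (coeff p i) * C ^ i) (?n - i))"
    have "evf g (tw e C) p * var ^ ?n
        = (\<Sum>i\<le>?n. cst (g (coeff p i)) * (cst C / var) ^ i * var ^ ?n)"
      using True by (simp add: tw_def evf_def poly_altdef deg coeff_map_poly sum_distrib_right)
    also have "\<dots> = (\<Sum>i\<le>?n. cst (g (coeff p i) * C ^ i) * var ^ (?n - i))"
      by (intro sum.cong refl)
         (simp add: power_divide power_diff cst.hom_mult cst.hom_power)
    also have "\<dots> = to_fract r"
      by (simp add: r_def to_fract_sum to_fract_monom)
    finally have "r = 0" using 0 by simp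
    moreover have "coeff r 0 = (\<Sum>i\<le>?n. if i = ?n then g (coeff p i) * C ^ i else 0)"
      unfolding r_def coeff_sum by (intro sum.cong refl) auto
    then have "coeff r 0 = g (lead_coeff p) * C ^ ?n" by (simp add: sum.delta)
    ultimately show False using p C by simp
  qed
qed

definition lft :: "('a::field \<Rightarrow> 'a) \<Rightarrow> bool \<Rightarrow> 'a \<Rightarrow> 'a poly fract \<Rightarrow> 'a poly fract" where
  "lft g e C = frac_ext (evf g (tw e C))"

lemma field_hom_lft: "field_hom g \<Longrightarrow> C \<noteq> 0 \<Longrightarrow> field_hom (lft g e C)"
  unfolding lft_def by (rule field_hom_frac_ext) (auto intro: comm_ring_hom_evf evf_0_imp)

lemma lft_to_fract:
  "field_hom g \<Longrightarrow> C \<noteq> 0 \<Longrightarrow> lft g e C (to_fract p) = evf g (tw e C) p"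
  unfolding lft_def by (rule frac_ext_to_fract) (auto intro: comm_ring_hom_evf evf_0_imp)

lemma lft_cst:
  assumes "field_hom g" "C \<noteq> 0" shows "lft g e C (cst a) = cst (g a)"
proof -
  interpret g: field_hom g by fact
  interpret c: field_hom "\<lambda>a. cst (g a)" by (rule field_hom_comp[OF field_hom_cst assms(1)])
  show ?thesis
    using lft_to_fract[OF assms, of e "[:a:]"]
    by (simp add: cst_def[of a] evf_def c.map_poly_pCons_hom)
qed

lemma lft_var:
  assumes "field_hom g" "C \<noteq> 0" shows "lft g e C var = tw e C"
proof -
  interpret g: field_hom g by fact
  interpret c: field_hom "\<lambda>a. cst (g a)" by (rule field_hom_comp[OF field_hom_cst assms(1)])
  show ?thesis
    using lft_to_fract[OF assms, of e "[:0,1:]"]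
    by (simp add: var_def evf_def c.map_poly_pCons_hom)
qed

lemma fract_hom_eqI:
  fixes f f' :: "'a::field poly fract \<Rightarrow> 'b::field"
  assumes f: "field_hom f" and f': "field_hom f'"
    and c: "\<And>a. f (cst a) = f' (cst a)" and v: "f var = f' var"
  shows "f = f'"
proof
  interpret f: field_hom f by fact
  interpret f': field_hom f' by fact
  have p: "f (to_fract p) = f' (to_fract p)" for p
    unfolding to_fract_poly poly_altdef f.hom_sum f'.hom_sum f.hom_mult f'.hom_mult
      f.hom_power f'.hom_power by (simp add: c v coeff_map_poly)
  fix x :: "'a poly fract"
  obtain a b where "x = Fract a b" "b \<noteq> 0" by (metis Fract_cases)
  then have "x = to_fract a / to_fract b" by (simp add: to_fract_def)
  then show "f x = f' x" by (simp add: f.hom_div f'.hom_div p)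
qed

text \<open>Two inversions of the variable cancel, so the flags add modulo 2; this needs the outer
  map to fix \<open>C\<close>, since it also acts on the numerator of \<open>C/v\<close>.\<close>

lemma lft_comp:
  assumes g: "field_hom g" and h: "field_hom h" and C: "C \<noteq> 0" "g C = C"
  shows "lft g e C \<circ> lft h e' C = lft (g \<circ> h) (e \<noteq> e') C"
proof (rule fract_hom_eqI)
  interpret gl: field_hom "lft g e C" by (rule field_hom_lft[OF g C(1)])
  have gh: "field_hom (g \<circ> h)" unfolding comp_def by (rule field_hom_comp[OF g h])
  show "field_hom (lft g e C \<circ> lft h e' C)" unfolding comp_def
    by (rule field_hom_comp[OF field_hom_lft[OF g C(1)] field_hom_lft[OF h C(1)]])
  show "field_hom (lft (g \<circ> h) (e \<noteq> e') C)"
    by (rule field_hom_lft[OF gh C(1)])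
  show "(lft g e C \<circ> lft h e' C) (cst a) = lft (g \<circ> h) (e \<noteq> e') C (cst a)" for a
    by (simp add: lft_cst g h gh C)
  have [simp]: "cst C \<noteq> 0" using C by simp
  have d: "lft g e C (cst C / var) = cst C / tw e C"
    by (simp add: gl.hom_div lft_cst lft_var g C)
  show "(lft g e C \<circ> lft h e' C) var = lft (g \<circ> h) (e \<noteq> e') C var"
    using d by (cases e; cases e') (simp_all add: lft_var g h gh C tw_def)
qed

lemma field_hom_id: "field_hom id"
  by (rule field_homI) auto

lemma lft_id:
  assumes "C \<noteq> 0" shows "lft id False C = id"
  by (rule fract_hom_eqI[OF field_hom_lft[OF field_hom_id assms] field_hom_id])
     (simp_all add: lft_cst[OF field_hom_id] lft_var[OF field_hom_id] tw_def assms)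

section \<open>Actions of the Klein four-group modulo a kernel\<close>

text \<open>The automorphisms \<open>s1\<close> and \<open>s2\<close> generate a Klein four-group only modulo the group \<open>N\<close>, which
  acts trivially on all the elements that matter. This avoids the question whether the Galois group
  acts faithfully on the cosets.\<close>

locale klein =
  fixes s1 s2 :: "'a::field \<Rightarrow> 'a" and N :: "('a \<Rightarrow> 'a) set"
  assumes hom1: "field_hom s1" and hom2: "field_hom s2" and homN: "\<nu> \<in> N \<Longrightarrow> field_hom \<nu>"
    and idN: "id \<in> N" and compN: "\<nu> \<in> N \<Longrightarrow> \<mu> \<in> N \<Longrightarrow> \<nu> \<circ> \<mu> \<in> N"
    and invN: "\<nu> \<in> N \<Longrightarrow> \<exists>\<mu>\<in>N. \<mu> \<circ> \<nu> = id"
    and sq1: "s1 \<circ> s1 \<in> N" and sq2: "s2 \<circ> s2 \<in> N"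
    and comm: "\<exists>\<nu>\<in>N. s1 \<circ> s2 = s2 \<circ> s1 \<circ> \<nu>"
    and norm1: "\<nu> \<in> N \<Longrightarrow> \<exists>\<mu>\<in>N. \<nu> \<circ> s1 = s1 \<circ> \<mu>"
    and norm2: "\<nu> \<in> N \<Longrightarrow> \<exists>\<mu>\<in>N. \<nu> \<circ> s2 = s2 \<circ> \<mu>"

definition Fix :: "('a \<Rightarrow> 'a) set \<Rightarrow> 'a set" where
  "Fix N = {x. \<forall>\<nu>\<in>N. \<nu> x = x}"

lemma Fix_D: "x \<in> Fix N \<Longrightarrow> \<nu> \<in> N \<Longrightarrow> \<nu> x = x"
  by (simp add: Fix_def)

context klein
begin

lemma Fix_s1: assumes x: "x \<in> Fix N" shows "s1 x \<in> Fix N"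
  unfolding Fix_def
proof clarify
  fix \<nu> assume "\<nu> \<in> N"
  then obtain \<mu> where m: "\<mu> \<in> N" "\<nu> \<circ> s1 = s1 \<circ> \<mu>" using norm1 by blast
  show "\<nu> (s1 x) = s1 x"
    using fun_cong[OF m(2), of x] Fix_D[OF x m(1)] by simp
qed

lemma Fix_s2: assumes x: "x \<in> Fix N" shows "s2 x \<in> Fix N"
  unfolding Fix_def
proof clarify
  fix \<nu> assume "\<nu> \<in> N"
  then obtain \<mu> where m: "\<mu> \<in> N" "\<nu> \<circ> s2 = s2 \<circ> \<mu>" using norm2 by blast
  show "\<nu> (s2 x) = s2 x"
    using fun_cong[OF m(2), of x] Fix_D[OF x m(1)] by simp
qed

lemma Fix_invol: assumes x: "x \<in> Fix N"
  shows "s1 (s1 x) = x" "s2 (s2 x) = x" "s1 (s2 x) = s2 (s1 x)"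
proof -
  show "s1 (s1 x) = x" "s2 (s2 x) = x"
    using Fix_D[OF x sq1] Fix_D[OF x sq2] by simp_all
  obtain \<nu> where n: "\<nu> \<in> N" "s1 \<circ> s2 = s2 \<circ> s1 \<circ> \<nu>" using comm by blast
  show "s1 (s2 x) = s2 (s1 x)"
    using fun_cong[OF n(2), of x] Fix_D[OF x n(1)] by simp
qed

text \<open>The relations survive because \<open>C\<close> is fixed by all the maps involved and
  flags add modulo 2: squares and commutators have flag \<open>False\<close>, so they stay in the
  lift of \<open>N\<close>, which leaves the variable alone.\<close>

lemma klein_lft:
  assumes C: "C \<noteq> 0" "s1 C = C" "s2 C = C" "C \<in> Fix N"
  shows "klein (lft s1 e1 C) (lft s2 e2 C) ((\<lambda>\<nu>. lft \<nu> False C) ` N)"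
proof -
  have hc: "field_hom (s1 \<circ> s2)" "field_hom (s2 \<circ> s1)" unfolding comp_def
    by (rule field_hom_comp[OF hom1 hom2], rule field_hom_comp[OF hom2 hom1])
  have nC: "\<And>\<nu>. \<nu> \<in> N \<Longrightarrow> \<nu> C = C" using Fix_D[OF C(4)] .
  have 1: "lft \<nu> False C \<circ> lft s e C = lft s e C \<circ> lft \<mu> False C"
    if "\<nu> \<in> N" "\<mu> \<in> N" "\<nu> \<circ> s = s \<circ> \<mu>" "field_hom s" "s C = C" for \<nu> \<mu> s e
    using lft_comp[of \<nu> s C False e] lft_comp[of s \<mu> C e False] that homN C nC by simp
  show ?thesis
  proof (rule klein.intro)
    show "field_hom (lft s1 e1 C)" "field_hom (lft s2 e2 C)"
      by (rule field_hom_lft[OF hom1 C(1)], rule field_hom_lft[OF hom2 C(1)])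
    show "field_hom \<nu>" if "\<nu> \<in> (\<lambda>\<nu>. lft \<nu> False C) ` N" for \<nu>
      using that field_hom_lft[OF homN C(1)] by blast
    show "id \<in> (\<lambda>\<nu>. lft \<nu> False C) ` N" using idN lft_id[OF C(1)] by force
    show "\<nu> \<circ> \<mu> \<in> (\<lambda>\<nu>. lft \<nu> False C) ` N"
      if "\<nu> \<in> (\<lambda>\<nu>. lft \<nu> False C) ` N" "\<mu> \<in> (\<lambda>\<nu>. lft \<nu> False C) ` N" for \<nu> \<mu>
    proof -
      obtain a b where ab: "a \<in> N" "b \<in> N" "\<nu> = lft a False C" "\<mu> = lft b False C"
        using \<open>\<nu> \<in> _\<close> \<open>\<mu> \<in> _\<close> by blast
      then have "\<nu> \<circ> \<mu> = lft (a \<circ> b) False C"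
        using lft_comp[of a b C False False] homN C nC by simp
      then show ?thesis using compN[OF ab(1,2)] by blast
    qed
    show "\<exists>\<mu>\<in>(\<lambda>\<nu>. lft \<nu> False C) ` N. \<mu> \<circ> \<nu> = id" if "\<nu> \<in> (\<lambda>\<nu>. lft \<nu> False C) ` N" for \<nu>
    proof -
      obtain a where a: "a \<in> N" "\<nu> = lft a False C" using \<open>\<nu> \<in> _\<close> by blast
      obtain b where b: "b \<in> N" "b \<circ> a = id" using invN[OF a(1)] by blast
      have "lft b False C \<circ> \<nu> = id"
        using lft_comp[of b a C False False] homN C nC a b lft_id by simp
      then show ?thesis using b by blast
    qed
    show "lft s1 e1 C \<circ> lft s1 e1 C \<in> (\<lambda>\<nu>. lft \<nu> False C) ` N"
      using lft_comp[OF hom1 hom1 C(1,2), of e1 e1] sq1 by simp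
    show "lft s2 e2 C \<circ> lft s2 e2 C \<in> (\<lambda>\<nu>. lft \<nu> False C) ` N"
      using lft_comp[OF hom2 hom2 C(1,3), of e2 e2] sq2 by simp
    show "\<exists>\<nu>\<in>(\<lambda>\<nu>. lft \<nu> False C) ` N. lft s1 e1 C \<circ> lft s2 e2 C = lft s2 e2 C \<circ> lft s1 e1 C \<circ> \<nu>"
    proof -
      obtain \<nu> where n: "\<nu> \<in> N" "s1 \<circ> s2 = s2 \<circ> s1 \<circ> \<nu>" using comm by blast
      have "lft s2 e2 C \<circ> lft s1 e1 C \<circ> lft \<nu> False C
          = lft (s2 \<circ> s1) (e2 \<noteq> e1) C \<circ> lft \<nu> False C"
        using lft_comp[OF hom2 hom1 C(1,3), of e2 e1] by simp
      also have "\<dots> = lft (s2 \<circ> s1 \<circ> \<nu>) ((e2 \<noteq> e1) \<noteq> False) C"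
        by (rule lft_comp) (use homN n hc C in auto)
      also have "\<dots> = lft (s1 \<circ> s2) (e1 \<noteq> e2) C"
        unfolding n(2)[symmetric] by (cases e1; cases e2; simp)
      also have "\<dots> = lft s1 e1 C \<circ> lft s2 e2 C"
        using lft_comp[OF hom1 hom2 C(1,2)] by simp
      finally have eq: "lft s2 e2 C \<circ> lft s1 e1 C \<circ> lft \<nu> False C = lft s1 e1 C \<circ> lft s2 e2 C" .
      show ?thesis by (rule bexI[where x = "lft \<nu> False C"]) (use n(1) eq in auto)
    qed
    show "\<exists>\<mu>\<in>(\<lambda>\<nu>. lft \<nu> False C) ` N. \<nu> \<circ> lft s1 e1 C = lft s1 e1 C \<circ> \<mu>"
      if "\<nu> \<in> (\<lambda>\<nu>. lft \<nu> False C) ` N" for \<nu>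
    proof -
      obtain a where a: "a \<in> N" "\<nu> = lft a False C" using \<open>\<nu> \<in> _\<close> by blast
      obtain b where b: "b \<in> N" "a \<circ> s1 = s1 \<circ> b" using norm1[OF a(1)] by blast
      show ?thesis using 1[OF a(1) b hom1 C(2)] a b by blast
    qed
    show "\<exists>\<mu>\<in>(\<lambda>\<nu>. lft \<nu> False C) ` N. \<nu> \<circ> lft s2 e2 C = lft s2 e2 C \<circ> \<mu>"
      if "\<nu> \<in> (\<lambda>\<nu>. lft \<nu> False C) ` N" for \<nu>
    proof -
      obtain a where a: "a \<in> N" "\<nu> = lft a False C" using \<open>\<nu> \<in> _\<close> by blast
      obtain b where b: "b \<in> N" "a \<circ> s2 = s2 \<circ> b" using norm2[OF a(1)] by blast
      show ?thesis using 1[OF a(1) b hom2 C(3)] a b by blast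
    qed
  qed
qed

lemma cst_Fix_lft:
  assumes "C \<noteq> 0" "x \<in> Fix N"
  shows "cst x \<in> Fix ((\<lambda>\<nu>. lft \<nu> False C) ` N)"
  using assms homN by (auto simp: Fix_def lft_cst)

end

section \<open>Laurent polynomials and the descent step\<close>

text \<open>Unlike the polynomials, the ring of Laurent polynomials is stable under
  \<open>v \<mapsto> C/v\<close>, and it is still a principal ideal domain whose units are the
  monomials.\<close>

definition laurent :: "'a::field poly fract set" where
  "laurent = {x. \<exists>r k. x * var ^ k = to_fract r}"

lemma laurent_to_fract: "to_fract r \<in> laurent"
  unfolding laurent_def by (intro CollectI exI[of _ r] exI[of _ "0::nat"]) simp

lemma laurent_cst: "cst a \<in> laurent"
  unfolding cst_def by (rule laurent_to_fract)

lemma laurent_var: "var \<in> laurent"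
  unfolding var_def by (rule laurent_to_fract)

lemma laurent_inverse_var: "inverse var \<in> laurent"
  unfolding laurent_def by (auto intro!: exI[of _ 1])

lemma laurent_mult: assumes "x \<in> laurent" "y \<in> laurent" shows "x * y \<in> laurent"
proof -
  obtain r k where r: "x * var ^ k = to_fract r" using assms unfolding laurent_def by blast
  obtain r' k' where r': "y * var ^ k' = to_fract r'" using assms unfolding laurent_def by blast
  have "x * y * var ^ (k + k') = (x * var ^ k) * (y * var ^ k')"
    by (simp add: power_add)
  then have "x * y * var ^ (k + k') = to_fract (r * r')"
    unfolding r r' by simp
  then show ?thesis unfolding laurent_def by blast
qed

lemma laurent_add: assumes "x \<in> laurent" "y \<in> laurent" shows "x + y \<in> laurent"
proof -
  obtain r k where r: "x * var ^ k = to_fract r" using assms unfolding laurent_def by blast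
  obtain r' k' where r': "y * var ^ k' = to_fract r'" using assms unfolding laurent_def by blast
  have v: "to_fract ([:0,1:] ^ i) = var ^ i" for i by (simp add: to_fract_power var_def)
  have "(x + y) * var ^ (k + k') = (x * var ^ k) * var ^ k' + (y * var ^ k') * var ^ k"
    by (simp add: power_add algebra_simps)
  also have "\<dots> = to_fract (r * [:0,1:] ^ k' + r' * [:0,1:] ^ k)"
    unfolding r r' by (simp add: v)
  finally show ?thesis unfolding laurent_def by blast
qed

lemma laurent_sum: "(\<And>i. i \<in> A \<Longrightarrow> f i \<in> laurent) \<Longrightarrow> sum f A \<in> laurent"
proof (induction A rule: infinite_finite_induct)
  case (insert x F)
  then show ?case by (simp add: laurent_add)
qed (use laurent_to_fract[of 0] in auto)

lemma laurent_power: "x \<in> laurent \<Longrightarrow> x ^ n \<in> laurent"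
  by (induction n) (use laurent_to_fract[of 1] in \<open>auto intro: laurent_mult\<close>)

lemma laurent_tw: "tw e C \<in> laurent"
  by (simp add: tw_def divide_inverse laurent_mult laurent_cst laurent_inverse_var laurent_var)

lemma laurent_inverse_tw: "inverse (tw e C) \<in> laurent"
proof (cases e)
  case True
  then have "inverse (tw e C) = cst (inverse C) * var"
    by (simp add: tw_def divide_inverse cst.hom_inverse)
  then show ?thesis by (simp add: laurent_mult laurent_cst laurent_var)
qed (simp add: tw_def laurent_inverse_var)

lemma laurent_evf:
  assumes "field_hom g" shows "evf g (tw e C) p \<in> laurent"
proof -
  interpret g: field_hom g by fact
  show ?thesis unfolding evf_def poly_altdef
    by (intro laurent_sum laurent_mult laurent_power laurent_tw)
       (simp add: coeff_map_poly laurent_cst)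
qed

lemma laurent_lft:
  assumes g: "field_hom g" and C: "C \<noteq> 0" and x: "x \<in> laurent"
  shows "lft g e C x \<in> laurent"
proof -
  interpret l: field_hom "lft g e C" by (rule field_hom_lft[OF g C])
  obtain r k where "x * var ^ k = to_fract r" using x by (auto simp: laurent_def)
  then have "lft g e C (x * var ^ k) = evf g (tw e C) r" using lft_to_fract[OF g C] by metis
  then have "lft g e C x * tw e C ^ k = evf g (tw e C) r"
    by (simp add: l.hom_mult l.hom_power lft_var[OF g C])
  moreover have "tw e C \<noteq> 0" using C by (simp add: tw_def)
  ultimately have "lft g e C x = evf g (tw e C) r * inverse (tw e C) ^ k"
    by (simp add: field_simps)
  then show ?thesis by (simp add: laurent_mult laurent_evf[OF g] laurent_power laurent_inverse_tw)
qed

lemma poly_split_X: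
  fixes r :: "'a::field poly" assumes "r \<noteq> 0"
  obtains a r0 where "r = [:0,1:] ^ a * r0" "poly r0 0 \<noteq> 0"
  using order_decomp[OF assms, of 0] by (auto simp: poly_eq_0_iff_dvd)

text \<open>Cleared of denominators, the two factors are polynomials whose product is a constant
  times a power of the variable. Splitting off their own powers of the variable leaves two
  polynomials with constant product, hence constants.\<close>

lemma laurent_unit:
  assumes x: "x \<in> laurent" and y: "y \<in> laurent" and xy: "x * y = cst m" and m: "m \<noteq> 0"
  obtains \<alpha> k where "\<alpha> \<noteq> 0" "x = cst \<alpha> * var powi k"
proof -
  obtain r i where r: "x * var ^ i = to_fract r" using x unfolding laurent_def by blast
  obtain r' j where r': "y * var ^ j = to_fract r'" using y unfolding laurent_def by blast
  have "to_fract (r * r') = x * y * var ^ (i + j)"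
    by (simp add: power_add flip: r r')
  also have "\<dots> = to_fract ([:m:] * [:0,1:] ^ (i + j))"
    unfolding xy by (simp add: to_fract_power var_def cst_def del: mult_pCons_left)
  finally have rr: "r * r' = [:m:] * [:0,1:] ^ (i + j)" by (simp only: to_fract_eq_iff)
  have "r * r' \<noteq> 0" unfolding rr using m by simp
  then have "r \<noteq> 0" "r' \<noteq> 0" by auto
  obtain a r0 where a: "r = [:0,1:] ^ a * r0" "poly r0 0 \<noteq> 0"
    using poly_split_X[OF \<open>r \<noteq> 0\<close>] .
  obtain b r0' where b: "r' = [:0,1:] ^ b * r0'" "poly r0' 0 \<noteq> 0"
    using poly_split_X[OF \<open>r' \<noteq> 0\<close>] .
  have e: "[:0,1:] ^ (a + b) * (r0 * r0') = [:0,1:] ^ (i + j) * [:m:]"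
    using rr a b by (simp add: power_add mult_ac)
  have X: "([:0,1:] :: 'a poly) ^ n \<noteq> 0" for n by simp
  \<comment> \<open>Evaluation at 0 excludes that a power of the variable remains on either
    side.\<close>
  have "a + b = i + j"
  proof (rule linorder_cases)
    assume l: "a + b < i + j"
    then have "([:0,1:] :: 'a poly) ^ (i + j) = [:0,1:] ^ (a + b) * [:0,1:] ^ (i + j - a - b)"
      by (simp flip: power_add)
    then have "[:0,1:] ^ (a + b) * (r0 * r0') = [:0,1:] ^ (a + b) * ([:0,1:] ^ (i + j - a - b) * [:m:])"
      using e by (simp only: mult.assoc)
    then have "r0 * r0' = [:0,1:] ^ (i + j - a - b) * [:m:]"
      using X mult_left_cancel by blast
    then have "poly (r0 * r0') 0 = poly ([:0,1:] ^ (i + j - a - b) * [:m:]) 0" by simp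
    then show ?thesis using a b l by (simp add: poly_power zero_power)
  next
    assume l: "a + b > i + j"
    then have "([:0,1:] :: 'a poly) ^ (a + b) = [:0,1:] ^ (i + j) * [:0,1:] ^ (a + b - i - j)"
      by (simp flip: power_add)
    then have "[:0,1:] ^ (i + j) * ([:0,1:] ^ (a + b - i - j) * (r0 * r0')) = [:0,1:] ^ (i + j) * [:m:]"
      using e by (simp only: mult.assoc)
    then have "[:0,1:] ^ (a + b - i - j) * (r0 * r0') = [:m:]"
      using X mult_left_cancel by blast
    then have "poly ([:0,1:] ^ (a + b - i - j) * (r0 * r0')) 0 = poly [:m:] 0" by simp
    then show ?thesis using m l by (simp add: poly_power zero_power)
  qed
  with e have "[:0,1:] ^ (i + j) * (r0 * r0') = [:0,1:] ^ (i + j) * [:m:]" by (simp only:)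
  then have u: "r0 * r0' = [:m:]" using X mult_left_cancel by blast
  have nz: "r0 \<noteq> 0" "r0' \<noteq> 0" using a b by auto
  then have "degree r0 + degree r0' = 0" using u by (metis degree_mult_eq degree_pCons_0)
  then obtain \<alpha> where al: "r0 = [:\<alpha>:]" by (meson add_is_0 degree_eq_zeroE)
  have "x * var ^ i = var ^ a * cst \<alpha>"
    unfolding r a(1) al by (simp add: to_fract_power var_def cst_def del: mult_pCons_right)
  then have "x = cst \<alpha> * var powi (int a - int i)"
    by (simp add: power_int_diff field_simps)
  moreover have "\<alpha> \<noteq> 0" using al nz by simp
  ultimately show thesis by (rule that[rotated])
qed

lemma cst_var_eqD:
  assumes e: "cst a * var powi i = cst b * var powi j" and a: "a \<noteq> 0"
  shows "i = j \<and> a = b"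
proof -
  \<comment> \<open>A shift that makes both exponents nonnegative turns the monomials into
    polynomials, where degrees and coefficients can be compared.\<close>
  define K where "K = \<bar>i\<bar> + \<bar>j\<bar>"
  have p: "cst c * var powi k * var powi K = to_fract (monom c (nat (k + K)))"
    if "k + K \<ge> 0" for c :: 'a and k
  proof -
    have "var powi k * var powi K = (var powi (k + K) :: 'a poly fract)"
      by (rule power_int_add[symmetric]) simp
    also have "\<dots> = var ^ nat (k + K)" using that by (simp add: power_int_def)
    finally show ?thesis by (simp add: to_fract_monom mult.assoc)
  qed
  have "monom a (nat (i + K)) = monom b (nat (j + K))"
    using p[of i a] p[of j b] e by (simp add: K_def)
  then have m: "monom a (nat (i + K)) = monom b (nat (j + K))" .
  then have "b \<noteq> 0" using a by (metis monom_eq_0_iff)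
  then have n: "nat (i + K) = nat (j + K)" using m a by (metis degree_monom_eq)
  then have "a = b" using m by simp
  moreover have "i + K \<ge> 0" "j + K \<ge> 0" by (auto simp: K_def)
  ultimately show ?thesis using n by simp
qed

text \<open>An element of least degree generates, by division with remainder. It is made monic
  because a monic generator is unique, which later forces it to be fixed by every automorphism that
  preserves the ideal.\<close>

lemma poly_ideal_generator:
  fixes I :: "'a::field poly set"
  assumes add: "\<And>p q. p \<in> I \<Longrightarrow> q \<in> I \<Longrightarrow> p + q \<in> I"
    and mult: "\<And>p q. p \<in> I \<Longrightarrow> q * p \<in> I" and nz: "p0 \<in> I" "p0 \<noteq> 0"
  obtains d where "d \<in> I" "lead_coeff d = 1" "\<And>p. p \<in> I \<Longrightarrow> d dvd p"
proof -
  obtain d0 where d0: "d0 \<in> I" "d0 \<noteq> 0" and min: "\<And>p. p \<in> I \<Longrightarrow> p \<noteq> 0 \<Longrightarrow> degree d0 \<le> degree p"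
    using ex_has_least_nat[of "\<lambda>p. p \<in> I \<and> p \<noteq> 0" p0 degree] nz by auto
  define d where "d = [:inverse (lead_coeff d0):] * d0"
  have "d \<in> I" unfolding d_def by (rule mult[OF d0(1)])
  moreover have "lead_coeff d = 1" using d0 by (simp add: d_def)
  moreover have "d dvd p" if p: "p \<in> I" for p
  proof -
    have "p mod d0 = p + (- (p div d0)) * d0" by (simp add: minus_div_mult_eq_mod[symmetric])
    then have "p mod d0 \<in> I" using p d0 add mult by metis
    then have "p mod d0 = 0"
      using min d0(2) degree_mod_less'[of d0 p] by (metis linorder_not_le)
    then have "d0 dvd p" by (simp add: mod_eq_0_iff_dvd)
    then show ?thesis unfolding d_def using d0 by (simp add: smult_dvd)
  qed
  ultimately show thesis using that by blast
qed

lemma monic_dvd_eq: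
  fixes p d :: "'a::field poly"
  assumes "lead_coeff p = 1" "lead_coeff d = 1" "d dvd p" "degree p = degree d"
  shows "p = d"
proof -
  obtain r where r: "p = d * r" using assms(3) by blast
  have "d \<noteq> 0" "r \<noteq> 0" using assms(1,2) r by auto
  then have "degree r = 0" using assms(4) r by (simp add: degree_mult_eq)
  then obtain a where "r = [:a:]" by (meson degree_eq_zeroE)
  moreover have "lead_coeff p = lead_coeff d * lead_coeff r" unfolding r by (rule lead_coeff_mult)
  ultimately have "r = 1" using assms(1,2) by (simp add: one_pCons)
  then show ?thesis using r by simp
qed

lemma field_hom_map_poly_monic:
  assumes "field_hom g"
  shows "degree (map_poly g p) = degree p" "lead_coeff p = 1 \<Longrightarrow> lead_coeff (map_poly g p) = 1"
proof -
  interpret g: field_hom g by fact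
  show "degree (map_poly g p) = degree p" "lead_coeff p = 1 \<Longrightarrow> lead_coeff (map_poly g p) = 1"
    by simp_all
qed

lemma lft_False_to_fract:
  assumes "field_hom g" "C \<noteq> 0"
  shows "lft g False C (to_fract p) = to_fract (map_poly g p)"
  using assms unfolding lft_to_fract[OF assms]
  by (simp add: evf_def tw_def to_fract_poly map_poly_map_poly comp_def field_hom_def idom_hom_def
      comm_ring_hom_def ring_hom_def semiring_hom_def comm_monoid_add_hom_def monoid_add_hom_def zero_hom_def)

context klein
begin

text \<open>The generator is a quotient \<open>p/d\<close>: \<open>d\<close> generates the ideal of
  common denominators of \<open>S\<close>, and \<open>p\<close> the ideal spanned by the numerators.
  \<open>N\<close> acts on coefficients and fixes \<open>S\<close>, so both ideals are preserved;
  degrees and the leading coefficient 1 are kept too, and the monic generators are therefore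
  fixed.\<close>

lemma fractional_ideal_generator:
  assumes C: "C \<noteq> 0" and S: "finite S" "x0 \<in> S" "x0 \<noteq> 0"
    and fixS: "S \<subseteq> Fix ((\<lambda>\<nu>. lft \<nu> False C) ` N)"
  obtains \<gamma> f where "\<gamma> \<in> Fix ((\<lambda>\<nu>. lft \<nu> False C) ` N)" "\<gamma> \<noteq> 0"
    "\<And>x. x \<in> S \<Longrightarrow> \<exists>r. x = \<gamma> * to_fract r" "\<gamma> = (\<Sum>x\<in>S. to_fract (f x) * x)"
proof -
  have l: "lft \<nu> False C (to_fract p) = to_fract (map_poly \<nu> p)" if "\<nu> \<in> N" for \<nu> p
    by (rule lft_False_to_fract[OF homN[OF that] C])
  have fx: "lft \<nu> False C x = x" if "\<nu> \<in> N" "x \<in> S" for \<nu> x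
    using fixS that by (auto simp: Fix_def)
  define J where "J = {p. \<forall>x\<in>S. \<exists>r. to_fract p * x = to_fract r}"
  have "\<exists>p\<in>J. p \<noteq> 0"
  proof -
    have "\<exists>p. p \<noteq> 0 \<and> (\<forall>x\<in>S. \<exists>r. to_fract p * x = to_fract r)" using S(1)
    proof (induction S rule: finite_induct)
      case (insert x F)
      then obtain p where p: "p \<noteq> 0" "\<forall>x\<in>F. \<exists>r. to_fract p * x = to_fract r" by blast
      obtain a b where x: "x = Fract a b" "b \<noteq> 0" by (metis Fract_cases)
      have "to_fract b * x = to_fract a" using x by (simp add: to_fract_def eq_fract)
      then have "to_fract (p * b) * x = to_fract (p * a)"
        by (simp only: to_fract_mult mult.assoc)
      moreover have "\<exists>r. to_fract (p * b) * y = to_fract r" if yF: "y \<in> F" for y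
      proof -
        obtain r where r: "to_fract p * y = to_fract r" using bspec[OF p(2) yF] by blast
        have "to_fract (p * b) * y = to_fract b * (to_fract p * y)" by (simp add: mult_ac)
        also have "\<dots> = to_fract (b * r)" unfolding r by simp
        finally show ?thesis by (rule exI)
      qed
      ultimately have "\<forall>y\<in>insert x F. \<exists>r. to_fract (p * b) * y = to_fract r" by blast
      moreover have "p * b \<noteq> 0" using p(1) x(2) by simp
      ultimately show ?case by (intro exI[of _ "p * b"] conjI)
    qed (auto intro: exI[of _ 1])
    then show ?thesis by (auto simp: J_def)
  qed
  then obtain p0 where p0: "p0 \<in> J" "p0 \<noteq> 0" by blast
  have Ja: "p + q \<in> J" if pq: "p \<in> J" "q \<in> J" for p q
    unfolding J_def
  proof clarify
    fix x assume "x \<in> S"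
    then obtain r r' where "to_fract p * x = to_fract r" "to_fract q * x = to_fract r'"
      using pq unfolding J_def by blast
    then have "to_fract (p + q) * x = to_fract (r + r')" by (simp add: distrib_right)
    then show "\<exists>r. to_fract (p + q) * x = to_fract r" by blast
  qed
  have Jm: "q * p \<in> J" if pq: "p \<in> J" for p q
    unfolding J_def
  proof clarify
    fix x assume "x \<in> S"
    then obtain r where "to_fract p * x = to_fract r" using pq unfolding J_def by blast
    then have "to_fract (q * p) * x = to_fract (q * r)"
      by (simp only: to_fract_mult mult.assoc)
    then show "\<exists>r. to_fract (q * p) * x = to_fract r" by blast
  qed
  obtain d where d: "d \<in> J" "lead_coeff d = 1" "\<And>p. p \<in> J \<Longrightarrow> d dvd p"
    using poly_ideal_generator[OF Ja Jm p0] by metis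
  have dfix: "map_poly \<nu> d = d" if n: "\<nu> \<in> N" for \<nu>
  proof -
    interpret n: field_hom "lft \<nu> False C" by (rule field_hom_lft[OF homN[OF n] C])
    have "map_poly \<nu> d \<in> J" unfolding J_def
    proof clarify
      fix x assume x: "x \<in> S"
      then obtain r where "to_fract d * x = to_fract r" using d unfolding J_def by blast
      then have "lft \<nu> False C (to_fract d * x) = to_fract (map_poly \<nu> r)" by (simp only: l[OF n])
      then have "to_fract (map_poly \<nu> d) * x = to_fract (map_poly \<nu> r)"
        by (simp only: n.hom_mult l[OF n] fx[OF n x])
      then show "\<exists>r. to_fract (map_poly \<nu> d) * x = to_fract r" by blast
    qed
    then show ?thesis
      by (intro monic_dvd_eq field_hom_map_poly_monic[OF homN[OF n]] d)
  qed
  define T where "T = {r. \<exists>f. to_fract r = to_fract d * (\<Sum>x\<in>S. to_fract (f x) * x)}"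
  obtain r0 where r0: "to_fract d * x0 = to_fract r0" using d(1) S(2) unfolding J_def by blast
  have "d \<noteq> 0" using d(2) by auto
  then have "r0 \<noteq> 0" using r0 S(3) by auto
  moreover have "r0 \<in> T"
  proof -
    have "(\<Sum>x\<in>S. to_fract (if x = x0 then 1 else 0) * x) = (\<Sum>x\<in>S. if x = x0 then x else 0)"
      by (intro sum.cong) auto
    also have "\<dots> = x0" using S by simp
    finally show ?thesis unfolding T_def using r0
      by (intro CollectI exI[of _ "\<lambda>x. if x = x0 then 1 else 0"]) simp
  qed
  moreover have "p + q \<in> T" if pq: "p \<in> T" "q \<in> T" for p q
  proof -
    obtain f g where "to_fract p = to_fract d * (\<Sum>x\<in>S. to_fract (f x) * x)"
      "to_fract q = to_fract d * (\<Sum>x\<in>S. to_fract (g x) * x)" using pq unfolding T_def by blast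
    then have "to_fract (p + q) = to_fract d * (\<Sum>x\<in>S. to_fract (f x + g x) * x)"
      by (simp add: distrib_right distrib_left sum.distrib)
    then show ?thesis unfolding T_def by (intro CollectI exI[of _ "\<lambda>x. f x + g x"])
  qed
  moreover have "q * p \<in> T" if pq: "p \<in> T" for p q
  proof -
    obtain f where "to_fract p = to_fract d * (\<Sum>x\<in>S. to_fract (f x) * x)"
      using pq unfolding T_def by blast
    then have "to_fract (q * p) = to_fract d * (\<Sum>x\<in>S. to_fract (q * f x) * x)"
      by (simp add: sum_distrib_left mult_ac)
    then show ?thesis unfolding T_def by (intro CollectI exI[of _ "\<lambda>x. q * f x"])
  qed
  ultimately obtain p where p: "p \<in> T" "lead_coeff p = 1" "\<And>q. q \<in> T \<Longrightarrow> p dvd q"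
    using poly_ideal_generator[of T r0 thesis] by metis
  have pfix: "map_poly \<nu> p = p" if n: "\<nu> \<in> N" for \<nu>
  proof -
    interpret n: field_hom "lft \<nu> False C" by (rule field_hom_lft[OF homN[OF n] C])
    obtain f where "to_fract p = to_fract d * (\<Sum>x\<in>S. to_fract (f x) * x)"
      using p unfolding T_def by blast
    then have "lft \<nu> False C (to_fract p) = lft \<nu> False C (to_fract d * (\<Sum>x\<in>S. to_fract (f x) * x))"
      by simp
    then have "to_fract (map_poly \<nu> p) = to_fract d * (\<Sum>x\<in>S. to_fract (map_poly \<nu> (f x)) * x)"
      by (simp add: n.hom_mult n.hom_sum l[OF n] fx[OF n] dfix[OF n])
    then have "map_poly \<nu> p \<in> T"
      unfolding T_def by (intro CollectI exI[of _ "\<lambda>x. map_poly \<nu> (f x)"])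
    then show ?thesis
      by (intro monic_dvd_eq field_hom_map_poly_monic[OF homN[OF n]] p)
  qed
  obtain f where f: "to_fract p = to_fract d * (\<Sum>x\<in>S. to_fract (f x) * x)"
    using p unfolding T_def by blast
  define \<gamma> where "\<gamma> = to_fract p / to_fract d"
  have p0: "p \<noteq> 0" using p(2) by auto
  show thesis
  proof
    show "\<gamma> \<noteq> 0" using p0 \<open>d \<noteq> 0\<close> by (simp add: \<gamma>_def)
    show "\<gamma> = (\<Sum>x\<in>S. to_fract (f x) * x)" using \<open>d \<noteq> 0\<close> by (simp add: \<gamma>_def f)
    show "\<gamma> \<in> Fix ((\<lambda>\<nu>. lft \<nu> False C) ` N)"
      unfolding Fix_def
    proof clarify
      fix \<nu> assume n: "\<nu> \<in> N"
      interpret n: field_hom "lft \<nu> False C" by (rule field_hom_lft[OF homN[OF n] C])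
      show "lft \<nu> False C \<gamma> = \<gamma>" by (simp add: \<gamma>_def n.hom_div l[OF n] pfix[OF n] dfix[OF n])
    qed
    fix x assume x: "x \<in> S"
    then obtain r where r: "to_fract d * x = to_fract r" using d(1) unfolding J_def by blast
    have "(\<Sum>y\<in>S. to_fract (if y = x then 1 else 0) * y) = (\<Sum>y\<in>S. if y = x then y else 0)"
      by (intro sum.cong) auto
    also have "\<dots> = x" using S x by simp
    finally have "r \<in> T" unfolding T_def using r
      by (intro CollectI exI[of _ "\<lambda>y. if y = x then 1 else 0"]) simp
    then obtain r' where "r = p * r'" using p(3) by blast
    then have "x = \<gamma> * to_fract r'" using r \<open>d \<noteq> 0\<close> by (simp add: \<gamma>_def field_simps)
    then show "\<exists>r. x = \<gamma> * to_fract r" by blast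
  qed
qed

text \<open>Multiplication by \<open>b\<close> after \<open>s1\<close> and by \<open>w\<close> after
  \<open>s2\<close> are semilinear operators; the hypotheses say that they commute and that their
  squares are the scalars \<open>m1\<close> and \<open>m2\<close>. A fractional ideal stable under
  both has a generator \<open>\<gamma>\<close>, and rescaling by \<open>\<gamma>\<close> turns
  \<open>b\<close> and \<open>w\<close> into units of the Laurent ring, that is, into monomials.
  Comparing exponents and coefficients in the relations gives the same kind of data over the smaller
  field, with powers of \<open>C\<close> wherever the variable is inverted.\<close>

lemma descent_step:
  assumes C: "C \<noteq> 0" "s1 C = C" "s2 C = C" "C \<in> Fix N"
    and b: "b \<in> Fix ((\<lambda>\<nu>. lft \<nu> False C) ` N)" "b \<noteq> 0"
    and w: "w \<in> Fix ((\<lambda>\<nu>. lft \<nu> False C) ` N)" "w \<noteq> 0"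
    and bb: "b * lft s1 e1 C b = cst m1" and ww: "w * lft s2 e2 C w = cst m2"
    and bw: "b * lft s1 e1 C w = w * lft s2 e2 C b"
  obtains b' w' k l where "b' \<in> Fix N" "b' \<noteq> 0" "w' \<in> Fix N" "w' \<noteq> 0"
    "e1 \<or> k = 0" "e2 \<or> l = 0" "e1 \<and> e2 \<longrightarrow> k = l"
    "b' * s1 b' * C powi k = m1" "w' * s2 w' * C powi l = m2" "b' * s1 w' = w' * s2 b'"
proof -
  let ?N = "(\<lambda>\<nu>. lft \<nu> False C) ` N"
  let ?s1 = "lft s1 e1 C" and ?s2 = "lft s2 e2 C"
  interpret K: klein ?s1 ?s2 ?N by (rule klein_lft[OF C])
  interpret h1: field_hom ?s1 by (rule K.hom1)
  interpret h2: field_hom ?s2 by (rule K.hom2)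
  interpret g1: field_hom s1 by (rule hom1)
  interpret g2: field_hom s2 by (rule hom2)
  have "cst m1 \<noteq> 0" unfolding bb[symmetric] using b(2) by simp
  then have m1: "m1 \<noteq> 0" by simp
  have "cst m2 \<noteq> 0" unfolding ww[symmetric] using w(2) by simp
  then have m2: "m2 \<noteq> 0" by simp
  \<comment> \<open>The orbit of 1 under the two operators, up to scalars: it spans a module stable
    under both.\<close>
  define S where "S = {1, b, w, b * ?s1 w}"
  have one: "1 \<in> Fix ?N"
    unfolding Fix_def
  proof clarify
    fix \<nu> assume n: "\<nu> \<in> N"
    interpret n: field_hom "lft \<nu> False C" by (rule field_hom_lft[OF homN[OF n] C(1)])
    show "lft \<nu> False C 1 = 1" by simp
  qed
  have fm: "x * y \<in> Fix ?N" if "x \<in> Fix ?N" "y \<in> Fix ?N" for x y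
    unfolding Fix_def
  proof clarify
    fix \<nu> assume n: "\<nu> \<in> N"
    interpret n: field_hom "lft \<nu> False C" by (rule field_hom_lft[OF homN[OF n] C(1)])
    show "lft \<nu> False C (x * y) = x * y" using that n by (simp add: n.hom_mult Fix_def)
  qed
  have SF: "S \<subseteq> Fix ?N" using one b w K.Fix_s1[OF w(1)] fm by (auto simp: S_def)
  obtain \<gamma> f where g: "\<gamma> \<in> Fix ?N" "\<gamma> \<noteq> 0"
    and Sg: "\<And>x. x \<in> S \<Longrightarrow> \<exists>r. x = \<gamma> * to_fract r" and gS: "\<gamma> = (\<Sum>x\<in>S. to_fract (f x) * x)"
    by (rule fractional_ideal_generator[OF C(1), of S 1]) (use SF in \<open>auto simp: S_def\<close>)
  define M where "M = (\<lambda>x. \<gamma> * x) ` laurent"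
  have SM: "x \<in> M" if "x \<in> S" for x using Sg[OF that] laurent_to_fract by (auto simp: M_def)
  have cM: "cst c * x \<in> M" if "x \<in> M" for c x
    using that laurent_mult[OF laurent_cst[of c]] unfolding M_def by (auto simp: mult.left_commute)
  have sumM: "(\<Sum>x\<in>S. g x * h x) \<in> M" if gl: "\<And>x. x \<in> S \<Longrightarrow> g x \<in> laurent"
    and hM: "\<And>x. x \<in> S \<Longrightarrow> h x \<in> M" for g h
  proof -
    have "\<forall>x\<in>S. \<exists>y\<in>laurent. h x = \<gamma> * y" using hM unfolding M_def by blast
    then obtain y where y: "\<And>x. x \<in> S \<Longrightarrow> y x \<in> laurent" "\<And>x. x \<in> S \<Longrightarrow> h x = \<gamma> * y x"
      by metis
    have "(\<Sum>x\<in>S. g x * h x) = \<gamma> * (\<Sum>x\<in>S. g x * y x)"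
      unfolding sum_distrib_left by (intro sum.cong refl) (simp add: y mult_ac)
    moreover have "(\<Sum>x\<in>S. g x * y x) \<in> laurent"
      by (intro laurent_sum laurent_mult gl y)
    ultimately show ?thesis unfolding M_def by blast
  qed
  have i1: "?s1 (?s1 x) = x" "?s2 (?s2 x) = x" "?s1 (?s2 x) = ?s2 (?s1 x)" if "x \<in> Fix ?N" for x
    using K.Fix_invol[OF that] .
  \<comment> \<open>The operators permute the elements of \<open>S\<close> up to constants.\<close>
  have b1: "b * ?s1 x \<in> M" if "x \<in> S" for x
  proof -
    have "b * ?s1 1 \<in> M" using SM[of b] by (simp add: S_def)
    moreover have "b * ?s1 b \<in> M" using cM[OF SM[of 1], of m1] bb by (simp add: S_def)
    moreover have "b * ?s1 w \<in> M" using SM[of "b * ?s1 w"] by (simp add: S_def)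
    moreover have "b * ?s1 (b * ?s1 w) = cst m1 * w"
      by (simp add: h1.hom_mult i1 w bb[symmetric] mult_ac)
    then have "b * ?s1 (b * ?s1 w) \<in> M" using cM[OF SM[of w], of m1] by (simp add: S_def)
    ultimately show ?thesis using that by (auto simp: S_def)
  qed
  have w1: "w * ?s2 x \<in> M" if "x \<in> S" for x
  proof -
    have "w * ?s2 1 \<in> M" using SM[of w] by (simp add: S_def)
    moreover have "w * ?s2 b \<in> M" using SM[of "b * ?s1 w"] bw by (simp add: S_def)
    moreover have "w * ?s2 w \<in> M" using cM[OF SM[of 1], of m2] ww by (simp add: S_def)
    moreover have "w * ?s2 (b * ?s1 w) = (w * ?s2 b) * ?s2 (?s1 w)"
      by (simp add: h2.hom_mult)
    then have "w * ?s2 (b * ?s1 w) = b * ?s1 w * ?s1 (?s2 w)"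
      by (simp only: bw[symmetric] i1(3)[OF w(1)])
    then have "w * ?s2 (b * ?s1 w) = b * ?s1 (w * ?s2 w)" by (simp add: h1.hom_mult mult_ac)
    then have "w * ?s2 (b * ?s1 w) = cst (s1 m2) * b"
      unfolding ww lft_cst[OF hom1 C(1)] by (simp add: mult_ac)
    then have "w * ?s2 (b * ?s1 w) \<in> M" using cM[OF SM[of b], of "s1 m2"] by (simp add: S_def)
    ultimately show ?thesis using that by (auto simp: S_def)
  qed
  \<comment> \<open>\<open>\<gamma>\<close> is a combination of \<open>S\<close> with polynomial
    coefficients. The inversion of the variable turns these into Laurent polynomials, which is why
    \<open>M\<close> is taken over that ring.\<close>
  have "b * ?s1 \<gamma> = (\<Sum>x\<in>S. ?s1 (to_fract (f x)) * (b * ?s1 x))"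
    by (subst gS) (simp add: h1.hom_sum h1.hom_mult sum_distrib_left mult_ac)
  then have "b * ?s1 \<gamma> \<in> M"
    using sumM[of "\<lambda>x. ?s1 (to_fract (f x))" "\<lambda>x. b * ?s1 x"] b1
      laurent_lft[OF hom1 C(1) laurent_to_fract] by simp
  then obtain \<rho>1 where r1: "\<rho>1 \<in> laurent" "b * ?s1 \<gamma> = \<gamma> * \<rho>1" unfolding M_def by blast
  have "w * ?s2 \<gamma> = (\<Sum>x\<in>S. ?s2 (to_fract (f x)) * (w * ?s2 x))"
    by (subst gS) (simp add: h2.hom_sum h2.hom_mult sum_distrib_left mult_ac)
  then have "w * ?s2 \<gamma> \<in> M"
    using sumM[of "\<lambda>x. ?s2 (to_fract (f x))" "\<lambda>x. w * ?s2 x"] w1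
      laurent_lft[OF hom2 C(1) laurent_to_fract] by simp
  then obtain \<rho>2 where r2: "\<rho>2 \<in> laurent" "w * ?s2 \<gamma> = \<gamma> * \<rho>2" unfolding M_def by blast
  have q1: "\<rho>1 = b * ?s1 \<gamma> / \<gamma>" and q2: "\<rho>2 = w * ?s2 \<gamma> / \<gamma>"
    using r1 r2 g(2) by (simp_all add: field_simps)
  have gs: "?s1 \<gamma> \<noteq> 0" "?s2 \<gamma> \<noteq> 0" "?s1 (?s2 \<gamma>) \<noteq> 0" using g(2) by auto
  \<comment> \<open>\<open>\<rho>1\<close> and \<open>\<rho>2\<close> differ from \<open>b\<close>
    and \<open>w\<close> by a coboundary, so the three relations carry over. The first two make them
    units.\<close>
  have rr1: "\<rho>1 * ?s1 \<rho>1 = cst m1"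
    unfolding q1 bb[symmetric] using g gs by (simp add: h1.hom_mult h1.hom_div i1)
  have rr2: "\<rho>2 * ?s2 \<rho>2 = cst m2"
    unfolding q2 ww[symmetric] using g gs by (simp add: h2.hom_mult h2.hom_div i1)
  have rr12: "\<rho>1 * ?s1 \<rho>2 = \<rho>2 * ?s2 \<rho>1"
  proof -
    have "\<rho>1 * ?s1 \<rho>2 = (b * ?s1 w) * ?s1 (?s2 \<gamma>) / \<gamma>"
      unfolding q1 q2 using g gs by (simp add: h1.hom_mult h1.hom_div)
    also have "\<dots> = \<rho>2 * ?s2 \<rho>1"
      unfolding q1 q2 bw using g gs by (simp add: h2.hom_mult h2.hom_div i1)
    finally show ?thesis .
  qed
  obtain \<alpha> k where a: "\<alpha> \<noteq> 0" "\<rho>1 = cst \<alpha> * var powi k"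
    using laurent_unit[OF r1(1) laurent_lft[OF hom1 C(1) r1(1)] rr1 m1] .
  obtain \<beta> l where be: "\<beta> \<noteq> 0" "\<rho>2 = cst \<beta> * var powi l"
    using laurent_unit[OF r2(1) laurent_lft[OF hom2 C(1) r2(1)] rr2 m2] .
  have fixc: "\<alpha> \<in> Fix N" if al: "\<alpha> \<noteq> 0" "cst \<alpha> * var powi k \<in> Fix ?N" for \<alpha> k
    unfolding Fix_def
  proof clarify
    fix \<nu> assume n: "\<nu> \<in> N"
    interpret n: field_hom "lft \<nu> False C" by (rule field_hom_lft[OF homN[OF n] C(1)])
    have "lft \<nu> False C (cst \<alpha> * var powi k) = cst (\<nu> \<alpha>) * var powi k"
      by (simp add: n.hom_mult lft_cst[OF homN[OF n] C(1)] power_int_def n.hom_power n.hom_inverse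
          lft_var[OF homN[OF n] C(1)] tw_def)
    then have "cst \<alpha> * var powi k = cst (\<nu> \<alpha>) * var powi k"
      using al n by (simp add: Fix_def)
    then show "\<nu> \<alpha> = \<alpha>" using cst_var_eqD[OF _ al(1)] by metis
  qed
  have fd: "x / y \<in> Fix ?N" if "x \<in> Fix ?N" "y \<in> Fix ?N" for x y
    unfolding Fix_def
  proof clarify
    fix \<nu> assume n: "\<nu> \<in> N"
    interpret n: field_hom "lft \<nu> False C" by (rule field_hom_lft[OF homN[OF n] C(1)])
    show "lft \<nu> False C (x / y) = x / y" using that n by (simp add: n.hom_div Fix_def)
  qed
  have aF: "\<alpha> \<in> Fix N"
    using fixc[OF a(1)] a(2) q1 fd fm b(1) g(1) K.Fix_s1[OF g(1)] by metis
  have bF: "\<beta> \<in> Fix N"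
    using fixc[OF be(1)] be(2) q2 fd fm w(1) g(1) K.Fix_s2[OF g(1)] by metis
  have tw: "tw e C powi i = (if e then cst (C powi i) * var powi (- i) else var powi i)" for e i
    by (simp add: tw_def power_int_divide_distrib power_int_minus divide_inverse cst.hom_mult)
       (simp add: power_int_def cst.hom_power cst.hom_inverse power_mult_distrib power_inverse)
  have s1p: "?s1 (cst x * var powi i) = cst (s1 x) * tw e1 C powi i" for x i
    by (simp add: h1.hom_mult lft_cst[OF hom1 C(1)] power_int_def h1.hom_power h1.hom_inverse
        lft_var[OF hom1 C(1)])
  have s2p: "?s2 (cst x * var powi i) = cst (s2 x) * tw e2 C powi i" for x i
    by (simp add: h2.hom_mult lft_cst[OF hom2 C(1)] power_int_def h2.hom_power h2.hom_inverse
        lft_var[OF hom2 C(1)])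
  have v2: "var powi (i * 2) = (var powi i * var powi i :: 'a poly fract)" for i
    unfolding mult_2_right by (rule power_int_add) simp
  \<comment> \<open>If the variable is inverted, its exponents cancel and \<open>C\<close> to the
    power \<open>k\<close> remains; otherwise the exponent is \<open>2 * k\<close> and must
    vanish.\<close>
  have E1: "cst (\<alpha> * s1 \<alpha> * (if e1 then C powi k else 1)) * var powi (if e1 then 0 else 2 * k)
      = cst m1 * var powi 0"
  proof (cases e1)
    case True
    then show ?thesis using rr1 unfolding a(2) s1p tw
      by (simp add: cst.hom_mult power_int_minus field_simps)
  next
    case False
    then show ?thesis using rr1 unfolding a(2) s1p tw
      by (simp add: cst.hom_mult v2 mult_ac)
  qed
  have E2: "cst (\<beta> * s2 \<beta> * (if e2 then C powi l else 1)) * var powi (if e2 then 0 else 2 * l)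
      = cst m2 * var powi 0"
  proof (cases e2)
    case True
    then show ?thesis using rr2 unfolding be(2) s2p tw
      by (simp add: cst.hom_mult power_int_minus field_simps)
  next
    case False
    then show ?thesis using rr2 unfolding be(2) s2p tw
      by (simp add: cst.hom_mult v2 mult_ac)
  qed
  \<comment> \<open>With both flags set the exponents are \<open>k - l\<close> and
    \<open>l - k\<close>, whose equality gives \<open>k = l\<close>.\<close>
  have E3: "cst (\<alpha> * s1 \<beta> * (if e1 then C powi l else 1)) * var powi (if e1 then k - l else k + l)
     = cst (\<beta> * s2 \<alpha> * (if e2 then C powi k else 1)) * var powi (if e2 then l - k else l + k)"
  proof -
    have "cst (\<alpha> * s1 \<beta> * (if e1 then C powi l else 1)) * var powi (if e1 then k - l else k + l)
      = \<rho>1 * ?s1 \<rho>2"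
      unfolding a(2) be(2) s1p tw
      by (cases e1) (simp_all add: cst.hom_mult mult_ac power_int_minus power_int_diff power_int_add
          divide_inverse)
    moreover have "cst (\<beta> * s2 \<alpha> * (if e2 then C powi k else 1)) * var powi (if e2 then l - k else l + k)
      = \<rho>2 * ?s2 \<rho>1"
      unfolding a(2) be(2) s2p tw
      by (cases e2) (simp_all add: cst.hom_mult mult_ac power_int_minus power_int_diff power_int_add
          divide_inverse)
    ultimately show ?thesis using rr12 by simp
  qed
  have nz: "\<alpha> * s1 \<alpha> * (if e1 then C powi k else 1) \<noteq> 0" "\<beta> * s2 \<beta> * (if e2 then C powi l else 1) \<noteq> 0"
    "\<alpha> * s1 \<beta> * (if e1 then C powi l else 1) \<noteq> 0"
    using a(1) be(1) C(1) by auto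
  note D1 = cst_var_eqD[OF E1 nz(1)] and D2 = cst_var_eqD[OF E2 nz(2)] and D3 = cst_var_eqD[OF E3 nz(3)]
  have k: "e1 \<or> k = 0" using D1 by (auto split: if_splits)
  have l: "e2 \<or> l = 0" using D2 by (auto split: if_splits)
  show thesis
  proof
    show "\<alpha> \<in> Fix N" "\<alpha> \<noteq> 0" "\<beta> \<in> Fix N" "\<beta> \<noteq> 0" by (fact aF a(1) bF be(1))+
    show "e1 \<or> k = 0" "e2 \<or> l = 0" by (fact k l)+
    show kl: "e1 \<and> e2 \<longrightarrow> k = l" using D3 by auto
    show "\<alpha> * s1 \<alpha> * C powi k = m1" using D1 k by (auto split: if_splits)
    show "\<beta> * s2 \<beta> * C powi l = m2" using D2 l by (auto split: if_splits)
    show "\<alpha> * s1 \<beta> = \<beta> * s2 \<alpha>" using D3 k l kl C(1) by (auto split: if_splits)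
  qed
qed

end

section \<open>A tower of conics\<close>

lemma order_map_poly_fixed:
  assumes g: "field_hom g" and a: "g a = a" and p: "p \<noteq> 0"
  shows "order a (map_poly g p) = order a p"
proof -
  interpret g: field_hom g by fact
  interpret m: map_poly_comm_ring_hom g by unfold_locales
  obtain r where r: "p = [:- a, 1:] ^ order a p * r" "\<not> [:- a, 1:] dvd r"
    using order_decomp[OF p] by blast
  have l: "map_poly g [:- a, 1:] = [:- a, 1:]"
    by (simp add: g.map_poly_pCons_hom g.hom_uminus a)
  have e: "map_poly g p = [:- a, 1:] ^ order a p * map_poly g r"
    by (subst r(1)) (simp only: m.hom_mult m.hom_power l)
  have "poly r a \<noteq> 0" using r(2) by (simp add: poly_eq_0_iff_dvd)
  then have "poly (map_poly g r) (g a) \<noteq> 0" by simp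
  then have "\<not> [:- a, 1:] dvd map_poly g r" by (simp add: a poly_eq_0_iff_dvd)
  then have "order a (map_poly g r) = 0" by (meson order_0I poly_eq_0_iff_dvd)
  moreover have "map_poly g p \<noteq> 0" using p by simp
  ultimately show ?thesis unfolding e by (simp add: order_mult order_power_n_n)
qed

text \<open>The map \<open>g\<close> of the coefficients fixes the points \<open>0\<close> and
  \<open>1\<close>, so it preserves the orders there, and \<open>b\<close> times its conjugate has
  even order at both.\<close>

lemma even_exponents:
  fixes b :: "'a::field poly fract"
  assumes g: "field_hom g" and b: "b \<noteq> 0" and c: "c \<noteq> 0"
    and e: "b * lft g False 1 b = cst c * var powi i * (var - 1) powi j"
  shows "even i \<and> even j"
proof -
  interpret g: field_hom g by fact
  interpret l: field_hom "lft g False 1" by (rule field_hom_lft[OF g]) simp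
  obtain p q where pq: "b = Fract p q" "q \<noteq> 0" by (metis Fract_cases)
  then have bq: "b = to_fract p / to_fract q" by (simp add: to_fract_def)
  have p: "p \<noteq> 0" using b bq by auto
  obtain i1 i2 where i: "i = int i1 - int i2" by (metis int_diff_cases)
  obtain j1 j2 where j: "j = int j1 - int j2" by (metis int_diff_cases)
  let ?X = "[:0, 1:] :: 'a poly" and ?Y = "[:- 1, 1:] :: 'a poly"
  have X: "var = to_fract ?X" by (simp add: var_def)
  have Y: "var - 1 = to_fract ?Y"
    unfolding X to_fract_1[symmetric] to_fract_diff[symmetric] by (simp add: one_pCons)
  have y0: "to_fract ?Y \<noteq> 0" by simp
  have lf: "lft g False 1 (to_fract r) = to_fract (map_poly g r)" for r
    by (rule lft_False_to_fract[OF g]) simp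
  have lq: "lft g False 1 b = to_fract (map_poly g p) / to_fract (map_poly g q)"
    unfolding bq l.hom_div lf ..
  have vi: "var powi i = to_fract (?X ^ i1) / to_fract (?X ^ i2)"
    unfolding i X by (simp add: power_int_diff to_fract_power)
  have vj: "(var - 1) powi j = to_fract (?Y ^ j1) / to_fract (?Y ^ j2)"
    unfolding j Y using y0 by (simp add: power_int_diff to_fract_power)
  have nz: "to_fract q \<noteq> 0" "to_fract (map_poly g q) \<noteq> 0"
    "to_fract (?X ^ i2) \<noteq> 0" "to_fract (?Y ^ j2) \<noteq> 0"
    using pq by simp_all
  have fe: "P * P' * x2 * y2 = d * (Q * Q' * x1 * y1)"
    if "P / Q * (P' / Q') = d * (x1 / x2) * (y1 / y2)" "Q \<noteq> 0" "Q' \<noteq> 0" "x2 \<noteq> 0" "y2 \<noteq> 0"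
    for P P' Q Q' d x1 x2 y1 y2 :: "'a poly fract"
    using that by (simp add: field_simps)
  have "to_fract (p * map_poly g p * ?X ^ i2 * ?Y ^ j2)
      = to_fract ([:c:] * (q * map_poly g q * ?X ^ i1 * ?Y ^ j1))"
    using fe[OF _ nz] e unfolding lq vi vj unfolding bq to_fract_mult cst_def by blast
  then have E: "p * map_poly g p * ?X ^ i2 * ?Y ^ j2 = [:c:] * (q * map_poly g q * ?X ^ i1 * ?Y ^ j1)"
    by (simp only: to_fract_eq_iff)
  have mp: "map_poly g p \<noteq> 0" "map_poly g q \<noteq> 0" using p pq by simp_all
  have oX: "order 0 (?X ^ n) = n" "order 1 (?Y ^ n) = n" for n
    using order_power_n_n[of 0 n] order_power_n_n[of 1 n] by simp_all
  have oY: "order 0 (?Y ^ n) = 0" "order 1 (?X ^ n) = 0" "order x [:c:] = 0" for n x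
    using c by (auto intro!: order_0I simp: poly_power)
  have om: "order a (p * map_poly g p * ?X ^ i2 * ?Y ^ j2)
      = order a p + order a (map_poly g p) + order a (?X ^ i2) + order a (?Y ^ j2)"
    "order a ([:c:] * (q * map_poly g q * ?X ^ i1 * ?Y ^ j1)) = order a [:c:] +
      (order a q + order a (map_poly g q) + order a (?X ^ i1) + order a (?Y ^ j1))" for a
    using p mp pq c by (simp_all add: order_mult del: mult_pCons_left mult_pCons_right)
  have "order 0 p + order 0 p + i2 = order 0 q + order 0 q + i1"
    using om[of 0] unfolding E order_map_poly_fixed[OF g g.hom_zero p]
      order_map_poly_fixed[OF g g.hom_zero pq(2)] oX oY by simp
  moreover have "order 1 p + order 1 p + j2 = order 1 q + order 1 q + j1"
    using om[of 1] unfolding E order_map_poly_fixed[OF g g.hom_one p]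
      order_map_poly_fixed[OF g g.hom_one pq(2)] oX oY by simp
  ultimately show ?thesis unfolding i j by presburger
qed

lemma cst_power_int: "cst (x powi k) = cst x powi k"
  by (simp add: power_int_def cst.hom_power cst.hom_inverse)

lemma cst_cancel_power_int:
  assumes "x * cst D powi k = cst m" "D \<noteq> 0" shows "x = cst (m * D powi (- k))"
proof -
  have "cst D powi k * cst D powi (- k) = 1"
    using assms(2) by (simp flip: power_int_add)
  then have "x = x * cst D powi k * cst D powi (- k)" by (simp add: mult.assoc)
  also have "\<dots> = cst (m * D powi (- k))"
    unfolding assms(1) cst.hom_mult cst_power_int ..
  finally show ?thesis .
qed

abbreviation lftN :: "('a::field \<Rightarrow> 'a) set \<Rightarrow> 'a \<Rightarrow> ('a poly fract \<Rightarrow> 'a poly fract) set" where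
  "lftN N C \<equiv> (\<lambda>\<nu>. lft \<nu> False C) ` N"

abbreviation conA :: "'a::field poly fract" where "conA \<equiv> var"
definition conB :: "'a::field poly fract" where "conB = var - 1"
text \<open>\<open>A * B * C = 1\<close> gives the special point of the torus product 1. As
  \<open>A\<close> and \<open>B\<close> vanish at different places, the parities of their exponents
  can be read off separately.\<close>

definition conC :: "'a::field poly fract" where "conC = inverse (conA * conB)"

type_synonym 'a tower = "'a poly fract poly fract poly fract poly fract"

text \<open>From the inside outwards the four levels adjoin \<open>A\<close>, \<open>v_1\<close>,
  \<open>v_2\<close>, \<open>v_3\<close>; the flags tell which of the last three is inverted. So
  \<open>s1\<close> acts with the flags \<open>False True True\<close>, \<open>s2\<close> with
  \<open>True False True\<close>, and \<open>N\<close> with all three \<open>False\<close>.\<close>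

definition tower :: "bool \<Rightarrow> bool \<Rightarrow> bool \<Rightarrow> ('a::field \<Rightarrow> 'a) \<Rightarrow> 'a tower \<Rightarrow> 'a tower" where
  "tower e1 e2 e3 g = lft (lft (lft (lft g False 1) e1 conA) e2 (cst conB)) e3 (cst (cst conC))"

lemma conB_nonzero [simp]: "(conB :: 'a::field poly fract) \<noteq> 0"
proof -
  have "conB = (to_fract [:-1, 1:] :: 'a poly fract)"
    unfolding conB_def var_def to_fract_1[symmetric] to_fract_diff[symmetric] by (simp add: one_pCons)
  then show ?thesis by (metis pCons_eq_0_iff one_neq_zero to_fract_eq_0_iff)
qed

lemma conC_nonzero [simp]: "(conC :: 'a::field poly fract) \<noteq> 0"
  by (simp add: conC_def)

lemma lft_var_diff:
  assumes "field_hom g"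
  shows "lft g False 1 conA = conA" "lft g False 1 conB = conB" "lft g False 1 conC = conC"
proof -
  interpret l: field_hom "lft g False 1" by (rule field_hom_lft[OF assms]) simp
  show "lft g False 1 conA = conA" by (simp add: lft_var assms tw_def)
  then show B: "lft g False 1 conB = conB" by (simp add: conB_def l.hom_minus)
  show "lft g False 1 conC = conC"
    unfolding conC_def l.hom_inverse l.hom_mult B by (simp add: lft_var assms tw_def)
qed

context klein
begin

text \<open>One application of \<open>klein_lft\<close> per level; the intermediate levels are
  recorded because the elimination visits them one at a time.\<close>

lemma klein_tower:
  shows klein_tower0: "klein (lft s1 False 1) (lft s2 False 1) (lftN N 1)"
    and klein_tower1: "klein (lft (lft s1 False 1) False conA) (lft (lft s2 False 1) True conA)
      (lftN (lftN N 1) conA)"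
    and klein_tower2: "klein (lft (lft (lft s1 False 1) False conA) True (cst conB))
      (lft (lft (lft s2 False 1) True conA) False (cst conB))
      (lftN (lftN (lftN N 1) conA) (cst conB))"
    and klein_tower3: "klein (tower False True True s1) (tower True False True s2)
      (tower False False False ` N)"
    and conA_Fix: "conA \<in> Fix (lftN N 1)" and conB_Fix: "cst conB \<in> Fix (lftN (lftN N 1) conA)"
    and conC_Fix: "cst (cst conC) \<in> Fix (lftN (lftN (lftN N 1) conA) (cst conB))"
proof -
  have one: "1 \<in> Fix N" "s1 1 = 1" "s2 1 = 1"
  proof -
    interpret h1: field_hom s1 by (rule hom1)
    interpret h2: field_hom s2 by (rule hom2)
    show "s1 1 = 1" "s2 1 = 1" by simp_all
    show "1 \<in> Fix N" unfolding Fix_def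
    proof clarify
      fix \<nu> assume "\<nu> \<in> N"
      then interpret n: field_hom \<nu> by (rule homN)
      show "\<nu> 1 = 1" by simp
    qed
  qed
  show K0: "klein (lft s1 False 1) (lft s2 False 1) (lftN N 1)"
    by (rule klein_lft) (use one in auto)
  interpret K0: klein "lft s1 False 1" "lft s2 False 1" "lftN N 1" by (rule K0)
  have F: "conA \<in> Fix (lftN N 1)" "conB \<in> Fix (lftN N 1)" "conC \<in> Fix (lftN N 1)"
    using homN by (auto simp: Fix_def lft_var_diff)
  show "conA \<in> Fix (lftN N 1)" by (rule F)
  show K1: "klein (lft (lft s1 False 1) False conA) (lft (lft s2 False 1) True conA)
      (lftN (lftN N 1) conA)"
    by (rule K0.klein_lft) (use F hom1 hom2 in \<open>auto simp: lft_var_diff\<close>)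
  interpret K1: klein "lft (lft s1 False 1) False conA" "lft (lft s2 False 1) True conA"
    "lftN (lftN N 1) conA" by (rule K1)
  have F1: "cst conB \<in> Fix (lftN (lftN N 1) conA)" "cst conC \<in> Fix (lftN (lftN N 1) conA)"
    by (rule K0.cst_Fix_lft[OF _ F(2)], simp, rule K0.cst_Fix_lft[OF _ F(3)], simp)
  show "cst conB \<in> Fix (lftN (lftN N 1) conA)" by (rule F1)
  have c: "lft (lft s1 False 1) e conA (cst x) = cst (lft s1 False 1 x)"
    "lft (lft s2 False 1) e conA (cst x) = cst (lft s2 False 1 x)" for x e
    by (simp_all add: lft_cst K0.hom1 K0.hom2)
  show K2: "klein (lft (lft (lft s1 False 1) False conA) True (cst conB))
      (lft (lft (lft s2 False 1) True conA) False (cst conB))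
      (lftN (lftN (lftN N 1) conA) (cst conB))"
    by (rule K1.klein_lft) (use F1 hom1 hom2 in \<open>simp_all only: lft_var_diff c cst.hom_0_iff conB_nonzero not_False_eq_True\<close>)
  interpret K2: klein "lft (lft (lft s1 False 1) False conA) True (cst conB)"
    "lft (lft (lft s2 False 1) True conA) False (cst conB)"
    "lftN (lftN (lftN N 1) conA) (cst conB)" by (rule K2)
  have F2: "cst (cst conC) \<in> Fix (lftN (lftN (lftN N 1) conA) (cst conB))"
    by (rule K1.cst_Fix_lft[OF _ F1(2)]) simp
  then show "cst (cst conC) \<in> Fix (lftN (lftN (lftN N 1) conA) (cst conB))" .
  have B0: "cst conB \<noteq> (0 :: 'a poly fract poly fract)" by simp
  have c2: "lft (lft (lft s1 False 1) False conA) e (cst conB) (cst x) = cst (lft (lft s1 False 1) False conA x)"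
    "lft (lft (lft s2 False 1) True conA) e (cst conB) (cst x) = cst (lft (lft s2 False 1) True conA x)" for x e
    by (rule lft_cst[OF K1.hom1 B0], rule lft_cst[OF K1.hom2 B0])
  have "klein (lft (lft (lft (lft s1 False 1) False conA) True (cst conB)) True (cst (cst conC)))
     (lft (lft (lft (lft s2 False 1) True conA) False (cst conB)) True (cst (cst conC)))
      (lftN (lftN (lftN (lftN N 1) conA) (cst conB)) (cst (cst conC)))"
    by (rule K2.klein_lft[OF _ _ _ F2])
       (simp_all only: c c2 lft_var_diff[OF hom1] lft_var_diff[OF hom2], simp)
  moreover have "lftN (lftN (lftN (lftN N 1) conA) (cst conB)) (cst (cst conC))
      = tower False False False ` N"
    by (auto simp: tower_def)
  ultimately show "klein (tower False True True s1) (tower True False True s2) (tower False False False ` N)"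
    by (simp add: tower_def)
qed

text \<open>The equation for \<open>h\<close> and its invariance under \<open>s2\<close> are read as
  descent data with \<open>w = 1\<close>. The second component starts trivially, but after the
  elimination of \<open>v_3\<close> it remembers the exponent \<open>k\<close> of
  \<open>C\<close>.\<close>

lemma tower_obstruction:
  assumes c: "c \<noteq> 0" and h: "h \<in> Fix (tower False False False ` N)" "h \<noteq> 0"
    and h1: "h * tower False True True s1 h = cst (cst (cst (cst c * conA)))"
    and h2: "tower True False True s2 h = h"
  shows False
proof -
  interpret K0: klein "lft s1 False 1" "lft s2 False 1" "lftN N 1" by (rule klein_tower0)
  interpret K1: klein "lft (lft s1 False 1) False conA" "lft (lft s2 False 1) True conA"
    "lftN (lftN N 1) conA" by (rule klein_tower1)
  interpret K2: klein "lft (lft (lft s1 False 1) False conA) True (cst conB)"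
    "lft (lft (lft s2 False 1) True conA) False (cst conB)"
    "lftN (lftN (lftN N 1) conA) (cst conB)" by (rule klein_tower2)
  interpret K3: klein "tower False True True s1" "tower True False True s2" "tower False False False ` N"
    by (rule klein_tower3)
  have c1: "lft (lft s1 False 1) e conA (cst x) = cst (lft s1 False 1 x)"
    "lft (lft s2 False 1) e conA (cst x) = cst (lft s2 False 1 x)" for x e
    by (simp_all add: lft_cst K0.hom1 K0.hom2)
  have B0: "cst conB \<noteq> (0 :: 'a poly fract poly fract)" by simp
  have C0: "conC \<noteq> (0 :: 'a poly fract)" "cst conC \<noteq> (0 :: 'a poly fract poly fract)"
    "cst (cst conC) \<noteq> (0 :: 'a poly fract poly fract poly fract)" by simp_all
  have c2: "lft (lft (lft s1 False 1) False conA) e (cst conB) (cst x) = cst (lft (lft s1 False 1) False conA x)"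
    "lft (lft (lft s2 False 1) True conA) e (cst conB) (cst x) = cst (lft (lft s2 False 1) True conA x)" for x e
    by (rule lft_cst[OF K1.hom1 B0], rule lft_cst[OF K1.hom2 B0])
  note v = lft_var_diff[OF hom1] lft_var_diff[OF hom2]
  have N3: "tower False False False ` N = lftN (lftN (lftN (lftN N 1) conA) (cst conB)) (cst (cst conC))"
    by (auto simp: tower_def)
  have one: "1 \<in> Fix (tower False False False ` N)" unfolding Fix_def
  proof (rule CollectI, rule ballI)
    fix \<nu> :: "'a tower \<Rightarrow> 'a tower" assume "\<nu> \<in> tower False False False ` N"
    then interpret n: field_hom \<nu> by (rule K3.homN)
    show "\<nu> 1 = 1" by simp
  qed
  interpret t1: field_hom "tower False True True s1" by (rule K3.hom1)
  interpret t2: field_hom "tower True False True s2" by (rule K3.hom2)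
  have w1: "1 * lft (lft (lft (lft s2 False 1) True conA) False (cst conB)) True (cst (cst conC)) 1 = cst 1"
    using t2.hom_one by (simp add: tower_def)
  have hw: "h * lft (lft (lft (lft s1 False 1) False conA) True (cst conB)) True (cst (cst conC)) 1
      = 1 * lft (lft (lft (lft s2 False 1) True conA) False (cst conB)) True (cst (cst conC)) h"
    using t1.hom_one h2 by (simp add: tower_def)
  \<comment> \<open>Both involutions invert \<open>v_3\<close>, so \<open>C\<close> enters the two
    norm equations with the same exponent.\<close>
  obtain b2 w2 k k' where b2: "b2 \<noteq> 0" "w2 \<noteq> 0" and F2: "b2 \<in> Fix (lftN (lftN (lftN N 1) conA) (cst conB))"
    "w2 \<in> Fix (lftN (lftN (lftN N 1) conA) (cst conB))"
    and k: "k = k'"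
    and e2: "b2 * lft (lft (lft s1 False 1) False conA) True (cst conB) b2 * cst (cst conC) powi k
        = cst (cst (cst c * conA))"
      "w2 * lft (lft (lft s2 False 1) True conA) False (cst conB) w2 * cst (cst conC) powi k' = cst 1"
      "b2 * lft (lft (lft s1 False 1) False conA) True (cst conB) w2
        = w2 * lft (lft (lft s2 False 1) True conA) False (cst conB) b2"
    by (rule K2.descent_step[OF C0(3) _ _ conC_Fix h(1)[unfolded N3] h(2) one[unfolded N3] one_neq_zero
          h1[unfolded tower_def] w1 hw]) (simp_all add: c1 c2 v)
  have k2: "b2 * lft (lft (lft s1 False 1) False conA) True (cst conB) b2
      = cst (cst (cst c * conA * conC powi (- k)))"
    using cst_cancel_power_int[OF e2(1) C0(2)] by (simp only: cst.hom_mult cst_power_int)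
  have k2': "w2 * lft (lft (lft s2 False 1) True conA) False (cst conB) w2
      = cst (cst (conC powi (- k)))"
    using cst_cancel_power_int[of _ "cst conC" k' 1] e2(2) C0(2) k
    by (simp add: cst_power_int)
  \<comment> \<open>Only \<open>s1\<close> inverts \<open>v_2\<close>, hence \<open>B\<close> enters
    only the first equation.\<close>
  obtain b1 w1 l l' where b1: "b1 \<noteq> 0" "w1 \<noteq> 0" and F1: "b1 \<in> Fix (lftN (lftN N 1) conA)"
    "w1 \<in> Fix (lftN (lftN N 1) conA)" and l: "l' = 0"
    and e1: "b1 * lft (lft s1 False 1) False conA b1 * cst conB powi l
        = cst (cst c * conA * conC powi (- k))"
      "w1 * lft (lft s2 False 1) True conA w1 * cst conB powi l' = cst (conC powi (- k))"
      "b1 * lft (lft s1 False 1) False conA w1 = w1 * lft (lft s2 False 1) True conA b1"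
    by (rule K1.descent_step[OF B0 _ _ conB_Fix F2(1) b2(1) F2(2) b2(2) k2 k2' e2(3)])
      (simp_all add: c1 v)
  have k1: "b1 * lft (lft s1 False 1) False conA b1
      = cst (cst c * conA * conC powi (- k) * conB powi (- l))"
    using cst_cancel_power_int[OF e1(1)] by simp
  have k1': "w1 * lft (lft s2 False 1) True conA w1 = cst (conC powi (- k))"
    using e1(2) l by simp
  \<comment> \<open>Only \<open>s2\<close> inverts \<open>v_1\<close>, hence \<open>A\<close> enters
    only the second equation.\<close>
  obtain b w m m' where b: "b \<noteq> 0" "w \<noteq> 0" and m: "m = 0"
    and e: "b * lft s1 False 1 b * conA powi m = cst c * conA * conC powi (- k) * conB powi (- l)"
      "w * lft s2 False 1 w * conA powi m' = conC powi (- k)"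
    by (rule K0.descent_step[OF var_nonzero _ _ conA_Fix F1(1) b1(1) F1(2) b1(2) k1 k1' e1(3)])
      (simp_all add: v)
  \<comment> \<open>Now \<open>C\<close> is expressed by \<open>A\<close> and \<open>B\<close>: the
    exponent of \<open>A\<close> in the first equation is \<open>1 + k\<close>, and the exponent of
    \<open>B\<close> in the second is \<open>k\<close>.\<close>
  have Cp: "conC powi (- k) = conA powi k * (conB powi k :: 'a poly fract)"
    by (simp add: conC_def power_int_minus power_int_mult_distrib power_int_inverse)
  have "b * lft s1 False 1 b = cst c * conA powi (1 + k) * conB powi (k - l)"
    using e(1) unfolding m Cp by (simp add: power_int_add power_int_diff power_int_minus divide_inverse mult_ac)
  then have "even (1 + k)" unfolding conB_def using even_exponents[OF hom1 b(1) c] by blast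
  moreover have "w * lft s2 False 1 w = cst 1 * conA powi (k - m') * conB powi k"
    using e(2) unfolding Cp by (simp add: power_int_diff field_simps)
  then have "even k" unfolding conB_def using even_exponents[OF hom2 b(2) one_neq_zero] by blast
  ultimately show False by simp
qed

end

section \<open>Norms and invariant polynomials\<close>

lemma irreducible_degree_pos:
  fixes p :: "'a::field poly"
  assumes "irreducible p" shows "degree p > 0" "p \<noteq> 0"
proof -
  show p: "p \<noteq> 0" using assms by auto
  have "\<not> is_unit p" using assms by (rule irreducible_not_unit)
  then show "degree p > 0" using p by (simp add: is_unit_iff_degree)
qed

text \<open>For irreducible \<open>p\<close> and nonzero \<open>x\<close> the exponent exists and is
  unique, and this is the \<open>p\<close>-adic valuation.\<close>

definition pmult :: "'a::field poly \<Rightarrow> 'a poly \<Rightarrow> nat" where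
  "pmult p x = (SOME k. \<exists>r. x = p ^ k * r \<and> \<not> p dvd r)"

lemma pmult_ex:
  fixes p x :: "'a::field poly"
  assumes p: "irreducible p" and "x \<noteq> 0"
  shows "\<exists>k r. x = p ^ k * r \<and> \<not> p dvd r"
  using assms(2)
proof (induction "degree x" arbitrary: x rule: less_induct)
  case less
  show ?case
  proof (cases "p dvd x")
    case False
    then show ?thesis by (intro exI[of _ 0] exI[of _ x]) simp
  next
    case True
    then obtain y where y: "x = p * y" by blast
    then have y0: "y \<noteq> 0" "p \<noteq> 0" using less by auto
    have "degree p > 0" using irreducible_degree_pos[OF p] by simp
    then have "degree y < degree x" unfolding y using y0 by (simp add: degree_mult_eq)
    then obtain k r where "y = p ^ k * r" "\<not> p dvd r" using less(1) y0 by blast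
    then have "x = p ^ Suc k * r" using y by (simp add: mult.assoc)
    then show ?thesis using \<open>\<not> p dvd r\<close> by blast
  qed
qed

lemma pmultI:
  fixes p x :: "'a::field poly"
  assumes p: "irreducible p" and x: "x = p ^ k * r" "\<not> p dvd r"
  shows "pmult p x = k"
proof -
  have u: "l = k" if l: "x = p ^ l * s" "\<not> p dvd s" for l s
  proof (rule ccontr)
    assume "l \<noteq> k"
    have p0: "p \<noteq> 0" using p by auto
    have *: False if "a < b" "p ^ a * u = p ^ b * v" "\<not> p dvd u" for a b u v
    proof -
      have "p ^ b = p ^ a * p ^ (b - a)" using that by (simp flip: power_add)
      then have "p ^ a * u = p ^ a * (p ^ (b - a) * v)" using that(2) by (simp add: mult.assoc)
      then have "u = p ^ (b - a) * v" using p0 by simp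
      moreover have "p dvd p ^ (b - a)" using that(1) by simp
      ultimately show False using that(3) by simp
    qed
    show False using \<open>l \<noteq> k\<close> *[of l k s r] *[of k l r s] l x by (metis nat_neq_iff)
  qed
  have "\<exists>k r. x = p ^ k * r \<and> \<not> p dvd r" using x by blast
  then have "\<exists>r. x = p ^ pmult p x * r \<and> \<not> p dvd r" unfolding pmult_def by (rule someI_ex)
  then show ?thesis using u by blast
qed

lemma pmult_decomp:
  fixes p x :: "'a::field poly"
  assumes "irreducible p" "x \<noteq> 0"
  obtains r where "x = p ^ pmult p x * r" "\<not> p dvd r"
  using pmult_ex[OF assms] pmultI[OF assms(1)] by metis

lemma pmult_mult:
  fixes p :: "'a::field poly"
  assumes p: "irreducible p" and "x \<noteq> 0" "y \<noteq> 0"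
  shows "pmult p (x * y) = pmult p x + pmult p y"
proof -
  obtain r where r: "x = p ^ pmult p x * r" "\<not> p dvd r" using pmult_decomp[OF p assms(2)] .
  obtain s where s: "y = p ^ pmult p y * s" "\<not> p dvd s" using pmult_decomp[OF p assms(3)] .
  have "prime_elem p" using p by (rule field_poly_irreducible_imp_prime)
  then have "\<not> p dvd r * s" using r s by (simp add: prime_elem_dvd_mult_iff)
  moreover have "x * y = (p ^ pmult p x * r) * (p ^ pmult p y * s)" using r s by metis
  then have "x * y = p ^ (pmult p x + pmult p y) * (r * s)" by (simp add: power_add mult_ac)
  ultimately show ?thesis using pmultI[OF p] by blast
qed

lemma pmult_not_dvd:
  fixes p :: "'a::field poly"
  assumes "irreducible p" "\<not> p dvd x" shows "pmult p x = 0"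
  using pmultI[OF assms(1), of x 0 x] assms(2) by simp

lemma pmult_dvd:
  fixes p :: "'a::field poly"
  assumes "irreducible p" "x \<noteq> 0" "p dvd x" shows "pmult p x > 0"
proof (rule ccontr)
  assume "\<not> 0 < pmult p x"
  moreover obtain r where r: "x = p ^ pmult p x * r" "\<not> p dvd r" using pmult_decomp[OF assms(1,2)] .
  ultimately show False using assms(3) by simp
qed

lemma pmult_power:
  fixes p :: "'a::field poly"
  assumes "irreducible p" "x \<noteq> 0" shows "pmult p (x ^ n) = n * pmult p x"
proof (induction n)
  case 0
  have "\<not> p dvd 1" using assms(1) by (rule irreducible_not_unit)
  then show ?case using pmult_not_dvd[OF assms(1)] by simp
qed (use assms in \<open>simp add: pmult_mult\<close>)

lemma pmult_prod:
  fixes p :: "'a::field poly"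
  assumes "irreducible p" "finite A" "\<And>i. i \<in> A \<Longrightarrow> f i \<noteq> 0"
  shows "pmult p (\<Prod>i\<in>A. f i) = (\<Sum>i\<in>A. pmult p (f i))"
  using assms(2,3)
proof (induction A rule: finite_induct)
  case empty
  then show ?case using pmult_power[OF assms(1), of 1 0] by simp
qed (use assms(1) in \<open>simp add: pmult_mult\<close>)

lemma pmult_self: "irreducible p \<Longrightarrow> pmult p p = 1" for p :: "'a::field poly"
  by (rule pmultI[of p p 1 1]) (use irreducible_degree_pos[of p] in \<open>simp_all add: is_unit_iff_degree\<close>)

lemma monic_irreducible_eq:
  fixes p q :: "'a::field poly"
  assumes "irreducible p" "irreducible q" "lead_coeff p = 1" "lead_coeff q = 1" "p dvd q"
  shows "p = q"
proof -
  obtain r where r: "q = p * r" using assms(5) by blast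
  have "\<not> is_unit p" using assms(1) by (rule irreducible_not_unit)
  then have "is_unit r" using irreducibleD[OF assms(2) r] by blast
  then have "degree r = 0" "r \<noteq> 0" by (auto simp: is_unit_iff_degree)
  then have "degree q = degree p" unfolding r using irreducible_degree_pos[OF assms(1)] by (simp add: degree_mult_eq)
  then show ?thesis by (rule monic_dvd_eq[OF assms(4,3,5), symmetric])
qed

lemma poly_factorization_ex:
  fixes p :: "'a::field poly"
  assumes "p \<noteq> 0"
  obtains M c where "\<And>q. q \<in># M \<Longrightarrow> irreducible q" "c \<noteq> 0" "prod_mset M = smult c p"
proof -
  show thesis
    by (rule that[OF _ _ field_poly_prod_mset_prime_factorization[OF assms]])
       (use assms field_poly_in_prime_factorization_imp_prime prime_elem_imp_irreducible in auto)
qed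

lemma monic_irreducible_normalize:
  fixes q :: "'a::field poly"
  assumes "irreducible q"
  defines "q' \<equiv> smult (inverse (lead_coeff q)) q"
  shows "irreducible q'" "lead_coeff q' = 1" "\<And>x. q' dvd x \<longleftrightarrow> q dvd x"
proof -
  have q: "q \<noteq> 0" using assms(1) by auto
  then show "lead_coeff q' = 1" by (simp add: q'_def)
  show d: "q' dvd x \<longleftrightarrow> q dvd x" for x
    unfolding q'_def using q by (simp add: smult_dvd_iff)
  have "q = smult (lead_coeff q) q'" using q by (simp add: q'_def)
  show "irreducible q'"
  proof (rule irreducibleI)
    show "q' \<noteq> 0" using q by (simp add: q'_def)
    show "\<not> is_unit q'" unfolding d by (rule irreducible_not_unit[OF assms(1)])
    fix a b assume ab: "q' = a * b"
    have "q = smult (lead_coeff q) a * b" using \<open>q = _\<close> ab by simp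
    then have "is_unit (smult (lead_coeff q) a) \<or> is_unit b" using irreducibleD[OF assms(1)] by blast
    then show "is_unit a \<or> is_unit b" using q by (simp add: is_unit_smult_iff)
  qed
qed

lemma monic_irreducible_divisor:
  fixes x :: "'a::field poly"
  assumes "degree x > 0"
  obtains p where "irreducible p" "lead_coeff p = 1" "p dvd x"
proof -
  have x: "x \<noteq> 0" using assms by auto
  obtain M c where M: "\<And>q. q \<in># M \<Longrightarrow> irreducible q" "c \<noteq> 0" "prod_mset M = smult c x"
    using poly_factorization_ex[OF x] by blast
  have "M \<noteq> {#}"
  proof
    assume "M = {#}"
    then have "degree (smult c x) = 0" using M(3) by (metis degree_1 prod_mset_empty)
    then show False using assms M(2) by simp
  qed
  then obtain q where q: "q \<in># M" by blast
  then have "q dvd smult c x" using M(3) dvd_prod_mset by metis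
  then have "q dvd x" using M(2) by (simp add: dvd_smult_iff)
  then show thesis using that monic_irreducible_normalize[OF M(1)[OF q]] by blast
qed

lemma finite_monic_irreducible_divisors:
  fixes x :: "'a::field poly"
  assumes x: "x \<noteq> 0"
  shows "finite {p. irreducible p \<and> lead_coeff p = 1 \<and> p dvd x}"
proof -
  obtain M c where M: "\<And>q. q \<in># M \<Longrightarrow> irreducible q" "c \<noteq> 0" "prod_mset M = smult c x"
    using poly_factorization_ex[OF x] by blast
  have "p \<in> (\<lambda>q. smult (inverse (lead_coeff q)) q) ` set_mset M"
    if p: "irreducible p" "lead_coeff p = 1" "p dvd x" for p
  proof -
    have "p dvd prod_mset M" unfolding M(3) using p(3) by (simp add: dvd_smult)
    then obtain q where q: "q \<in># M" "p dvd q"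
      using field_poly_irreducible_imp_prime[OF p(1)] by (metis prime_elem_dvd_prod_mset)
    have "p = smult (inverse (lead_coeff q)) q"
      using monic_irreducible_normalize[OF M(1)[OF q(1)]] p q(2)
      by (intro monic_irreducible_eq) (auto simp: dvd_smult)
    then show ?thesis using q(1) by blast
  qed
  then show ?thesis by (intro finite_subset[OF _ finite_imageI[OF finite_set_mset[of M]]]) auto
qed

text \<open>Unique factorization in terms of valuations: the induction cancels a common irreducible
  factor as long as \<open>u\<close> has one.\<close>

lemma associated_if_pmult_eq:
  fixes u v :: "'a::field poly"
  assumes "u \<noteq> 0" "v \<noteq> 0" "\<And>p. irreducible p \<Longrightarrow> lead_coeff p = 1 \<Longrightarrow> pmult p u = pmult p v"
  shows "\<exists>c. c \<noteq> 0 \<and> u = smult c v"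
  using assms
proof (induction "degree u" arbitrary: u v rule: less_induct)
  case less
  show ?case
  proof (cases "degree u > 0")
    case True
    then obtain p where p: "irreducible p" "lead_coeff p = 1" "p dvd u"
      using monic_irreducible_divisor by blast
    have "pmult p v > 0" using pmult_dvd[OF p(1) less(2) p(3)] less(4)[OF p(1,2)] by simp
    then have "p dvd v" using pmult_not_dvd[OF p(1)] by (metis neq0_conv)
    then obtain v' where v: "v = p * v'" by blast
    obtain u' where u: "u = p * u'" using p(3) by blast
    have nz: "p \<noteq> 0" "u' \<noteq> 0" "v' \<noteq> 0" using u v less(2,3) by auto
    have "degree p > 0" using irreducible_degree_pos[OF p(1)] by simp
    then have "degree u' < degree u" unfolding u using nz by (simp add: degree_mult_eq)
    moreover have "pmult q u' = pmult q v'" if "irreducible q" "lead_coeff q = 1" for q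
      using less(4)[OF that] nz unfolding u v by (simp add: pmult_mult that)
    ultimately obtain c where "c \<noteq> 0" "u' = smult c v'" using less(1) nz by blast
    then show ?thesis unfolding u v by (intro exI[of _ c]) simp
  next
    case False
    have "degree v = 0"
    proof (rule ccontr)
      assume "degree v \<noteq> 0"
      then obtain p where p: "irreducible p" "lead_coeff p = 1" "p dvd v"
        using monic_irreducible_divisor by blast
      then have "pmult p u > 0" using pmult_dvd[OF p(1) less(3) p(3)] less(4)[OF p(1,2)] by simp
      then have "p dvd u" using pmult_not_dvd[OF p(1)] by (metis neq0_conv)
      moreover have "is_unit u" using False less(2) by (simp add: is_unit_iff_degree)
      ultimately show False using irreducible_not_unit[OF p(1)] dvd_trans by blast
    qed
    then obtain a b where "u = [:a:]" "v = [:b:]" using False by (metis degree_eq_zeroE neq0_conv)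
    then show ?thesis using less(2,3) by (intro exI[of _ "a / b"]) simp
  qed
qed

lemma pmult_map_poly:
  assumes g: "field_hom g" and h: "field_hom h" and hg: "h \<circ> g = id"
    and p: "irreducible p" and x: "x \<noteq> 0"
    and gp: "irreducible (map_poly g p)"
  shows "pmult (map_poly g p) (map_poly g x) = pmult p x"
proof -
  interpret g: field_hom g by fact
  interpret h: field_hom h by fact
  interpret mg: map_poly_comm_ring_hom g by unfold_locales
  interpret mh: map_poly_comm_ring_hom h by unfold_locales
  have inv: "map_poly h (map_poly g r) = r" for r
    using hg by (simp add: map_poly_map_poly)
  obtain r where r: "x = p ^ pmult p x * r" "\<not> p dvd r" using pmult_decomp[OF p x] .
  have "map_poly g x = map_poly g p ^ pmult p x * map_poly g r"
    by (subst r(1)) (simp only: mg.hom_mult mg.hom_power)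
  moreover have "\<not> map_poly g p dvd map_poly g r"
    using r(2) mh.hom_dvd[of "map_poly g p" "map_poly g r"] inv by auto
  ultimately show ?thesis by (intro pmultI[OF gp])
qed

lemma irreducible_map_poly:
  assumes g: "field_hom g" and h: "field_hom h" and hg: "h \<circ> g = id" "g \<circ> h = id"
    and p: "irreducible p"
  shows "irreducible (map_poly g p)"
proof -
  interpret g: field_hom g by fact
  interpret h: field_hom h by fact
  interpret mg: map_poly_comm_ring_hom g by unfold_locales
  interpret mh: map_poly_comm_ring_hom h by unfold_locales
  have inv: "map_poly h (map_poly g r) = r" "map_poly g (map_poly h r') = r'" for r r'
    using hg by (simp_all add: map_poly_map_poly)
  have u: "is_unit (map_poly g q) \<longleftrightarrow> is_unit q" for q
    by (cases "q = 0") (simp_all add: is_unit_iff_degree)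
  show ?thesis
  proof (rule irreducibleI)
    show "map_poly g p \<noteq> 0" using p by auto
    show "\<not> is_unit (map_poly g p)" using u[of p] irreducible_not_unit[OF p] by simp
    fix a b assume "map_poly g p = a * b"
    then have "p = map_poly h a * map_poly h b" using inv mh.hom_mult by metis
    then have "is_unit (map_poly h a) \<or> is_unit (map_poly h b)" using irreducibleD[OF p] by blast
    then show "is_unit a \<or> is_unit b" using u inv by metis
  qed
qed

text \<open>The elements fall into pairs \<open>a\<close>, \<open>\<pi> a\<close>, each of which
  contributes \<open>2 * f a\<close>.\<close>

lemma even_sum_involution:
  fixes f :: "'p \<Rightarrow> nat"
  assumes "finite A" "\<And>a. a \<in> A \<Longrightarrow> \<pi> a \<in> A" "\<And>a. a \<in> A \<Longrightarrow> \<pi> (\<pi> a) = a"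
    "\<And>a. a \<in> A \<Longrightarrow> \<pi> a \<noteq> a" "\<And>a. a \<in> A \<Longrightarrow> f (\<pi> a) = f a"
  shows "even (sum f A)"
  using assms
proof (induction A rule: finite_psubset_induct)
  case (psubset A)
  show ?case
  proof (cases "A = {}")
    case False
    then obtain a where a: "a \<in> A" by blast
    let ?B = "A - {a, \<pi> a}"
    have "even (sum f ?B)"
    proof (rule psubset(2))
      show "?B \<subset> A" using a by blast
      fix b assume b: "b \<in> ?B"
      have "\<pi> b \<noteq> \<pi> a" using b a psubset(4) by (metis DiffD1 DiffD2 insert_iff)
      moreover have "\<pi> b \<noteq> a" using b a psubset(4) by (metis DiffD1 DiffD2 insert_iff)
      ultimately show "\<pi> b \<in> ?B" using b psubset(3) by blast
    qed (use psubset in auto)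
    moreover have "sum f A = sum f ?B + sum f {a, \<pi> a}"
      using psubset(1,3) a by (intro sum.subset_diff) auto
    moreover have "sum f {a, \<pi> a} = 2 * f a"
      using psubset(5)[OF a] psubset(6)[OF a] by simp
    ultimately show ?thesis by simp
  qed simp
qed

text \<open>The involution \<open>s\<close> acts on classes. On a class that it fixes,
  \<open>D\<close> is halved, which needs the parity; of two classes that it exchanges, one receives
  all of \<open>D\<close> and the other nothing.\<close>

lemma class_splitting:
  fixes cl :: "'x \<Rightarrow> 'c" and D :: "'x \<Rightarrow> nat"
  assumes ss: "\<And>x. cl (s (s x)) = cl x" and s: "\<And>x y. cl x = cl y \<Longrightarrow> cl (s x) = cl (s y)"
    and D: "\<And>x y. cl x = cl y \<Longrightarrow> D x = D y" "\<And>x. D (s x) = D x"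
    and ev: "\<And>x. cl (s x) = cl x \<Longrightarrow> even (D x)"
  obtains E :: "'x \<Rightarrow> nat" where "\<And>x y. cl x = cl y \<Longrightarrow> E x = E y" "\<And>x. E x + E (s x) = D x"
proof -
  \<comment> \<open>The choice depends only on the unordered pair of classes, so \<open>x\<close>
    and \<open>s x\<close> choose the same class.\<close>
  define \<rho> where "\<rho> x = (SOME c. c \<in> {cl x, cl (s x)})" for x
  have r: "\<rho> x \<in> {cl x, cl (s x)}" for x
    unfolding \<rho>_def by (rule someI_ex) blast
  have rs: "\<rho> (s x) = \<rho> x" for x
    unfolding \<rho>_def ss by (simp add: insert_commute)
  have rc: "\<rho> x = \<rho> y" if "cl x = cl y" for x y
    unfolding \<rho>_def using that s[OF that] by simp
  define E where "E x = (if cl (s x) = cl x then D x div 2 else if \<rho> x = cl x then D x else 0)" for x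
  show thesis
  proof
    show "E x = E y" if "cl x = cl y" for x y
      unfolding E_def using that s[OF that] D(1)[OF that] rc[OF that] by simp
    fix x
    show "E x + E (s x) = D x"
    proof (cases "cl (s x) = cl x")
      case True
      then show ?thesis using ev[OF True] by (auto simp: E_def ss D(2))
    next
      case False
      then show ?thesis using r[of x] by (auto simp: E_def ss D(2) rs)
    qed
  qed
qed

section \<open>Factorization under the action of the four-group\<close>

context klein
begin

text \<open>The group generated by \<open>N\<close> and \<open>s2\<close>. The factor
  \<open>h\<close> of a norm has to be fixed by it, so irreducible polynomials are grouped into the
  orbits of this group.\<close>

definition half :: "('a \<Rightarrow> 'a) set" where
  "half = N \<union> (\<lambda>\<nu>. s2 \<circ> \<nu>) ` N"

lemma invN': assumes "\<nu> \<in> N" obtains \<mu> where "\<mu> \<in> N" "\<mu> \<circ> \<nu> = id" "\<nu> \<circ> \<mu> = id"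
proof -
  obtain \<mu> where m: "\<mu> \<in> N" "\<mu> \<circ> \<nu> = id" using invN[OF assms] by blast
  obtain \<kappa> where k: "\<kappa> \<in> N" "\<kappa> \<circ> \<mu> = id" using invN[OF m(1)] by blast
  have "\<kappa> = \<kappa> \<circ> (\<mu> \<circ> \<nu>)" using m by simp
  also have "\<dots> = \<nu>" unfolding comp_assoc[symmetric] k by simp
  finally have "\<nu> \<circ> \<mu> = id" using k by simp
  then show thesis using that m by blast
qed

lemma halfI: "\<nu> \<in> N \<Longrightarrow> \<nu> \<in> half" "\<nu> \<in> N \<Longrightarrow> s2 \<circ> \<nu> \<in> half"
  by (auto simp: half_def)

lemma half_hom: "\<gamma> \<in> half \<Longrightarrow> field_hom \<gamma>"
  using field_hom_comp[OF hom2 homN] homN by (auto simp: half_def comp_def)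

lemma half_comp: assumes "\<gamma> \<in> half" "\<delta> \<in> half" shows "\<gamma> \<circ> \<delta> \<in> half"
proof -
  have 1: "\<gamma> \<circ> \<delta> \<in> half" if "\<gamma> \<in> half" "\<delta> \<in> N" for \<gamma> \<delta>
    using that compN by (auto simp: half_def comp_assoc)
  show ?thesis
  proof (cases "\<delta> \<in> N")
    case True
    then show ?thesis using 1 assms by blast
  next
    case False
    then obtain \<nu> where n: "\<nu> \<in> N" "\<delta> = s2 \<circ> \<nu>" using assms by (auto simp: half_def)
    show ?thesis
    proof (cases "\<gamma> \<in> N")
      case True
      then obtain \<mu> where m: "\<mu> \<in> N" "\<gamma> \<circ> s2 = s2 \<circ> \<mu>" using norm2 by blast
      have "\<gamma> \<circ> \<delta> = s2 \<circ> (\<mu> \<circ> \<nu>)" unfolding n comp_assoc[symmetric] m ..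
      then show ?thesis using halfI(2)[OF compN[OF m(1) n(1)]] by simp
    next
      case False
      then obtain \<kappa> where k: "\<kappa> \<in> N" "\<gamma> = s2 \<circ> \<kappa>" using assms by (auto simp: half_def)
      obtain \<mu> where m: "\<mu> \<in> N" "\<kappa> \<circ> s2 = s2 \<circ> \<mu>" using norm2 k by blast
      have "\<gamma> \<circ> \<delta> = s2 \<circ> (\<kappa> \<circ> s2) \<circ> \<nu>" unfolding n k by (simp only: comp_assoc)
      also have "\<dots> = (s2 \<circ> s2) \<circ> (\<mu> \<circ> \<nu>)" unfolding m by (simp only: comp_assoc)
      finally show ?thesis using compN[OF sq2 compN[OF m(1) n(1)]] halfI(1) by simp
    qed
  qed
qed

lemma half_inv: assumes "\<gamma> \<in> half" obtains \<delta> where "\<delta> \<in> half" "\<delta> \<circ> \<gamma> = id"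
proof (cases "\<gamma> \<in> N")
  case True
  then show thesis using that invN[OF True] halfI(1) by blast
next
  case False
  then obtain \<nu> where n: "\<nu> \<in> N" "\<gamma> = s2 \<circ> \<nu>" using assms by (auto simp: half_def)
  obtain \<mu> where m: "\<mu> \<in> N" "\<mu> \<circ> \<nu> = id" using invN[OF n(1)] by blast
  obtain \<tau> where t: "\<tau> \<in> N" "\<tau> \<circ> (s2 \<circ> s2) = id" using invN[OF sq2] by blast
  have s2: "s2 \<in> half" using halfI(2)[OF idN] by simp
  have "(\<mu> \<circ> (\<tau> \<circ> s2)) \<circ> \<gamma> = \<mu> \<circ> (\<tau> \<circ> (s2 \<circ> s2)) \<circ> \<nu>" unfolding n by (simp only: comp_assoc)
  also have "\<dots> = id" unfolding t using m by simp
  finally have "(\<mu> \<circ> (\<tau> \<circ> s2)) \<circ> \<gamma> = id" .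
  moreover have "\<mu> \<circ> (\<tau> \<circ> s2) \<in> half" by (intro half_comp halfI(1) m t s2)
  ultimately show thesis using that by blast
qed

text \<open>\<open>s1\<close> normalizes \<open>half\<close>, because it commutes with
  \<open>s2\<close> modulo \<open>N\<close> and normalizes \<open>N\<close>.\<close>

lemma half_s1: assumes "\<gamma> \<in> half" obtains \<delta> where "\<delta> \<in> half" "\<gamma> \<circ> s1 = s1 \<circ> \<delta>"
proof (cases "\<gamma> \<in> N")
  case True
  then show thesis using that norm1[OF True] halfI(1) by blast
next
  case False
  then obtain \<nu> where n: "\<nu> \<in> N" "\<gamma> = s2 \<circ> \<nu>" using assms by (auto simp: half_def)
  obtain \<mu> where m: "\<mu> \<in> N" "\<nu> \<circ> s1 = s1 \<circ> \<mu>" using norm1[OF n(1)] by blast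
  obtain \<kappa> where k: "\<kappa> \<in> N" "s1 \<circ> s2 = s2 \<circ> s1 \<circ> \<kappa>" using comm by blast
  obtain \<theta> where l: "\<theta> \<in> N" "\<kappa> \<circ> \<theta> = id" using invN'[OF k(1)] by blast
  have "s2 \<circ> s1 = s2 \<circ> s1 \<circ> (\<kappa> \<circ> \<theta>)" unfolding l by simp
  also have "\<dots> = s1 \<circ> (s2 \<circ> \<theta>)" unfolding comp_assoc[symmetric] k(2)[symmetric] by (simp only: comp_assoc)
  finally have c: "s2 \<circ> s1 = s1 \<circ> (s2 \<circ> \<theta>)" .
  have "\<gamma> \<circ> s1 = (s2 \<circ> s1) \<circ> \<mu>" unfolding n comp_assoc m by (simp only: comp_assoc)
  also have "\<dots> = s1 \<circ> ((s2 \<circ> \<theta>) \<circ> \<mu>)" unfolding c by (simp only: comp_assoc)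
  finally have "\<gamma> \<circ> s1 = s1 \<circ> ((s2 \<circ> \<theta>) \<circ> \<mu>)" .
  moreover have "(s2 \<circ> \<theta>) \<circ> \<mu> \<in> half" by (intro half_comp halfI m l)
  ultimately show thesis using that by blast
qed

lemma half_inv2: assumes "\<gamma> \<in> half" obtains \<delta> where "\<delta> \<in> half" "\<delta> \<circ> \<gamma> = id" "\<gamma> \<circ> \<delta> = id"
proof -
  obtain \<mu> where m: "\<mu> \<in> half" "\<mu> \<circ> \<gamma> = id" using half_inv[OF assms] by blast
  obtain \<kappa> where k: "\<kappa> \<in> half" "\<kappa> \<circ> \<mu> = id" using half_inv[OF m(1)] by blast
  have "\<kappa> = \<kappa> \<circ> (\<mu> \<circ> \<gamma>)" using m by simp
  also have "\<dots> = \<gamma>" unfolding comp_assoc[symmetric] k by simp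
  finally have "\<gamma> \<circ> \<mu> = id" using k by simp
  then show thesis using that m by blast
qed

lemma s1_inv: obtains t where "field_hom t" "t \<circ> s1 = id" "s1 \<circ> t = id"
proof -
  obtain \<tau> where t: "\<tau> \<in> N" "\<tau> \<circ> (s1 \<circ> s1) = id" "(s1 \<circ> s1) \<circ> \<tau> = id" using invN'[OF sq1] by blast
  have l: "(\<tau> \<circ> s1) \<circ> s1 = id" using t by (simp add: comp_assoc)
  have r: "s1 \<circ> (s1 \<circ> \<tau>) = id" using t by (simp add: comp_assoc)
  have "\<tau> \<circ> s1 = (\<tau> \<circ> s1) \<circ> (s1 \<circ> (s1 \<circ> \<tau>))" unfolding r by simp
  also have "\<dots> = ((\<tau> \<circ> s1) \<circ> s1) \<circ> (s1 \<circ> \<tau>)" by (simp only: comp_assoc)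
  also have "\<dots> = s1 \<circ> \<tau>" unfolding l by simp
  finally have "s1 \<circ> (\<tau> \<circ> s1) = id" using r by simp
  moreover have "field_hom (\<tau> \<circ> s1)" using field_hom_comp[OF homN[OF t(1)] hom1] by (simp add: comp_def)
  ultimately show thesis using that l by blast
qed

text \<open>The exponent of each irreducible factor of \<open>Y p0 * Y p1\<close> is divided between
  the orbit of the factor under \<open>half\<close> and the image of that orbit under
  \<open>s1\<close>. This can fail only if \<open>s1\<close> maps an orbit to itself and the
  exponent is odd; the hypotheses on the fixed points and on \<open>n\<close> exclude that
  case.\<close>

lemma norm_splitting:
  fixes Y :: "'p::finite \<Rightarrow> 'a poly"
  assumes Y1: "\<And>P. map_poly s1 (Y P) = Y (\<pi>1 P)" and Y2: "\<And>P. map_poly s2 (Y P) = Y (\<pi>2 P)"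
    and YN: "\<And>\<nu> P. \<nu> \<in> N \<Longrightarrow> map_poly \<nu> (Y P) = Y P"
    and prod: "(\<Prod>P\<in>UNIV. Y P) = B ^ n" and n: "even n" and B: "B \<noteq> 0"
    and inv: "\<And>P. \<pi>1 (\<pi>1 P) = P" and fp: "\<And>P. \<pi>1 P = P \<longleftrightarrow> P = p0 \<or> P = p1"
    and p01: "p0 \<noteq> p1" "\<pi>2 p0 = p1" "\<pi>2 p1 = p0"
  obtains h c where "c \<noteq> 0" "h \<noteq> 0" "map_poly s2 h = h" "\<And>\<nu>. \<nu> \<in> N \<Longrightarrow> map_poly \<nu> h = h"
    "Y p0 * Y p1 = smult c (h * map_poly s1 h)"
proof -
  define u where "u = Y p0 * Y p1"
  have "(\<Prod>P\<in>UNIV. Y P) \<noteq> 0" unfolding prod using B by simp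
  then have Y0: "Y P \<noteq> 0" for P by (simp add: prod_zero_iff)
  then have u0: "u \<noteq> 0" by (simp add: u_def)
  have mc: "map_poly f (map_poly g p) = map_poly (f \<circ> g) p" if "field_hom f" "field_hom g" for f g :: "'a \<Rightarrow> 'a" and p :: "'a poly"
  proof -
    interpret f: field_hom f by fact
    interpret g: field_hom g by fact
    show ?thesis by (simp add: map_poly_map_poly)
  qed
  have mm: "map_poly g (p * q) = map_poly g p * map_poly g q" if "field_hom g" for g :: "'a \<Rightarrow> 'a" and p q :: "'a poly"
  proof -
    interpret g: field_hom g by fact
    interpret m: map_poly_comm_ring_hom g by unfold_locales
    show ?thesis by (rule m.hom_mult)
  qed
  have mprod: "map_poly g (\<Prod>p\<in>A. f p) = (\<Prod>p\<in>A. map_poly g (f p))" "map_poly g (p ^ k) = map_poly g p ^ k"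
    if "field_hom g" for g :: "'a \<Rightarrow> 'a" and f :: "'a poly \<Rightarrow> 'a poly" and A k p
  proof -
    interpret g: field_hom g by fact
    interpret m: map_poly_comm_ring_hom g by unfold_locales
    show "map_poly g (\<Prod>p\<in>A. f p) = (\<Prod>p\<in>A. map_poly g (f p))" by (rule m.hom_prod)
    show "map_poly g (p ^ k) = map_poly g p ^ k" by (rule m.hom_power)
  qed
  have pi1: "\<pi>1 p0 = p0" "\<pi>1 p1 = p1" using fp by blast+
  have us1: "map_poly s1 u = u" by (simp add: u_def mm[OF hom1] Y1 pi1)
  have uhalf: "map_poly \<gamma> u = u" if g: "\<gamma> \<in> half" for \<gamma>
  proof -
    have uN: "map_poly \<nu> u = u" if "\<nu> \<in> N" for \<nu>
      using that by (simp add: u_def mm[OF homN] YN)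
    moreover have "map_poly s2 u = u" by (simp add: u_def mm[OF hom2] Y2 p01 mult.commute)
    then have "map_poly (s2 \<circ> \<nu>) u = u" if "\<nu> \<in> N" for \<nu>
      using mc[OF hom2 homN[OF that], of u] uN[OF that] by simp
    ultimately show ?thesis using g by (auto simp: half_def)
  qed
  define MI where "MI = {p :: 'a poly. irreducible p \<and> lead_coeff p = 1}"
  define X where "X = {p. irreducible p \<and> lead_coeff p = 1 \<and> p dvd u}"
  have finX: "finite X" unfolding X_def by (rule finite_monic_irreducible_divisors[OF u0])
  have XMI: "X = {p \<in> MI. p dvd u}" by (auto simp: X_def MI_def)
  obtain t1 where t1: "field_hom t1" "t1 \<circ> s1 = id" "s1 \<circ> t1 = id" using s1_inv by blast
  have MIhom: "map_poly g p \<in> MI" if "field_hom g" "field_hom h" "h \<circ> g = id" "g \<circ> h = id" "p \<in> MI" for g h :: "'a \<Rightarrow> 'a" and p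
    using that irreducible_map_poly[OF that(1-4)] field_hom_map_poly_monic(2)[OF that(1)] by (auto simp: MI_def)
  have MIiff: "map_poly g p \<in> MI \<longleftrightarrow> p \<in> MI" if "field_hom g" "field_hom h" "h \<circ> g = id" "g \<circ> h = id" for g h :: "'a \<Rightarrow> 'a" and p
  proof
    assume "map_poly g p \<in> MI"
    then have "map_poly h (map_poly g p) \<in> MI" by (rule MIhom[OF that(2,1,4,3)])
    then show "p \<in> MI" unfolding mc[OF that(2,1)] that(3) by simp
  qed (rule MIhom[OF that])
  have pm: "pmult (map_poly g p) (map_poly g x) = pmult p x"
    if "field_hom g" "field_hom h" "h \<circ> g = id" "g \<circ> h = id" "p \<in> MI" "x \<noteq> 0" for g h :: "'a \<Rightarrow> 'a" and p x
    using pmult_map_poly[OF that(1,2,3) _ that(6), of p] MIhom[OF that(1-5)] that(5) by (simp add: MI_def)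
  have halfinv: "\<exists>\<delta>. field_hom \<delta> \<and> \<delta> \<circ> \<gamma> = id \<and> \<gamma> \<circ> \<delta> = id" if "\<gamma> \<in> half" for \<gamma>
    using half_inv2[OF that] half_hom by metis
  \<comment> \<open>Extended by 0 from the monic irreducible polynomials to all polynomials, since
    \<open>class_splitting\<close> speaks of a whole type.\<close>
  define D where "D p = (if p \<in> MI then pmult p u else 0)" for p
  define cl where "cl p = (\<lambda>\<gamma>. map_poly \<gamma> p) ` half" for p :: "'a poly"
  have idh: "id \<in> half" by (rule halfI(1)[OF idN])
  have clI: "cl (map_poly \<gamma> p) = cl p" if g: "\<gamma> \<in> half" for \<gamma> p
  proof
    show "cl (map_poly \<gamma> p) \<subseteq> cl p"
      unfolding cl_def using half_comp[OF _ g] mc[OF half_hom half_hom[OF g]] by auto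
    obtain \<delta> where d: "\<delta> \<in> half" "\<delta> \<circ> \<gamma> = id" using half_inv[OF g] by blast
    show "cl p \<subseteq> cl (map_poly \<gamma> p)"
    proof
      fix x assume "x \<in> cl p"
      then obtain \<epsilon> where e: "\<epsilon> \<in> half" "x = map_poly \<epsilon> p" by (auto simp: cl_def)
      have "map_poly (\<epsilon> \<circ> \<delta>) (map_poly \<gamma> p) = map_poly (\<epsilon> \<circ> (\<delta> \<circ> \<gamma>)) p"
        using mc[OF half_hom[OF half_comp[OF e(1) d(1)]] half_hom[OF g]] by (simp add: comp_assoc)
      then have "x = map_poly (\<epsilon> \<circ> \<delta>) (map_poly \<gamma> p)" using e d by simp
      then show "x \<in> cl (map_poly \<gamma> p)" unfolding cl_def using half_comp[OF e(1) d(1)] by blast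
    qed
  qed
  have clD: "\<exists>\<gamma>\<in>half. y = map_poly \<gamma> x" if "cl x = cl y" for x y
  proof -
    have "y \<in> cl y" unfolding cl_def using idh by (force simp: map_poly_id)
    then show ?thesis using that by (auto simp: cl_def)
  qed
  have ss: "cl (map_poly s1 (map_poly s1 p)) = cl p" for p
    using clI[OF halfI(1)[OF sq1]] mc[OF hom1 hom1] by simp
  \<comment> \<open>Since \<open>s1\<close> normalizes \<open>half\<close>, it maps orbits to
    orbits; \<open>\<tau>\<close> inverts \<open>s1 \<circ> s1\<close> and allows \<open>s1\<close>
    to be moved past \<open>\<gamma>\<close>.\<close>
  have s: "cl (map_poly s1 x) = cl (map_poly s1 y)" if cxy: "cl x = cl y" for x y
  proof -
    obtain \<gamma> where g: "\<gamma> \<in> half" "y = map_poly \<gamma> x" using clD[OF cxy] by blast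
    obtain \<tau> where t: "\<tau> \<in> N" "\<tau> \<circ> (s1 \<circ> s1) = id" using invN[OF sq1] by blast
    obtain \<mu> where m: "\<mu> \<in> half" "(\<gamma> \<circ> \<tau>) \<circ> s1 = s1 \<circ> \<mu>"
      using half_s1[OF half_comp[OF g(1) halfI(1)[OF t(1)]]] by blast
    have "s1 \<circ> \<gamma> = s1 \<circ> (\<gamma> \<circ> (\<tau> \<circ> (s1 \<circ> s1)))" unfolding t by simp
    also have "\<dots> = s1 \<circ> ((\<gamma> \<circ> \<tau>) \<circ> s1) \<circ> s1" by (simp only: comp_assoc)
    also have "\<dots> = ((s1 \<circ> s1) \<circ> \<mu>) \<circ> s1" unfolding m by (simp only: comp_assoc)
    finally have e: "s1 \<circ> \<gamma> = ((s1 \<circ> s1) \<circ> \<mu>) \<circ> s1" .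
    have d: "(s1 \<circ> s1) \<circ> \<mu> \<in> half" by (intro half_comp halfI(1)[OF sq1] m)
    have "map_poly s1 y = map_poly ((s1 \<circ> s1) \<circ> \<mu>) (map_poly s1 x)"
      unfolding g mc[OF hom1 half_hom[OF g(1)]] mc[OF half_hom[OF d] hom1] e ..
    then show ?thesis using clI[OF d] by simp
  qed
  have Dh: "D (map_poly \<gamma> x) = D x" if g: "\<gamma> \<in> half" for \<gamma> x
  proof -
    obtain \<delta> where d: "field_hom \<delta>" "\<delta> \<circ> \<gamma> = id" "\<gamma> \<circ> \<delta> = id" using halfinv[OF g] by blast
    show ?thesis
      using MIiff[OF half_hom[OF g] d, of x] pm[OF half_hom[OF g] d _ u0, of x] uhalf[OF g]
      by (auto simp: D_def)
  qed
  have Dcl: "D x = D y" if "cl x = cl y" for x y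
    using clD[OF that] Dh by metis
  have Ds: "D (map_poly s1 x) = D x" for x
    using MIiff[OF hom1 t1, of x] pm[OF hom1 t1 _ u0, of x] us1 by (auto simp: D_def)
  \<comment> \<open>If \<open>s1\<close> fixes the orbit of \<open>x\<close>, then it acts on
    \<open>x\<close> like some \<open>\<gamma>\<close> in \<open>half\<close>, and
    \<open>\<gamma>\<close> lies either in \<open>N\<close> or in its coset by
    \<open>s2\<close>.\<close>
  have ev: "even (D x)" if c: "cl (map_poly s1 x) = cl x" for x
  proof (cases "x \<in> MI")
    case xMI: True
    then have xi: "irreducible x" by (simp add: MI_def)
    obtain \<gamma> where g: "\<gamma> \<in> half" "map_poly s1 x = map_poly \<gamma> x" using clD[OF c[symmetric]] by blast
    have D: "D x = pmult x (Y p0) + pmult x (Y p1)"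
      using xMI by (simp add: D_def u_def pmult_mult[OF xi] Y0)
    have f1: "pmult x (Y P) = pmult (map_poly \<gamma> x) (Y (\<pi>1 P))" for P
      using pm[OF hom1 t1 xMI Y0, of P] by (simp add: Y1 g)
    obtain \<delta> where d: "field_hom \<delta>" "\<delta> \<circ> \<gamma> = id" "\<gamma> \<circ> \<delta> = id" using halfinv[OF g(1)] by blast
    have f2: "pmult (map_poly \<gamma> x) (map_poly \<gamma> (Y P)) = pmult x (Y P)" for P
      by (rule pm[OF half_hom[OF g(1)] d xMI Y0])
    show ?thesis
    proof (cases "\<gamma> \<in> N")
      case True
      \<comment> \<open>Here the multiplicity of \<open>x\<close> in \<open>Y P\<close> is invariant
        under \<open>\<pi>1\<close>. The total over all points is a multiple of the even
        \<open>n\<close>, and the points other than \<open>p0\<close>, \<open>p1\<close> pair off,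
        so these two contribute an even number.\<close>
      have f: "pmult x (Y (\<pi>1 P)) = pmult x (Y P)" for P
        using f1[of P] f2[of "\<pi>1 P"] YN[OF True] by simp
      have "(\<Sum>P\<in>UNIV. pmult x (Y P)) = n * pmult x B"
        using prod pmult_prod[OF xi finite, of UNIV Y] Y0 pmult_power[OF xi B] by simp
      then have "even (\<Sum>P\<in>UNIV. pmult x (Y P))" using n by simp
      moreover have "(\<Sum>P\<in>UNIV. pmult x (Y P)) = (\<Sum>P\<in>UNIV - {p0, p1}. pmult x (Y P)) + (\<Sum>P\<in>{p0, p1}. pmult x (Y P))"
        by (rule sum.subset_diff) auto
      moreover have "even (\<Sum>P\<in>UNIV - {p0, p1}. pmult x (Y P))"
      proof (rule even_sum_involution[where \<pi> = \<pi>1])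
        fix P assume "P \<in> UNIV - {p0, p1}"
        then show "\<pi>1 P \<noteq> P" "\<pi>1 P \<in> UNIV - {p0, p1}" using fp inv pi1 by (auto, metis, metis)
      qed (use f inv in auto)
      ultimately show ?thesis unfolding D using p01 by simp
    next
      case False
      then obtain \<nu> where v: "\<nu> \<in> N" "\<gamma> = s2 \<circ> \<nu>" using g by (auto simp: half_def)
      \<comment> \<open>Here \<open>\<gamma>\<close> carries \<open>Y p1\<close> to
        \<open>Y p0\<close> while \<open>s1\<close> fixes both, so the two multiplicities
        agree.\<close>
      have "map_poly \<gamma> (Y p1) = Y p0"
        unfolding v mc[OF hom2 homN[OF v(1)], symmetric] YN[OF v(1)] Y2 p01 ..
      then have "pmult x (Y p0) = pmult x (Y p1)" using f1[of p0] f2[of p1] pi1 by simp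
      then show ?thesis unfolding D by simp
    qed
  qed (simp add: D_def)
  obtain E where Ecl: "\<And>x y. cl x = cl y \<Longrightarrow> E x = E y" and EE: "\<And>x. E x + E (map_poly s1 x) = D x"
    using class_splitting[of cl "map_poly s1" D, OF ss s Dcl Ds ev] by blast
  define h where "h = (\<Prod>p\<in>X. p ^ E p)"
  have Xinv: "bij_betw (map_poly g) X X" if g: "field_hom g" "field_hom k" "k \<circ> g = id" "g \<circ> k = id" "map_poly g u = u" for g k :: "'a \<Rightarrow> 'a"
  proof -
    interpret g: field_hom g by fact
    interpret m: map_poly_comm_ring_hom g by unfold_locales
    have "map_poly g ` X \<subseteq> X"
      using MIhom[OF g(1-4)] m.hom_dvd g(5) unfolding XMI by (metis (mono_tags, lifting) image_subsetI mem_Collect_eq)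
    moreover have "inj_on (map_poly g) X"
    proof (rule inj_onI)
      fix x y assume "map_poly g x = map_poly g y"
      then have "map_poly k (map_poly g x) = map_poly k (map_poly g y)" by simp
      then show "x = y" unfolding mc[OF g(2,1)] g(3) by simp
    qed
    ultimately show ?thesis using endo_inj_surj[OF finX] by (simp add: bij_betw_def)
  qed
  have hhalf: "map_poly \<gamma> h = h" if g: "\<gamma> \<in> half" for \<gamma>
  proof -
    obtain \<delta> where d: "field_hom \<delta>" "\<delta> \<circ> \<gamma> = id" "\<gamma> \<circ> \<delta> = id" using halfinv[OF g] by blast
    have "map_poly \<gamma> h = (\<Prod>p\<in>X. map_poly \<gamma> p ^ E p)"
      unfolding h_def by (simp add: mprod[OF half_hom[OF g]])
    also have "\<dots> = (\<Prod>p\<in>X. map_poly \<gamma> p ^ E (map_poly \<gamma> p))"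
      using Ecl[OF clI[OF g]] by simp
    also have "\<dots> = h" unfolding h_def
      by (rule prod.reindex_bij_betw[OF Xinv[OF half_hom[OF g] d uhalf[OF g]]])
    finally show ?thesis .
  qed
  have hs1: "h * map_poly s1 h = (\<Prod>p\<in>X. p ^ D p)"
  proof -
    note bij = Xinv[OF hom1 t1 us1]
    have "h = (\<Prod>p\<in>X. map_poly s1 p ^ E (map_poly s1 p))" unfolding h_def
      by (rule prod.reindex_bij_betw[OF bij, symmetric])
    moreover have "map_poly s1 h = (\<Prod>p\<in>X. map_poly s1 p ^ E p)"
      unfolding h_def by (simp add: mprod[OF hom1])
    ultimately have "h * map_poly s1 h = (\<Prod>p\<in>X. map_poly s1 p ^ (E p + E (map_poly s1 p)))"
      by (simp add: prod.distrib power_add mult.commute)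
    also have "\<dots> = (\<Prod>p\<in>X. map_poly s1 p ^ D (map_poly s1 p))" by (simp add: EE Ds)
    also have "\<dots> = (\<Prod>p\<in>X. p ^ D p)" by (rule prod.reindex_bij_betw[OF bij])
    finally show ?thesis .
  qed
  have Xnz: "p \<noteq> 0" if "p \<in> X" for p using that irreducible_degree_pos(2) by (auto simp: X_def)
  have h0: "h \<noteq> 0" unfolding h_def using Xnz finX by (simp add: prod_zero_iff)
  have "\<exists>c. c \<noteq> 0 \<and> u = smult c (h * map_poly s1 h)"
    unfolding hs1
  proof (rule associated_if_pmult_eq[OF u0])
    show "(\<Prod>p\<in>X. p ^ D p) \<noteq> 0" using Xnz finX by (simp add: prod_zero_iff)
    fix q :: "'a poly" assume q: "irreducible q" "lead_coeff q = 1"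
    have "pmult q (\<Prod>p\<in>X. p ^ D p) = (\<Sum>p\<in>X. D p * pmult q p)"
      using Xnz by (simp add: pmult_prod[OF q(1) finX] pmult_power[OF q(1)])
    also have "\<dots> = (\<Sum>p\<in>X. if p = q then D q else 0)"
    proof (intro sum.cong refl)
      fix p assume p: "p \<in> X"
      show "D p * pmult q p = (if p = q then D q else 0)"
      proof (cases "p = q")
        case False
        then have "\<not> q dvd p" using monic_irreducible_eq[OF q(1) _ q(2)] p by (auto simp: X_def)
        then show ?thesis using pmult_not_dvd[OF q(1)] False by simp
      qed (simp add: pmult_self[OF q(1)])
    qed
    also have "\<dots> = (if q \<in> X then D q else 0)" using finX by simp
    also have "\<dots> = pmult q u"
      using q pmult_not_dvd[OF q(1)] by (auto simp: D_def MI_def X_def)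
    finally show "pmult q u = pmult q (\<Prod>p\<in>X. p ^ D p)" by simp
  qed
  then obtain c where c: "c \<noteq> 0" "u = smult c (h * map_poly s1 h)" by blast
  show thesis
    using that[OF c(1) h0] hhalf[OF halfI(1)] hhalf[OF halfI(2)[OF idN]] c(2) by (simp add: u_def)
qed

end

section \<open>Evaluation of multivariate polynomials\<close>

definition monom_eval :: "(nat \<Rightarrow> 'a::comm_ring_1) \<Rightarrow> (nat \<Rightarrow>\<^sub>0 nat) \<Rightarrow> 'a" where
  "monom_eval z t = (\<Prod>i\<in>Poly_Mapping.keys t. z i ^ Poly_Mapping.lookup t i)"

definition meval :: "('k::field \<Rightarrow> 'a::comm_ring_1) \<Rightarrow> (nat \<Rightarrow> 'a) \<Rightarrow> 'k mpoly \<Rightarrow> 'a" where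
  "meval \<kappa> z p = (\<Sum>t\<in>Poly_Mapping.keys p. \<kappa> (Poly_Mapping.lookup p t) * monom_eval z t)"

lemma monom_eval_superset:
  assumes "finite A" "Poly_Mapping.keys t \<subseteq> A"
  shows "monom_eval z t = (\<Prod>i\<in>A. z i ^ Poly_Mapping.lookup t i)"
  unfolding monom_eval_def using assms
  by (intro prod.mono_neutral_left) (auto simp: in_keys_iff)

lemma monom_eval_add: "monom_eval z (s + t) = monom_eval z s * monom_eval z t"
proof -
  let ?A = "Poly_Mapping.keys s \<union> Poly_Mapping.keys t"
  have "monom_eval z (s + t) = (\<Prod>i\<in>?A. z i ^ Poly_Mapping.lookup (s + t) i)"
    by (rule monom_eval_superset) (use keys_add[of s t] in auto)
  also have "\<dots> = (\<Prod>i\<in>?A. z i ^ Poly_Mapping.lookup s i) * (\<Prod>i\<in>?A. z i ^ Poly_Mapping.lookup t i)"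
    by (simp add: lookup_add power_add prod.distrib)
  also have "\<dots> = monom_eval z s * monom_eval z t"
    by (subst (1 2) monom_eval_superset[of ?A]) auto
  finally show ?thesis .
qed

lemma monom_eval_0 [simp]: "monom_eval z 0 = 1"
  by (simp add: monom_eval_def)

lemma poly_mapping_sum_singles:
  "(\<Sum>t\<in>Poly_Mapping.keys p. Poly_Mapping.single t (Poly_Mapping.lookup p t)) = p"
proof (rule poly_mapping_eqI)
  fix k
  have "(\<Sum>t\<in>Poly_Mapping.keys p. Poly_Mapping.lookup p t when t = k)
      = (\<Sum>t\<in>Poly_Mapping.keys p. if t = k then Poly_Mapping.lookup p k else 0)"
    by (intro sum.cong) (auto simp: when_def)
  then show "Poly_Mapping.lookup (\<Sum>t\<in>Poly_Mapping.keys p. Poly_Mapping.single t (Poly_Mapping.lookup p t)) k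
      = Poly_Mapping.lookup p k"
    by (simp add: lookup_sum lookup_single in_keys_iff)
qed

lemma meval_superset:
  assumes "comm_ring_hom \<kappa>" "finite A" "Poly_Mapping.keys p \<subseteq> A"
  shows "meval \<kappa> z p = (\<Sum>t\<in>A. \<kappa> (Poly_Mapping.lookup p t) * monom_eval z t)"
proof -
  interpret comm_ring_hom \<kappa> by fact
  show ?thesis unfolding meval_def using assms(2,3)
    by (intro sum.mono_neutral_left) (auto simp: in_keys_iff)
qed

lemma meval_single:
  assumes "comm_ring_hom \<kappa>"
  shows "meval \<kappa> z (Poly_Mapping.single t a) = \<kappa> a * monom_eval z t"
  by (subst meval_superset[OF assms, of "{t}"]) auto

lemma comm_ring_hom_meval:
  assumes k: "comm_ring_hom \<kappa>" shows "comm_ring_hom (meval \<kappa> z)"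
proof -
  interpret comm_ring_hom \<kappa> by fact
  have add: "meval \<kappa> z (p + q) = meval \<kappa> z p + meval \<kappa> z q" for p q
  proof -
    let ?A = "Poly_Mapping.keys p \<union> Poly_Mapping.keys q"
    have "meval \<kappa> z (p + q) = (\<Sum>t\<in>?A. \<kappa> (Poly_Mapping.lookup (p + q) t) * monom_eval z t)"
      by (rule meval_superset[OF k]) (use keys_add[of p q] in auto)
    also have "\<dots> = (\<Sum>t\<in>?A. \<kappa> (Poly_Mapping.lookup p t) * monom_eval z t) + (\<Sum>t\<in>?A. \<kappa> (Poly_Mapping.lookup q t) * monom_eval z t)"
      by (simp add: lookup_add hom_add distrib_right sum.distrib)
    also have "\<dots> = meval \<kappa> z p + meval \<kappa> z q"
      by (subst (1 2) meval_superset[OF k, of ?A]) auto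
    finally show ?thesis .
  qed
  have zero: "meval \<kappa> z 0 = 0" by (simp add: meval_def)
  have sums: "meval \<kappa> z (sum f A) = (\<Sum>x\<in>A. meval \<kappa> z (f x))" for f :: "'c \<Rightarrow> _" and A
    by (induction A rule: infinite_finite_induct) (auto simp: add zero)
  have ss: "meval \<kappa> z (Poly_Mapping.single s a * Poly_Mapping.single t b)
      = meval \<kappa> z (Poly_Mapping.single s a) * meval \<kappa> z (Poly_Mapping.single t b)" for s t a b
    by (simp add: mult_single meval_single[OF k] monom_eval_add hom_mult mult_ac)
  have mult: "meval \<kappa> z (p * q) = meval \<kappa> z p * meval \<kappa> z q" for p q
  proof -
    let ?p = "\<Sum>t\<in>Poly_Mapping.keys p. Poly_Mapping.single t (Poly_Mapping.lookup p t)"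
    let ?q = "\<Sum>t\<in>Poly_Mapping.keys q. Poly_Mapping.single t (Poly_Mapping.lookup q t)"
    have "meval \<kappa> z (?p * ?q) = meval \<kappa> z ?p * meval \<kappa> z ?q"
      by (simp only: sum_product sums ss)
    then show ?thesis unfolding poly_mapping_sum_singles .
  qed
  have one: "meval \<kappa> z 1 = 1"
    using meval_single[OF k, of z 0 1] by simp
  show ?thesis by unfold_locales (simp_all add: add mult zero one)
qed

lemma meval_mconst: "comm_ring_hom \<kappa> \<Longrightarrow> meval \<kappa> z (mconst c) = \<kappa> c"
  by (simp add: mconst_def meval_single)

lemma meval_mvar: assumes "comm_ring_hom \<kappa>" shows "meval \<kappa> z (mvar i) = z i"
proof -
  interpret comm_ring_hom \<kappa> by fact
  show ?thesis using assms by (simp add: mvar_def meval_single monom_eval_def)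
qed

lemma hom_meval:
  assumes "comm_ring_hom h"
  shows "h (meval \<kappa> z p) = meval (\<lambda>c. h (\<kappa> c)) (\<lambda>i. h (z i)) p"
proof -
  interpret comm_ring_hom h by fact
  show ?thesis by (simp add: meval_def monom_eval_def hom_sum hom_mult hom_prod hom_power)
qed

lemma comm_ring_hom_comp:
  assumes "comm_ring_hom f" "comm_ring_hom g" shows "comm_ring_hom (\<lambda>x. f (g x))"
proof -
  interpret f: comm_ring_hom f by fact
  interpret g: comm_ring_hom g by fact
  show ?thesis by unfold_locales (simp_all add: g.hom_add f.hom_add g.hom_mult f.hom_mult)
qed

lemma comm_ring_hom_mconst: "comm_ring_hom mconst"
  by unfold_locales (simp_all add: mconst_def single_add mult_single)

lemma comm_ring_hom_to_fract: "comm_ring_hom to_fract"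
  by unfold_locales simp_all

lemma comm_ring_hom_frac_const: "comm_ring_hom frac_const"
  using comm_ring_hom_comp[OF comm_ring_hom_to_fract comm_ring_hom_mconst]
  by (simp add: frac_const_def[abs_def])

lemma field_hom_comm_ring_hom: "field_hom f \<Longrightarrow> comm_ring_hom f"
proof -
  assume "field_hom f"
  then interpret field_hom f .
  show ?thesis ..
qed

lemma meval_mconst_mvar: "meval mconst mvar p = (p :: 'k::field mpoly)"
proof -
  have pw: "mvar i ^ n = (Poly_Mapping.single (Poly_Mapping.single i n) 1 :: 'k mpoly)" for i n
    by (induction n) (auto simp: mvar_def mult_single simp flip: single_add)
  have "(\<Prod>i\<in>A. mvar i ^ f i) = (Poly_Mapping.single (\<Sum>i\<in>A. Poly_Mapping.single i (f i)) 1 :: 'k mpoly)"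
    if "finite A" for f :: "nat \<Rightarrow> nat" and A
    using that by (induction A rule: finite_induct) (auto simp: pw mult_single)
  then have "monom_eval mvar t = (Poly_Mapping.single t 1 :: 'k mpoly)" for t
    by (simp add: monom_eval_def poly_mapping_sum_singles)
  then show ?thesis
    using poly_mapping_sum_singles[of p]
    by (simp add: meval_def mconst_def mult_single)
qed

lemma mpolys_mconst: "mconst c \<in> mpolys m"
  by (auto simp: mpolys_def mconst_def split: if_splits)

lemma mpolys_mvar: "i < m \<Longrightarrow> mvar i \<in> mpolys m"
  by (auto simp: mpolys_def mvar_def)

lemma mpolys_add: "p \<in> mpolys m \<Longrightarrow> q \<in> mpolys m \<Longrightarrow> p + q \<in> mpolys m"
  using keys_add[of p q] by (auto simp: mpolys_def)

lemma mpolys_mult: assumes "p \<in> mpolys m" "q \<in> mpolys m" shows "p * q \<in> mpolys m"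
  unfolding mpolys_def
proof clarify
  fix t x assume t: "t \<in> Poly_Mapping.keys (p * q)" and x: "x \<in> Poly_Mapping.keys t"
  obtain a b where "a \<in> Poly_Mapping.keys p" "b \<in> Poly_Mapping.keys q" "t = a + b"
    using t keys_mult[of p q] by blast
  then show "x < m" using x keys_add[of a b] assms by (auto simp: mpolys_def)
qed

lemma mpolys_sum: "(\<And>i. i \<in> A \<Longrightarrow> f i \<in> mpolys m) \<Longrightarrow> sum f A \<in> mpolys m"
  using mpolys_mconst[of 0 m]
  by (induction A rule: infinite_finite_induct) (auto simp: mpolys_add mconst_def)

lemma mpolys_one: "1 \<in> mpolys m"
  using mpolys_mconst[of 1 m] by (simp add: mconst_def)

lemma mpolys_prod: "(\<And>i. i \<in> A \<Longrightarrow> f i \<in> mpolys m) \<Longrightarrow> prod f A \<in> mpolys m"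
  using mpolys_one[of m]
  by (induction A rule: infinite_finite_induct) (auto simp: mpolys_mult)

lemma mpolys_power: "p \<in> mpolys m \<Longrightarrow> p ^ n \<in> mpolys m"
  using mpolys_one[of m] by (induction n) (auto simp: mpolys_mult)

lemma mpolys_uminus: "p \<in> mpolys m \<Longrightarrow> - p \<in> mpolys m"
  by (simp add: mpolys_def in_keys_iff)

lemma mpolys_diff: "p \<in> mpolys m \<Longrightarrow> q \<in> mpolys m \<Longrightarrow> p - q \<in> mpolys m"
  using mpolys_add[OF _ mpolys_uminus, of p m q] by simp

text \<open>A polynomial is its own value at its variables, \<open>meval mconst mvar p\<close>; this
  expression is built from constants and variables by sums and products that stay inside
  \<open>mpolys m\<close>.\<close>

lemma mpolys_induct [consumes 1, case_names const var add mult]: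
  assumes p: "p \<in> mpolys m"
    and c: "\<And>c. P (mconst c)" and v: "\<And>i. i < m \<Longrightarrow> P (mvar i)"
    and add: "\<And>p q. p \<in> mpolys m \<Longrightarrow> q \<in> mpolys m \<Longrightarrow> P p \<Longrightarrow> P q \<Longrightarrow> P (p + q)"
    and mult: "\<And>p q. p \<in> mpolys m \<Longrightarrow> q \<in> mpolys m \<Longrightarrow> P p \<Longrightarrow> P q \<Longrightarrow> P (p * q)"
  shows "P p"
proof -
  define Q where "Q p \<longleftrightarrow> p \<in> mpolys m \<and> P p" for p
  have Qc: "Q (mconst c)" for c using c mpolys_mconst by (auto simp: Q_def)
  have Q1: "Q 1" "Q 0" using Qc[of 1] Qc[of 0] by (simp_all add: mconst_def)
  have Qm: "Q (a * b)" if "Q a" "Q b" for a b using that mult mpolys_mult by (auto simp: Q_def)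
  have Qa: "Q (a + b)" if "Q a" "Q b" for a b using that add mpolys_add by (auto simp: Q_def)
  have Qpow: "Q (a ^ k)" if "Q a" for a k using that by (induction k) (auto simp: Q1 Qm)
  have Qprod: "Q (prod f A)" if "\<And>i. i \<in> A \<Longrightarrow> Q (f i)" for f and A :: "nat set"
    using that by (induction A rule: infinite_finite_induct) (auto simp: Q1 Qm)
  have Qsum: "Q (sum f A)" if "\<And>i. i \<in> A \<Longrightarrow> Q (f i)" for f and A :: "(nat \<Rightarrow>\<^sub>0 nat) set"
    using that by (induction A rule: infinite_finite_induct) (auto simp: Q1 Qa)
  have Qv: "Q (mvar i)" if "i < m" for i using that v mpolys_mvar by (auto simp: Q_def)
  have "Q (meval mconst mvar p)"
    unfolding meval_def monom_eval_def
    by (intro Qsum Qm Qc Qprod Qpow Qv) (use p in \<open>auto simp: mpolys_def\<close>)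
  then show ?thesis by (simp add: Q_def meval_mconst_mvar)
qed

lemma meval_cong:
  assumes "p \<in> mpolys m" "\<And>i. i < m \<Longrightarrow> z i = z' i" shows "meval \<kappa> z p = meval \<kappa> z' p"
proof -
  have "z i = z' i" if "t \<in> Poly_Mapping.keys p" "i \<in> Poly_Mapping.keys t" for t i
    using assms that by (auto simp: mpolys_def)
  then show ?thesis unfolding meval_def monom_eval_def by simp
qed

lemma to_fract_mpolys_loc: "p \<in> mpolys m \<Longrightarrow> to_fract p \<in> mpolys_loc m f"
  unfolding mpolys_loc_def to_fract_def by (intro CollectI exI[of _ p] exI[of _ 0]) simp

text \<open>\<open>alg_hom\<close> promises additivity and multiplicativity only on a subset, hence
  an induction that never leaves \<open>mpolys m\<close>.\<close>

lemma alg_hom_to_fract: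
  assumes h: "alg_hom frac_const (mpolys_loc m f) j R \<theta>" and p: "p \<in> mpolys m"
    and j: "comm_ring_hom j"
  shows "\<theta> (to_fract p) = meval j (\<lambda>i. \<theta> (to_fract (mvar i))) p"
proof -
  interpret M: comm_ring_hom "meval j (\<lambda>i. \<theta> (to_fract (mvar i)))"
    by (rule comm_ring_hom_meval[OF j])
  show ?thesis using p
  proof (induction rule: mpolys_induct)
    case (const c)
    then show ?case using h by (simp add: alg_hom_def meval_mconst[OF j] frac_const_def)
  next
    case (var i)
    then show ?case by (simp add: meval_mvar[OF j])
  next
    case (add p q)
    then show ?case using h to_fract_mpolys_loc[OF add(1), of f] to_fract_mpolys_loc[OF add(2), of f]
      by (simp add: alg_hom_def M.hom_add)
  next
    case (mult p q)
    then show ?case using h to_fract_mpolys_loc[OF mult(1), of f] to_fract_mpolys_loc[OF mult(2), of f]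
      by (simp add: alg_hom_def M.hom_mult)
  qed
qed

lemma alg_hom_meval:
  assumes h: "alg_hom j R \<kappa>' S \<phi>" and R: "subalgebra j R" and p: "p \<in> mpolys n"
    and z: "\<And>i. i < n \<Longrightarrow> z i \<in> R" and j: "comm_ring_hom j" "comm_ring_hom \<kappa>'"
  shows "meval j z p \<in> R \<and> \<phi> (meval j z p) = meval \<kappa>' (\<lambda>i. \<phi> (z i)) p"
proof -
  interpret M: comm_ring_hom "meval j z" by (rule comm_ring_hom_meval[OF j(1)])
  interpret M': comm_ring_hom "meval \<kappa>' (\<lambda>i. \<phi> (z i))" by (rule comm_ring_hom_meval[OF j(2)])
  show ?thesis using p
  proof (induction rule: mpolys_induct)
    case (const c)
    then show ?case using h R
      by (auto simp: alg_hom_def subalgebra_def meval_mconst[OF j(1)] meval_mconst[OF j(2)])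
  next
    case (var i)
    then show ?case by (simp add: meval_mvar[OF j(1)] meval_mvar[OF j(2)] z)
  next
    case (add p q)
    then show ?case using h R by (simp add: alg_hom_def subalgebra_def M.hom_add M'.hom_add)
  next
    case (mult p q)
    then show ?case using h R by (simp add: alg_hom_def subalgebra_def M.hom_mult M'.hom_mult)
  qed
qed

section \<open>The norm form and its values\<close>

lemma norm_poly_mpolys: "norm_poly \<iota> n \<omega> \<in> mpolys n"
proof -
  define A where "A = generic_mult_mat \<iota> n \<omega>"
  have dim: "dim_row A = n" "dim_col A = n" by (simp_all add: A_def generic_mult_mat_def)
  have A: "A $$ (r, s) \<in> mpolys n" if "r < n" "s < n" for r s
    using that unfolding A_def generic_mult_mat_def
    by (auto intro!: mpolys_sum mpolys_mult mpolys_mvar mpolys_mconst)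
  have s: "signof p \<in> mpolys n" for p
    using mpolys_one[of n] mpolys_uminus[OF mpolys_one[of n]] by (auto simp: sign_def)
  have "det A \<in> mpolys n"
    unfolding det_def dim if_P[OF refl]
    by (intro mpolys_sum mpolys_mult mpolys_prod A s) (auto dest: permutes_in_image)
  then show ?thesis by (simp add: norm_poly_def A_def)
qed

definition eval_mult_mat ::
  "('k::field \<Rightarrow> 'l::field) \<Rightarrow> nat \<Rightarrow> (nat \<Rightarrow> 'l) \<Rightarrow> ('k \<Rightarrow> 'a::comm_ring_1) \<Rightarrow> (nat \<Rightarrow> 'a) \<Rightarrow> 'a mat" where
  "eval_mult_mat \<iota> n \<omega> \<kappa> z = mat n n (\<lambda>(r, s). \<Sum>i<n.
     z i * \<kappa> (module.representation (scale_by \<iota>) (\<omega> ` {..<n}) (\<omega> i * \<omega> s) (\<omega> r)))"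

lemma meval_norm_poly:
  assumes k: "comm_ring_hom \<kappa>"
  shows "meval \<kappa> z (norm_poly \<iota> n \<omega>) = det (eval_mult_mat \<iota> n \<omega> \<kappa> z)"
proof -
  interpret M: comm_ring_hom "meval \<kappa> z" by (rule comm_ring_hom_meval[OF k])
  have "map_mat (meval \<kappa> z) (generic_mult_mat \<iota> n \<omega>) = eval_mult_mat \<iota> n \<omega> \<kappa> z"
    by (rule eq_matI) (auto simp: generic_mult_mat_def eval_mult_mat_def M.hom_sum M.hom_mult
        meval_mvar[OF k] meval_mconst[OF k])
  then show ?thesis unfolding norm_poly_def by (metis M.hom_det)
qed

lemma meval_norm_poly_scale:
  assumes k: "comm_ring_hom \<kappa>"
  shows "meval \<kappa> (\<lambda>i. b * z i) (norm_poly \<iota> n \<omega>) = b ^ n * meval \<kappa> z (norm_poly \<iota> n \<omega>)"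
proof -
  have "eval_mult_mat \<iota> n \<omega> \<kappa> (\<lambda>i. b * z i) = b \<cdot>\<^sub>m eval_mult_mat \<iota> n \<omega> \<kappa> z"
    by (rule eq_matI) (auto simp: eval_mult_mat_def sum_distrib_left mult.assoc)
  then show ?thesis unfolding meval_norm_poly[OF k] by (simp add: det_smult eval_mult_mat_def)
qed

section \<open>Rational points from a retraction\<close>

definition tdeg :: "(nat \<Rightarrow>\<^sub>0 nat) \<Rightarrow> nat" where
  "tdeg t = (\<Sum>i\<in>Poly_Mapping.keys t. Poly_Mapping.lookup t i)"

text \<open>The sum of the degrees of all monomials instead of their maximum: clearing denominators
  only requires an upper bound for the degree.\<close>

definition hdeg :: "'k::field mpoly \<Rightarrow> nat" where
  "hdeg p = (\<Sum>t\<in>Poly_Mapping.keys p. tdeg t)"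

text \<open>This is \<open>Q ^ \<delta>\<close> times the value of \<open>p\<close> at
  \<open>P/Q\<close>, written without division; the truncated subtraction is exact once
  \<open>hdeg p \<le> \<delta>\<close>.\<close>

definition hsub :: "nat \<Rightarrow> (nat \<Rightarrow> 'k::field mpoly) \<Rightarrow> 'k mpoly \<Rightarrow> 'k mpoly \<Rightarrow> 'k mpoly" where
  "hsub \<delta> P Q p = (\<Sum>t\<in>Poly_Mapping.keys p.
     mconst (Poly_Mapping.lookup p t) * monom_eval P t * Q ^ (\<delta> - tdeg t))"

lemma tdeg_le_hdeg: "t \<in> Poly_Mapping.keys p \<Longrightarrow> tdeg t \<le> hdeg p"
  unfolding hdeg_def by (rule member_le_sum) auto

lemma hom_monom_eval:
  assumes "comm_ring_hom h" shows "h (monom_eval z t) = monom_eval (\<lambda>i. h (z i)) t"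
proof -
  interpret comm_ring_hom h by fact
  show ?thesis by (simp add: monom_eval_def hom_prod hom_power)
qed

lemma monom_eval_scale: "monom_eval (\<lambda>i. b * z i) t = b ^ tdeg t * monom_eval z t"
  by (simp add: monom_eval_def tdeg_def power_mult_distrib prod.distrib power_sum)

lemma meval_hsub:
  fixes \<kappa> :: "'k::field \<Rightarrow> 'a::field"
  assumes k: "comm_ring_hom \<kappa>" and q: "meval \<kappa> z Q \<noteq> 0" and d: "hdeg p \<le> \<delta>"
  shows "meval \<kappa> z (hsub \<delta> P Q p)
    = meval \<kappa> z Q ^ \<delta> * meval \<kappa> (\<lambda>l. meval \<kappa> z (P l) / meval \<kappa> z Q) p"
proof -
  interpret M: comm_ring_hom "meval \<kappa> z" by (rule comm_ring_hom_meval[OF k])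
  let ?q = "meval \<kappa> z Q"
  let ?x = "\<lambda>l. meval \<kappa> z (P l) / ?q"
  have 1: "meval \<kappa> z (monom_eval P t) * ?q ^ (\<delta> - tdeg t) = ?q ^ \<delta> * monom_eval ?x t"
    if "t \<in> Poly_Mapping.keys p" for t
  proof -
    have "meval \<kappa> z (monom_eval P t) = monom_eval (\<lambda>l. meval \<kappa> z (P l)) t"
      by (rule hom_monom_eval[OF comm_ring_hom_meval[OF k]])
    also have "\<dots> = monom_eval (\<lambda>l. ?q * ?x l) t" using q by simp
    also have "\<dots> = ?q ^ tdeg t * monom_eval ?x t" by (rule monom_eval_scale)
    finally have "meval \<kappa> z (monom_eval P t) * ?q ^ (\<delta> - tdeg t) = ?q ^ (tdeg t + (\<delta> - tdeg t)) * monom_eval ?x t"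
      by (simp add: power_add)
    moreover have "tdeg t + (\<delta> - tdeg t) = \<delta>" using tdeg_le_hdeg[OF that] d by simp
    ultimately show ?thesis by simp
  qed
  have "meval \<kappa> z (hsub \<delta> P Q p) = (\<Sum>t\<in>Poly_Mapping.keys p.
      \<kappa> (Poly_Mapping.lookup p t) * (meval \<kappa> z (monom_eval P t) * ?q ^ (\<delta> - tdeg t)))"
    by (simp add: hsub_def M.hom_sum M.hom_mult M.hom_power meval_mconst[OF k] mult.assoc)
  also have "\<dots> = (\<Sum>t\<in>Poly_Mapping.keys p. ?q ^ \<delta> * (\<kappa> (Poly_Mapping.lookup p t) * monom_eval ?x t))"
    by (intro sum.cong refl) (simp only: 1 mult.left_commute)
  also have "\<dots> = ?q ^ \<delta> * meval \<kappa> ?x p"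
    by (simp add: meval_def sum_distrib_left)
  finally show ?thesis .
qed

lemma mpolys_hsub:
  assumes "p \<in> mpolys m" "\<And>l. l < m \<Longrightarrow> P l \<in> mpolys n" "Q \<in> mpolys n"
  shows "hsub \<delta> P Q p \<in> mpolys n"
proof -
  have "P i \<in> mpolys n" if "t \<in> Poly_Mapping.keys p" "i \<in> Poly_Mapping.keys t" for t i
    using assms(1,2) that unfolding mpolys_def by blast
  then show ?thesis
    unfolding hsub_def monom_eval_def using assms(3)
    by (intro mpolys_sum mpolys_mult mpolys_mconst mpolys_prod mpolys_power)
qed

lemma common_power:
  assumes f: "f \<in> mpolys m" "f \<noteq> 0" and S: "finite S" "S \<subseteq> mpolys_loc m f"
  shows "\<exists>K. \<forall>x\<in>S. \<exists>p\<in>mpolys m. to_fract (f ^ K) * x = to_fract p"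
  using S
proof (induction S rule: finite_induct)
  case (insert x S)
  then obtain K where K: "\<forall>x\<in>S. \<exists>p\<in>mpolys m. to_fract (f ^ K) * x = to_fract p" by blast
  obtain p i where p: "x = Fract p (f ^ i)" "p \<in> mpolys m"
    using insert(4) unfolding mpolys_loc_def by blast
  have x: "to_fract (f ^ i) * x = to_fract p" using p f by (simp add: to_fract_def eq_fract)
  have "\<exists>p\<in>mpolys m. to_fract (f ^ (K + i)) * y = to_fract p" if y: "y \<in> insert x S" for y
  proof (cases "y = x")
    case True
    have "to_fract (f ^ (K + i)) * y = to_fract (f ^ K) * (to_fract (f ^ i) * x)"
      by (simp add: True power_add)
    also have "\<dots> = to_fract (f ^ K * p)" unfolding x by simp
    finally show ?thesis using mpolys_mult[OF mpolys_power[OF f(1)] p(2)] by blast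
  next
    case False
    then obtain r where r: "r \<in> mpolys m" "to_fract (f ^ K) * y = to_fract r" using K y by blast
    have "to_fract (f ^ (K + i)) * y = to_fract (f ^ i) * (to_fract (f ^ K) * y)"
      by (simp add: power_add)
    also have "\<dots> = to_fract (f ^ i * r)" unfolding r by simp
    finally show ?thesis using mpolys_mult[OF mpolys_power[OF f(1)] r(1)] by blast
  qed
  then show ?case by blast
qed simp

lemma common_denominator:
  fixes x :: "nat \<Rightarrow> 'f::field"
  assumes "\<And>i. i < n \<Longrightarrow> \<exists>p\<in>R. \<exists>q\<in>R. q \<noteq> 0 \<and> x i = p / q"
    and one: "1 \<in> R" and mult: "\<And>p q. p \<in> R \<Longrightarrow> q \<in> R \<Longrightarrow> p * q \<in> R"
  shows "\<exists>b\<in>R. b \<noteq> 0 \<and> (\<forall>i<n. b * x i \<in> R)"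
  using assms(1)
proof (induction n)
  case 0
  then show ?case using one by (intro bexI[of _ 1]) auto
next
  case (Suc n)
  then obtain b where b: "b \<in> R" "b \<noteq> 0" "\<And>i. i < n \<Longrightarrow> b * x i \<in> R" by (metis less_SucI)
  obtain p q where pq: "p \<in> R" "q \<in> R" "q \<noteq> 0" "x n = p / q" using Suc.prems[of n] by blast
  have "(b * q) * x i \<in> R" if "i < Suc n" for i
  proof (cases "i = n")
    case True
    have "(b * q) * x i = b * p" using pq True by simp
    then show ?thesis using mult[OF b(1) pq(1)] by metis
  next
    case False
    then have "q * (b * x i) \<in> R" using that b pq mult by simp
    then show ?thesis by (simp add: mult_ac)
  qed
  then show ?case using b pq mult by (intro bexI[of _ "b * q"]) auto
qed

locale torus_function_field =
  fixes \<iota> :: "'k::field \<Rightarrow> 'l::field" and j :: "'k \<Rightarrow> 'f::field" and n :: nat and \<omega> :: "nat \<Rightarrow> 'l"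
    and \<theta> :: "'k mpoly fract \<Rightarrow> 'f" and N :: "'k mpoly"
  assumes j: "field_hom j" and N_def: "N = norm_poly \<iota> n \<omega>"
    and hom: "alg_hom frac_const (mpolys_loc n N) j UNIV \<theta>"
    and ker: "{x \<in> mpolys_loc n N. \<theta> x = 0} = {(to_fract N - 1) * y | y. y \<in> mpolys_loc n N}"
    and frac: "\<And>z. \<exists>x\<in>mpolys_loc n N. \<exists>y\<in>mpolys_loc n N. \<theta> y \<noteq> 0 \<and> z = \<theta> x / \<theta> y"
begin

text \<open>The generic point of the torus, with coordinates in the function field.\<close>

definition \<zeta> :: "nat \<Rightarrow> 'f" where "\<zeta> i = \<theta> (to_fract (mvar i))"

lemma j': "comm_ring_hom j" by (rule field_hom_comm_ring_hom[OF j])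

lemma N_mpolys: "N \<in> mpolys n" unfolding N_def by (rule norm_poly_mpolys)

lemma eval: "p \<in> mpolys n \<Longrightarrow> \<theta> (to_fract p) = meval j \<zeta> p"
  unfolding \<zeta>_def[abs_def] by (rule alg_hom_to_fract[OF hom _ j'])

lemma zeta_N: "meval j \<zeta> N = 1"
proof -
  interpret M: comm_ring_hom "meval j \<zeta>" by (rule comm_ring_hom_meval[OF j'])
  have "to_fract N - 1 \<in> {x \<in> mpolys_loc n N. \<theta> x = 0}"
    unfolding ker using to_fract_mpolys_loc[OF mpolys_one, of n N]
    by (intro CollectI exI[of _ 1]) simp
  then have "\<theta> (to_fract (N - 1)) = 0" by simp
  then show ?thesis
    using eval[OF mpolys_diff[OF N_mpolys mpolys_one]] by (simp add: M.hom_minus)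
qed

lemma N_nonzero: "N \<noteq> 0"
proof
  assume "N = 0"
  then have "meval j \<zeta> N = 0" by (simp add: meval_def)
  then show False using zeta_N by simp
qed

text \<open>The norm is 1 at the generic point, so inverting it adds no new functions.\<close>

lemma eval_loc:
  assumes "x \<in> mpolys_loc n N"
  obtains p where "p \<in> mpolys n" "\<theta> x = meval j \<zeta> p"
proof -
  interpret M: comm_ring_hom "meval j \<zeta>" by (rule comm_ring_hom_meval[OF j'])
  obtain p i where p: "x = Fract p (N ^ i)" "p \<in> mpolys n" using assms unfolding mpolys_loc_def by blast
  have Ni: "N ^ i \<in> mpolys n" by (rule mpolys_power[OF N_mpolys])
  have "x * to_fract (N ^ i) = to_fract p" using p N_nonzero by (simp add: to_fract_def eq_fract)
  moreover have "\<theta> (x * to_fract (N ^ i)) = \<theta> x * \<theta> (to_fract (N ^ i))"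
    using hom assms to_fract_mpolys_loc[OF Ni, of N] unfolding alg_hom_def by blast
  moreover have "\<theta> (to_fract (N ^ i)) = 1" unfolding eval[OF Ni] by (simp add: M.hom_power zeta_N)
  ultimately have "\<theta> x = meval j \<zeta> p" using eval[OF p(2)] by simp
  then show thesis using that p(2) by blast
qed

lemma frac_mpolys:
  "\<exists>p\<in>mpolys n. \<exists>q\<in>mpolys n. meval j \<zeta> q \<noteq> 0 \<and> z = meval j \<zeta> p / meval j \<zeta> q"
proof -
  obtain x y where xy: "x \<in> mpolys_loc n N" "y \<in> mpolys_loc n N" "\<theta> y \<noteq> 0" "z = \<theta> x / \<theta> y"
    using frac by blast
  obtain p where "p \<in> mpolys n" "\<theta> x = meval j \<zeta> p" using eval_loc[OF xy(1)] .
  moreover obtain q where "q \<in> mpolys n" "\<theta> y = meval j \<zeta> q" using eval_loc[OF xy(2)] .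
  ultimately show ?thesis using xy by metis
qed

text \<open>A polynomial that vanishes at the generic point becomes a multiple of
  \<open>N - 1\<close> after multiplication by a power of \<open>N\<close>. Where the norm is 1,
  that power is 1 and the multiple is 0.\<close>

lemma specialize:
  fixes \<kappa> :: "'k \<Rightarrow> 'e::idom"
  assumes p: "p \<in> mpolys n" "meval j \<zeta> p = 0" and k: "comm_ring_hom \<kappa>" and z: "meval \<kappa> z N = 1"
  shows "meval \<kappa> z p = 0"
proof -
  interpret M: comm_ring_hom "meval \<kappa> z" by (rule comm_ring_hom_meval[OF k])
  have "to_fract p \<in> {x \<in> mpolys_loc n N. \<theta> x = 0}"
    using eval[OF p(1)] p to_fract_mpolys_loc by simp
  then obtain y where y: "y \<in> mpolys_loc n N" "to_fract p = (to_fract N - 1) * y"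
    unfolding ker by blast
  obtain q i where q: "y = Fract q (N ^ i)" using y(1) unfolding mpolys_loc_def by blast
  have "to_fract (N ^ i) * y = to_fract q" using q N_nonzero by (simp add: to_fract_def eq_fract)
  moreover have "to_fract (N ^ i * p) = (to_fract N - 1) * (to_fract (N ^ i) * y)"
    by (simp add: y(2))
  ultimately have "to_fract (N ^ i * p) = to_fract ((N - 1) * q)" by simp
  then have "N ^ i * p = (N - 1) * q" by (simp only: to_fract_eq_iff)
  then have "meval \<kappa> z (N ^ i * p) = meval \<kappa> z ((N - 1) * q)" by simp
  then show ?thesis by (simp add: M.hom_mult M.hom_power M.hom_minus z)
qed

text \<open>\<open>A/B\<close> is a rational map from affine space to the torus, and
  \<open>\<xi>\<close> is a point of affine space over the function field that it sends to the
  generic point. The value \<open>B ^ n\<close> of the norm at \<open>A\<close> is the homogeneous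
  form of norm 1 for \<open>A/B\<close>.\<close>

lemma retract_data:
  assumes r: "retract_rational j"
  shows "\<exists>m A B \<xi>. (\<forall>i<n. A i \<in> mpolys m) \<and> B \<in> mpolys m \<and> meval mconst A N = B ^ n \<and>
    meval j \<xi> B \<noteq> 0 \<and> (\<forall>i<n. meval j \<xi> (A i) = \<zeta> i * meval j \<xi> B)"
proof -
  obtain R m f \<phi> \<psi> where R: "subalgebra j R" "\<And>z. \<exists>x\<in>R. \<exists>y\<in>R. y \<noteq> 0 \<and> z = x / y"
    and f: "f \<in> mpolys m" "f \<noteq> 0"
    and phi: "alg_hom j R frac_const (mpolys_loc m f) \<phi>"
    and psi: "alg_hom frac_const (mpolys_loc m f) j R \<psi>"
    and inv: "\<And>x. x \<in> R \<Longrightarrow> \<psi> (\<phi> x) = x"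
    using r unfolding retract_rational_def by blast
  interpret J: field_hom j by (rule j)
  interpret FC: comm_ring_hom frac_const by (rule comm_ring_hom_frac_const)
  have "j 1 \<in> R" using R(1) by (auto simp: subalgebra_def)
  then have one: "1 \<in> R" by simp
  have Rm: "p * q \<in> R" if "p \<in> R" "q \<in> R" for p q using R(1) that by (auto simp: subalgebra_def)
  \<comment> \<open>\<open>\<phi>\<close> is known only on \<open>R\<close>, so the generic point is
    first scaled into \<open>R\<close>; its norm becomes \<open>b ^ n\<close>.\<close>
  obtain b where b: "b \<in> R" "b \<noteq> 0" "\<And>i. i < n \<Longrightarrow> b * \<zeta> i \<in> R"
    using common_denominator[of n R \<zeta>, OF R(2) one Rm] by blast
  define a where "a i = b * \<zeta> i" for i
  have aR: "a i \<in> R" if "i < n" for i using b(3)[OF that] by (simp add: a_def)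
  have Na: "meval j a N = b ^ n"
    unfolding a_def N_def meval_norm_poly_scale[OF j'] using zeta_N by (simp add: N_def)
  have phim: "\<phi> (x * y) = \<phi> x * \<phi> y" if "x \<in> R" "y \<in> R" for x y
    using phi that by (auto simp: alg_hom_def)
  have "\<phi> (j 1) = frac_const 1" using phi unfolding alg_hom_def by blast
  then have phi1: "\<phi> 1 = 1" by simp
  have "b ^ k \<in> R \<and> \<phi> (b ^ k) = \<phi> b ^ k" for k
    by (induction k) (auto simp: one phi1 Rm b(1) phim)
  then have "\<phi> (meval j a N) = \<phi> b ^ n" unfolding Na by blast
  moreover have "\<phi> (meval j a N) = meval frac_const (\<lambda>i. \<phi> (a i)) N"
    using alg_hom_meval[where z = a, OF phi R(1) N_mpolys aR j' comm_ring_hom_frac_const] by blast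
  ultimately have Nphi: "meval frac_const (\<lambda>i. \<phi> (a i)) N = \<phi> b ^ n" by simp
  have loc: "\<phi> x \<in> mpolys_loc m f" if "x \<in> R" for x using phi that by (auto simp: alg_hom_def)
  \<comment> \<open>One power of \<open>f\<close> clears the denominators of all the images under
    \<open>\<phi>\<close>.\<close>
  obtain K where K: "\<forall>x\<in>insert (\<phi> b) ((\<lambda>i. \<phi> (a i)) ` {..<n}). \<exists>p\<in>mpolys m. to_fract (f ^ K) * x = to_fract p"
    using common_power[OF f, of "insert (\<phi> b) ((\<lambda>i. \<phi> (a i)) ` {..<n})"] loc[OF b(1)] loc[OF aR] by auto
  obtain B where B: "B \<in> mpolys m" "to_fract (f ^ K) * \<phi> b = to_fract B" using K by blast
  have "\<forall>i. \<exists>p. i < n \<longrightarrow> p \<in> mpolys m \<and> to_fract (f ^ K) * \<phi> (a i) = to_fract p"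
    using K by auto
  then obtain A where A: "\<And>i. i < n \<Longrightarrow> A i \<in> mpolys m"
    "\<And>i. i < n \<Longrightarrow> to_fract (f ^ K) * \<phi> (a i) = to_fract (A i)" by metis
  define \<xi> where "\<xi> i = \<psi> (to_fract (mvar i))" for i
  have pev: "\<psi> (to_fract p) = meval j \<xi> p" if "p \<in> mpolys m" for p
    unfolding \<xi>_def[abs_def] by (rule alg_hom_to_fract[OF psi that j'])
  have psim: "\<psi> (x * y) = \<psi> x * \<psi> y" if "x \<in> mpolys_loc m f" "y \<in> mpolys_loc m f" for x y
    using psi that by (auto simp: alg_hom_def)
  define c where "c = \<psi> (to_fract (f ^ K))"
  have fK: "to_fract (f ^ K) \<in> mpolys_loc m f" by (rule to_fract_mpolys_loc[OF mpolys_power[OF f(1)]])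
  \<comment> \<open>\<open>\<psi>\<close> cannot kill \<open>f ^ K\<close>, which is invertible in
    the localization.\<close>
  have "Fract 1 (f ^ K) \<in> mpolys_loc m f" unfolding mpolys_loc_def using mpolys_one by blast
  then have "\<psi> (to_fract (f ^ K) * Fract 1 (f ^ K)) = c * \<psi> (Fract 1 (f ^ K))"
    unfolding c_def by (rule psim[OF fK])
  moreover have "to_fract (f ^ K) * Fract 1 (f ^ K) = 1"
    using f(2) by (simp add: to_fract_def eq_fract One_fract_def)
  moreover have "\<psi> (frac_const 1) = j 1" using psi unfolding alg_hom_def by blast
  ultimately have c: "c \<noteq> 0" by auto
  have evA: "meval j \<xi> (A i) = c * a i" if "i < n" for i
    using pev[OF A(1)[OF that]] psim[OF fK loc[OF aR[OF that]]] inv[OF aR[OF that]] A(2)[OF that]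
    by (simp add: c_def)
  have evB: "meval j \<xi> B = c * b"
    using pev[OF B(1)] psim[OF fK loc[OF b(1)]] inv[OF b(1)] B(2) by (simp add: c_def)
  show ?thesis
  proof (rule exI[of _ m], rule exI[of _ A], rule exI[of _ B], rule exI[of _ \<xi>], intro conjI allI impI)
    show "meval j \<xi> B \<noteq> 0" using evB c b by simp
    show "A i \<in> mpolys m" if "i < n" for i by (rule A(1)[OF that])
    show "B \<in> mpolys m" by (rule B(1))
    show "meval j \<xi> (A i) = \<zeta> i * meval j \<xi> B" if "i < n" for i
      unfolding evA[OF that] evB a_def by simp
    have "to_fract (meval mconst A N) = meval frac_const (\<lambda>i. to_fract (A i)) N"
      using hom_meval[OF comm_ring_hom_to_fract, of mconst A N] by (simp add: frac_const_def[abs_def])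
    also have "\<dots> = meval frac_const (\<lambda>i. to_fract (f ^ K) * \<phi> (a i)) N"
      by (rule meval_cong[OF N_mpolys]) (simp only: A(2))
    also have "\<dots> = to_fract (f ^ K) ^ n * \<phi> b ^ n"
      using Nphi unfolding N_def meval_norm_poly_scale[OF comm_ring_hom_frac_const] by simp
    also have "\<dots> = to_fract (B ^ n)"
      unfolding power_mult_distrib[symmetric] B(2) by (simp add: to_fract_power)
    finally show "meval mconst A N = B ^ n" by (simp only: to_fract_eq_iff)
  qed
qed

text \<open>The coordinates of \<open>\<xi>\<close> are written as quotients \<open>P l / Q\<close>
  of polynomials in the generic point. Cleared of denominators, the equations of the section are
  polynomial identities at the generic point, so they specialize to points of norm 1 over another
  field, as long as \<open>D\<close> does not vanish there.\<close>

lemma torus_point_map: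
  fixes e :: "'e::field itself"
  assumes r: "retract_rational j"
  obtains m A B P Q D where "\<And>i. i < n \<Longrightarrow> A i \<in> mpolys m" "B \<in> mpolys m" "B \<noteq> 0"
    "meval mconst A N = B ^ n" "D \<in> mpolys n" "meval j \<zeta> D \<noteq> 0"
    "\<And>l. l < m \<Longrightarrow> P l \<in> mpolys n" "Q \<in> mpolys n"
    "\<And>(\<kappa> :: 'k \<Rightarrow> 'e) z \<xi>. comm_ring_hom \<kappa> \<Longrightarrow> meval \<kappa> z N = 1 \<Longrightarrow> meval \<kappa> z D \<noteq> 0 \<Longrightarrow>
      \<xi> = (\<lambda>l. meval \<kappa> z (P l) / meval \<kappa> z Q) \<Longrightarrow>
      meval \<kappa> \<xi> B \<noteq> 0 \<and> (\<forall>i<n. meval \<kappa> \<xi> (A i) = z i * meval \<kappa> \<xi> B)"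
proof -
  obtain m A B \<xi> where A: "\<And>i. i < n \<Longrightarrow> A i \<in> mpolys m" and B: "B \<in> mpolys m"
    and AB: "meval mconst A N = B ^ n" and xiB: "meval j \<xi> B \<noteq> 0"
    and xiA: "\<And>i. i < n \<Longrightarrow> meval j \<xi> (A i) = \<zeta> i * meval j \<xi> B"
    using retract_data[OF r] by metis
  interpret M: comm_ring_hom "meval j \<zeta>" by (rule comm_ring_hom_meval[OF j'])
  define R where "R = meval j \<zeta> ` mpolys n"
  have R1: "1 \<in> R" unfolding R_def using mpolys_one[of n] by (force simp: M.hom_one)
  have Rm: "p * q \<in> R" if pq: "p \<in> R" "q \<in> R" for p q
  proof -
    obtain p' q' where "p' \<in> mpolys n" "q' \<in> mpolys n" "p = meval j \<zeta> p'" "q = meval j \<zeta> q'"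
      using pq unfolding R_def by blast
    then have "p * q = meval j \<zeta> (p' * q')" "p' * q' \<in> mpolys n"
      by (simp_all add: M.hom_mult mpolys_mult)
    then show ?thesis unfolding R_def by blast
  qed
  have "\<exists>b\<in>R. b \<noteq> 0 \<and> (\<forall>i<m. b * \<xi> i \<in> R)"
  proof (rule common_denominator[OF _ R1 Rm])
    fix i
    show "\<exists>p\<in>R. \<exists>q\<in>R. q \<noteq> 0 \<and> \<xi> i = p / q" using frac_mpolys[of "\<xi> i"] unfolding R_def by blast
  qed
  then obtain Q where Q: "Q \<in> mpolys n" "meval j \<zeta> Q \<noteq> 0" "\<And>l. l < m \<Longrightarrow> meval j \<zeta> Q * \<xi> l \<in> R"
    unfolding R_def by blast
  have "\<forall>l. \<exists>p. l < m \<longrightarrow> p \<in> mpolys n \<and> meval j \<zeta> Q * \<xi> l = meval j \<zeta> p"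
    using Q(3) unfolding R_def by blast
  then obtain P where P: "\<And>l. l < m \<Longrightarrow> P l \<in> mpolys n" "\<And>l. l < m \<Longrightarrow> meval j \<zeta> Q * \<xi> l = meval j \<zeta> (P l)"
    by metis
  have xiP: "\<xi> l = meval j \<zeta> (P l) / meval j \<zeta> Q" if "l < m" for l
    using P(2)[OF that] Q(2) by (simp add: field_simps)
  define \<delta> where "\<delta> = hdeg B + (\<Sum>i<n. hdeg (A i))"
  have dB: "hdeg B \<le> \<delta>" by (simp add: \<delta>_def)
  have dA: "hdeg (A i) \<le> \<delta>" if "i < n" for i
    unfolding \<delta>_def using member_le_sum[of i "{..<n}" "\<lambda>i. hdeg (A i)"] that by simp
  \<comment> \<open>Nonvanishing of \<open>D\<close> keeps both \<open>Q\<close> and the value of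
    \<open>B\<close> at the new point away from 0.\<close>
  define D where "D = Q * hsub \<delta> P Q B"
  define V where "V i = hsub \<delta> P Q (A i) - mvar i * hsub \<delta> P Q B" for i
  have hB: "hsub \<delta> P Q B \<in> mpolys n" by (rule mpolys_hsub[where P = P, OF B P(1) Q(1)])
  have hA: "hsub \<delta> P Q (A i) \<in> mpolys n" if "i < n" for i by (rule mpolys_hsub[where P = P, OF A[OF that] P(1) Q(1)])
  have Vm: "V i \<in> mpolys n" if "i < n" for i
    unfolding V_def by (intro mpolys_diff mpolys_mult mpolys_mvar hA hB that)
  have xc: "meval j (\<lambda>l. meval j \<zeta> (P l) / meval j \<zeta> Q) p = meval j \<xi> p" if "p \<in> mpolys m" for p
    by (rule meval_cong[OF that]) (simp only: xiP)
  note h = meval_hsub[OF j' Q(2)]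
  have D0: "meval j \<zeta> D \<noteq> 0"
    unfolding D_def M.hom_mult h[OF dB] xc[OF B] using Q(2) xiB by simp
  have V0: "meval j \<zeta> (V i) = 0" if "i < n" for i
    unfolding V_def M.hom_minus M.hom_mult h[OF dB] h[OF dA[OF that]] xc[OF B] xc[OF A[OF that]]
      xiA[OF that] meval_mvar[OF j'] by simp
  have B0: "B \<noteq> 0" using xiB by (auto simp: meval_def)
  show thesis
  proof (rule that[OF A B B0 AB _ D0 P(1) Q(1)])
    show "D \<in> mpolys n" unfolding D_def by (intro mpolys_mult Q hB)
  next
    fix \<kappa> :: "'k \<Rightarrow> 'e" and z \<xi>
    assume k: "comm_ring_hom \<kappa>" and zN: "meval \<kappa> z N = 1" and zD: "meval \<kappa> z D \<noteq> 0"
      and xi: "\<xi> = (\<lambda>l. meval \<kappa> z (P l) / meval \<kappa> z Q)"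
    interpret M': comm_ring_hom "meval \<kappa> z" by (rule comm_ring_hom_meval[OF k])
    have zQ: "meval \<kappa> z Q \<noteq> 0" using zD by (auto simp: D_def M'.hom_mult)
    note h' = meval_hsub[OF k zQ, of _ _ P, folded xi]
    have nB: "meval \<kappa> \<xi> B \<noteq> 0" using zD unfolding D_def M'.hom_mult h'[OF dB] by auto
    have "meval \<kappa> \<xi> (A i) = z i * meval \<kappa> \<xi> B" if i: "i < n" for i
    proof -
      have "meval \<kappa> z (V i) = 0" by (rule specialize[OF Vm[OF i] V0[OF i] k zN])
      then have "meval \<kappa> z Q ^ \<delta> * (meval \<kappa> \<xi> (A i) - z i * meval \<kappa> \<xi> B) = 0"
        unfolding V_def M'.hom_minus M'.hom_mult h'[OF dB] h'[OF dA[OF i]] meval_mvar[OF k]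
        by (simp add: algebra_simps)
      then show ?thesis using zQ by simp
    qed
    then show "meval \<kappa> \<xi> B \<noteq> 0 \<and> (\<forall>i<n. meval \<kappa> \<xi> (A i) = z i * meval \<kappa> \<xi> B)" using nB by blast
  qed
qed

end

lemma digits_unique:
  fixes a b :: "nat \<Rightarrow> nat"
  assumes "\<And>i. i < m \<Longrightarrow> a i < M" "\<And>i. i < m \<Longrightarrow> b i < M"
    and "(\<Sum>i<m. a i * M ^ i) = (\<Sum>i<m. b i * M ^ i)" and "i < m"
  shows "a i = b i"
  using assms
proof (induction m arbitrary: a b i)
  case (Suc m)
  have e: "(\<Sum>i<Suc m. f i * M ^ i) = f 0 + M * (\<Sum>i<m. f (Suc i) * M ^ i)" for f :: "nat \<Rightarrow> nat"
    unfolding sum.lessThan_Suc_shift by (simp add: sum_distrib_left mult_ac)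
  have eq: "a 0 + M * (\<Sum>i<m. a (Suc i) * M ^ i) = b 0 + M * (\<Sum>i<m. b (Suc i) * M ^ i)"
    using Suc.prems(3) unfolding e .
  have lt: "a 0 < M" "b 0 < M" using Suc.prems(1)[of 0] Suc.prems(2)[of 0] by auto
  have 0: "a 0 = b 0"
    using arg_cong[OF eq, of "\<lambda>x. x mod M"] lt by simp
  then have s: "(\<Sum>i<m. a (Suc i) * M ^ i) = (\<Sum>i<m. b (Suc i) * M ^ i)" using eq lt by simp
  have "a (Suc i) = b (Suc i)" if "i < m" for i
    by (rule Suc.IH[of "\<lambda>i. a (Suc i)" "\<lambda>i. b (Suc i)", OF _ _ s that])
       (rule Suc.prems, simp)+
  then show ?case using 0 Suc.prems(4) by (cases i) auto
qed simp

text \<open>Kronecker substitution: with \<open>M\<close> above all exponents,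
  \<open>s ^ (M ^ i)\<close> in place of the variable \<open>i\<close> turns distinct monomials into
  distinct powers of \<open>s\<close>, and a nonzero polynomial in one variable has a nonzero value
  on the infinite set \<open>S\<close>. Closure under products keeps the coordinates in
  \<open>S\<close>.\<close>

lemma mpoly_nonvanishing:
  fixes p :: "'a::field mpoly"
  assumes p: "p \<noteq> 0" and S: "infinite S" "1 \<in> S" "\<And>x y. x \<in> S \<Longrightarrow> y \<in> S \<Longrightarrow> x * y \<in> S"
  obtains c where "\<And>i. c i \<in> S" "meval (\<lambda>x. x) c p \<noteq> 0"
proof -
  let ?I = "\<Union>t\<in>Poly_Mapping.keys p. Poly_Mapping.keys t"
  have "finite ?I" by simp
  then obtain m where m: "?I \<subseteq> {..<m}" using finite_nat_iff_bounded by blast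
  let ?L = "\<Union>t\<in>Poly_Mapping.keys p. Poly_Mapping.lookup t ` {..<m}"
  have "finite ?L" by simp
  then obtain M where M: "?L \<subseteq> {..<M}" using finite_nat_iff_bounded by blast
  define K where "K t = (\<Sum>i<m. Poly_Mapping.lookup t i * M ^ i)" for t :: "nat \<Rightarrow>\<^sub>0 nat"
  have inj: "t = s" if ts: "t \<in> Poly_Mapping.keys p" "s \<in> Poly_Mapping.keys p" "K t = K s" for t s
  proof (rule poly_mapping_eqI)
    fix i
    show "Poly_Mapping.lookup t i = Poly_Mapping.lookup s i"
    proof (cases "i < m")
      case True
      show ?thesis
        by (rule digits_unique[OF _ _ ts(3)[unfolded K_def] True]) (use ts M in blast)+
    next
      case False
      then have "i \<notin> Poly_Mapping.keys t" "i \<notin> Poly_Mapping.keys s" using m ts by auto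
      then show ?thesis by (simp add: in_keys_iff)
    qed
  qed
  define q where "q = (\<Sum>t\<in>Poly_Mapping.keys p. monom (Poly_Mapping.lookup p t) (K t))"
  obtain t0 where t0: "t0 \<in> Poly_Mapping.keys p" using p by (metis all_not_in_conv keys_eq_empty)
  have "coeff q (K t0) = (\<Sum>t\<in>Poly_Mapping.keys p. if t = t0 then Poly_Mapping.lookup p t else 0)"
    unfolding q_def coeff_sum by (intro sum.cong refl) (use inj t0 in auto)
  also have "\<dots> = Poly_Mapping.lookup p t0" using t0 by simp
  also have "\<dots> \<noteq> 0" using t0 by (simp add: in_keys_iff)
  finally have "q \<noteq> 0" by auto
  then have "finite {x. poly q x = 0}" by (rule poly_roots_finite)
  then have "\<not> S \<subseteq> {x. poly q x = 0}" using S(1) finite_subset by blast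
  then obtain s where s: "s \<in> S" "poly q s \<noteq> 0" by blast
  have pw: "s ^ k \<in> S" for k by (induction k) (use S s in auto)
  have mn: "monom_eval (\<lambda>i. s ^ (M ^ i)) t = s ^ K t" if "t \<in> Poly_Mapping.keys p" for t
  proof -
    have "monom_eval (\<lambda>i. s ^ (M ^ i)) t = (\<Prod>i<m. (s ^ (M ^ i)) ^ Poly_Mapping.lookup t i)"
      by (rule monom_eval_superset) (use m that in auto)
    also have "\<dots> = s ^ K t"
      unfolding K_def power_sum by (simp add: power_mult[symmetric] mult.commute)
    finally show ?thesis .
  qed
  have "meval (\<lambda>x. x) (\<lambda>i. s ^ (M ^ i)) p = poly q s"
    unfolding meval_def q_def poly_sum by (intro sum.cong refl) (simp add: mn poly_monom)
  then show thesis using that[of "\<lambda>i. s ^ (M ^ i)"] pw s by simp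
qed

section \<open>The norm as a product of conjugates\<close>

locale embeddings =
  fixes \<iota> :: "'k::field \<Rightarrow> 'l::field" and K :: "'l set" and n :: nat and \<omega> :: "nat \<Rightarrow> 'l"
    and \<tau> :: "nat \<Rightarrow> 'l \<Rightarrow> 'l"
  assumes iota: "field_hom \<iota>" and sub: "subextension \<iota> K" and basis: "ordered_basis \<iota> K n \<omega>"
    and tau: "\<And>r. r < n \<Longrightarrow> field_hom (\<tau> r)" and tau_iota: "\<And>r c. r < n \<Longrightarrow> \<tau> r (\<iota> c) = \<iota> c"
    and distinct: "\<And>r s. r < n \<Longrightarrow> s < n \<Longrightarrow> r \<noteq> s \<Longrightarrow> \<exists>x\<in>K. \<tau> r x \<noteq> \<tau> s x"
begin

definition rep :: "'l \<Rightarrow> nat \<Rightarrow> 'k" where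
  "rep x i = module.representation (scale_by \<iota>) (\<omega> ` {..<n}) x (\<omega> i)"

lemma expand: assumes "x \<in> K" shows "x = (\<Sum>i<n. \<iota> (rep x i) * \<omega> i)"
proof -
  interpret vs: vector_space "scale_by \<iota>" by (rule vector_space_scale_by[OF iota])
  have b: "inj_on \<omega> {..<n}" "vs.independent (\<omega> ` {..<n})" "vs.span (\<omega> ` {..<n}) = K"
    using basis by (auto simp: ordered_basis_def)
  have "(\<Sum>b\<in>\<omega> ` {..<n}. scale_by \<iota> (vs.representation (\<omega> ` {..<n}) x b) b) = x"
    by (rule vs.sum_representation_eq[OF b(2)]) (use assms b in auto)
  then show ?thesis by (simp add: sum.reindex[OF b(1)] scale_by_def rep_def)
qed

lemma omega_K: assumes "i < n" shows "\<omega> i \<in> K"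
proof -
  interpret vs: vector_space "scale_by \<iota>" by (rule vector_space_scale_by[OF iota])
  have "vs.span (\<omega> ` {..<n}) = K" using basis by (auto simp: ordered_basis_def)
  then show ?thesis using vs.span_base[of "\<omega> i" "\<omega> ` {..<n}"] assms by auto
qed

lemma K_mult: "x \<in> K \<Longrightarrow> y \<in> K \<Longrightarrow> x * y \<in> K"
  using sub by (auto simp: subextension_def)

lemma K_one: "1 \<in> K"
proof -
  interpret field_hom \<iota> by (rule iota)
  have "\<iota> 1 \<in> K" using sub unfolding subextension_def by blast
  then show ?thesis by simp
qed

text \<open>Linear independence of characters. From the relation at \<open>y * x\<close>,
  \<open>\<tau> a y\<close> times the relation at \<open>x\<close> is subtracted; the term of
  \<open>a\<close> disappears, and the coefficient at \<open>s\<close> is multiplied by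
  \<open>\<tau> s y - \<tau> a y\<close>, which is nonzero for a suitable \<open>y\<close>.\<close>

lemma dedekind:
  assumes "A \<subseteq> {..<n}" "\<And>x. x \<in> K \<Longrightarrow> (\<Sum>r\<in>A. c r * \<tau> r x) = 0" "r \<in> A"
  shows "c r = 0"
proof -
  have "finite A" using assms(1) finite_subset by blast
  then show ?thesis using assms
  proof (induction A arbitrary: c r rule: finite_induct)
    case (insert a F)
    have a: "a < n" using insert.prems(1) by auto
    have F: "c s = 0" if s: "s \<in> F" for s
    proof -
      have "s < n" "s \<noteq> a" using insert.hyps insert.prems(1) s by auto
      then obtain y where y: "y \<in> K" "\<tau> s y \<noteq> \<tau> a y" using distinct[OF _ a] by blast
      have "(\<Sum>r\<in>F. (c r * (\<tau> r y - \<tau> a y)) * \<tau> r x) = 0" if x: "x \<in> K" for x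
      proof -
        have m: "\<tau> r (y * x) = \<tau> r y * \<tau> r x" if "r \<in> insert a F" for r
        proof -
          interpret field_hom "\<tau> r" by (rule tau) (use that insert.prems(1) in auto)
          show ?thesis by (rule hom_mult)
        qed
        have "(\<Sum>r\<in>insert a F. c r * \<tau> r (y * x)) = 0" by (rule insert.prems(2)[OF K_mult[OF y(1) x]])
        moreover have "(\<Sum>r\<in>insert a F. c r * \<tau> r (y * x)) = (\<Sum>r\<in>insert a F. c r * \<tau> r y * \<tau> r x)"
          by (intro sum.cong refl) (simp add: m)
        ultimately have 1: "(\<Sum>r\<in>insert a F. c r * \<tau> r y * \<tau> r x) = 0" by simp
        have "(\<Sum>r\<in>insert a F. c r * \<tau> a y * \<tau> r x)
            = \<tau> a y * (\<Sum>r\<in>insert a F. c r * \<tau> r x)"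
          unfolding sum_distrib_left by (intro sum.cong refl) (simp only: mult_ac)
        then have 2: "(\<Sum>r\<in>insert a F. c r * \<tau> a y * \<tau> r x) = 0"
          unfolding insert.prems(2)[OF x] by simp
        have "(\<Sum>r\<in>insert a F. (c r * (\<tau> r y - \<tau> a y)) * \<tau> r x) = 0"
          using 1 2 by (simp only: right_diff_distrib left_diff_distrib sum_subtractf diff_self)
        then show ?thesis using insert.hyps by simp
      qed
      then have "c s * (\<tau> s y - \<tau> a y) = 0"
        using insert.IH[of "\<lambda>r. c r * (\<tau> r y - \<tau> a y)" s] insert.prems(1) s by blast
      then show ?thesis using y by simp
    qed
    have "c a = 0"
    proof -
      interpret field_hom "\<tau> a" by (rule tau[OF a])
      have "(\<Sum>r\<in>insert a F. c r * \<tau> r 1) = 0" by (rule insert.prems(2)[OF K_one])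
      then show ?thesis using F insert.hyps by simp
    qed
    then show ?case using F insert.prems(3) by blast
  qed simp
qed

definition W :: "nat \<Rightarrow> nat \<Rightarrow> 'l" where "W r i = \<tau> r (\<omega> i)"

definition Wm :: "'l mat" where "Wm = mat n n (\<lambda>(r, i). W r i)"

lemma Wm_carrier: "Wm \<in> carrier_mat n n" by (simp add: Wm_def)

text \<open>A vector in the kernel of the transpose is a linear relation between the embeddings on a
  basis, hence on all of \<open>K\<close>.\<close>

lemma det_Wm: "det Wm \<noteq> 0"
proof
  assume "det Wm = 0"
  then have "det (transpose_mat Wm) = 0" by (simp add: det_transpose[OF Wm_carrier])
  then obtain v where v: "v \<in> carrier_vec n" "v \<noteq> 0\<^sub>v n" "transpose_mat Wm *\<^sub>v v = 0\<^sub>v n"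
    using det_0_iff_vec_prod_zero[of "transpose_mat Wm" n] Wm_carrier by auto
  have i: "(\<Sum>r<n. v $ r * W r i) = 0" if "i < n" for i
  proof -
    have "(transpose_mat Wm *\<^sub>v v) $ i = 0" using v(3) that by simp
    then show ?thesis using that v(1)
      by (simp add: Wm_def scalar_prod_def lessThan_atLeast0 mult.commute)
  qed
  have "(\<Sum>r<n. v $ r * \<tau> r x) = 0" if x: "x \<in> K" for x
  proof -
    have t: "\<tau> r x = (\<Sum>i<n. \<iota> (rep x i) * W r i)" if r: "r < n" for r
    proof -
      interpret field_hom "\<tau> r" by (rule tau[OF r])
      show ?thesis by (subst expand[OF x]) (simp add: hom_sum hom_mult tau_iota[OF r] W_def)
    qed
    have "(\<Sum>r<n. v $ r * \<tau> r x) = (\<Sum>r<n. \<Sum>i<n. \<iota> (rep x i) * (v $ r * W r i))"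
      by (intro sum.cong refl) (simp add: t sum_distrib_left mult_ac)
    also have "\<dots> = (\<Sum>i<n. \<iota> (rep x i) * (\<Sum>r<n. v $ r * W r i))"
      by (subst sum.swap) (simp add: sum_distrib_left)
    also have "\<dots> = 0" by (simp add: i)
    finally show ?thesis .
  qed
  then have "v $ r = 0" if "r < n" for r
    using dedekind[of "{..<n}" "\<lambda>r. v $ r"] that by simp
  then have "v = 0\<^sub>v n" using v(1) by (intro eq_vecI) auto
  then show False using v(2) by simp
qed

lemma W_inverse:
  obtains V where "\<And>i i'. i < n \<Longrightarrow> i' < n \<Longrightarrow> (\<Sum>r<n. V i r * W r i') = (if i = i' then 1 else 0)"
    "\<And>r r'. r < n \<Longrightarrow> r' < n \<Longrightarrow> (\<Sum>i<n. W r i * V i r') = (if r = r' then 1 else 0)"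
proof -
  let ?A = "adj_mat Wm"
  have A: "?A \<in> carrier_mat n n" "Wm * ?A = det Wm \<cdot>\<^sub>m 1\<^sub>m n" "?A * Wm = det Wm \<cdot>\<^sub>m 1\<^sub>m n"
    using adj_mat[OF Wm_carrier] by auto
  define V where "V i r = inverse (det Wm) * ?A $$ (i, r)" for i r
  show thesis
  proof
    fix i i' assume i: "i < n" "i' < n"
    have "(?A * Wm) $$ (i, i') = (\<Sum>r<n. ?A $$ (i, r) * W r i')"
      using i A(1) by (simp add: scalar_prod_def Wm_def lessThan_atLeast0)
    then have "(\<Sum>r<n. ?A $$ (i, r) * W r i') = (if i = i' then det Wm else 0)"
      unfolding A(3) using i by (auto split: if_splits)
    moreover have "(\<Sum>r<n. V i r * W r i') = inverse (det Wm) * (\<Sum>r<n. ?A $$ (i, r) * W r i')"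
      by (simp add: V_def sum_distrib_left mult.assoc)
    ultimately show "(\<Sum>r<n. V i r * W r i') = (if i = i' then 1 else 0)" using det_Wm by simp
  next
    fix r r' assume r: "r < n" "r' < n"
    have "(Wm * ?A) $$ (r, r') = (\<Sum>i<n. W r i * ?A $$ (i, r'))"
      using r A(1) by (simp add: scalar_prod_def Wm_def lessThan_atLeast0)
    then have "(\<Sum>i<n. W r i * ?A $$ (i, r')) = (if r = r' then det Wm else 0)"
      unfolding A(2) using r by (auto split: if_splits)
    moreover have "(\<Sum>i<n. W r i * V i r') = inverse (det Wm) * (\<Sum>i<n. W r i * ?A $$ (i, r'))"
      by (simp add: V_def sum_distrib_left mult_ac)
    ultimately show "(\<Sum>i<n. W r i * V i r') = (if r = r' then 1 else 0)" using det_Wm by simp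
  qed
qed

text \<open>The matrix of conjugates of the basis diagonalizes all multiplication matrices at once:
  \<open>H * M = Y * H\<close>, where the diagonal of \<open>Y\<close> holds the conjugates of the
  element with coordinates \<open>z\<close>. Under \<open>h\<close>, \<open>det H\<close> stays
  invertible because \<open>det Wm\<close> is a nonzero element of a field.\<close>

lemma norm_eq_prod:
  fixes h :: "'l \<Rightarrow> 'a::comm_ring_1"
  assumes h: "comm_ring_hom h"
  shows "meval (\<lambda>c. h (\<iota> c)) z (norm_poly \<iota> n \<omega>) = (\<Prod>r<n. \<Sum>i<n. h (W r i) * z i)"
proof -
  interpret h: comm_ring_hom h by fact
  interpret \<iota>: field_hom \<iota> by (rule iota)
  have hi: "comm_ring_hom (\<lambda>c. h (\<iota> c))"
    by (rule comm_ring_hom_comp[OF h field_hom_comm_ring_hom[OF iota]])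
  define M where "M = eval_mult_mat \<iota> n \<omega> (\<lambda>c. h (\<iota> c)) z"
  define y where "y r = (\<Sum>i<n. h (W r i) * z i)" for r
  define Y where "Y = mat n n (\<lambda>(r, s). if r = s then y r else 0)"
  define H where "H = map_mat h Wm"
  have car: "M \<in> carrier_mat n n" "Y \<in> carrier_mat n n" "H \<in> carrier_mat n n"
    by (simp_all add: M_def eval_mult_mat_def Y_def H_def Wm_def)
  have "H * M = Y * H"
  proof (rule eq_matI)
    fix r s assume "r < dim_row (Y * H)" "s < dim_col (Y * H)"
    then have r: "r < n" and s: "s < n" using car by auto
    interpret t: field_hom "\<tau> r" by (rule tau[OF r])
    have k: "(\<Sum>t<n. W r t * \<iota> (rep (\<omega> i * \<omega> s) t)) = W r i * W r s" if i: "i < n" for i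
    proof -
      have "\<tau> r (\<omega> i * \<omega> s) = (\<Sum>t<n. \<iota> (rep (\<omega> i * \<omega> s) t) * W r t)"
        by (subst expand[OF K_mult[OF omega_K[OF i] omega_K[OF s]]])
           (simp add: t.hom_sum t.hom_mult tau_iota[OF r] W_def)
      then show ?thesis by (simp add: t.hom_mult W_def mult.commute)
    qed
    have "(H * M) $$ (r, s) = (\<Sum>t<n. h (W r t) * (\<Sum>i<n. z i * h (\<iota> (rep (\<omega> i * \<omega> s) t))))"
      using r s by (simp add: H_def M_def eval_mult_mat_def Wm_def scalar_prod_def rep_def lessThan_atLeast0)
    also have "\<dots> = (\<Sum>t<n. \<Sum>i<n. z i * h (W r t * \<iota> (rep (\<omega> i * \<omega> s) t)))"
      by (intro sum.cong refl) (simp add: sum_distrib_left h.hom_mult mult_ac)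
    also have "\<dots> = (\<Sum>i<n. z i * h (\<Sum>t<n. W r t * \<iota> (rep (\<omega> i * \<omega> s) t)))"
      by (subst sum.swap) (simp add: sum_distrib_left h.hom_sum)
    also have "\<dots> = (\<Sum>i<n. z i * (h (W r i) * h (W r s)))"
      by (intro sum.cong refl) (simp add: k h.hom_mult)
    also have "\<dots> = y r * h (W r s)" unfolding y_def sum_distrib_right by (intro sum.cong refl) (simp only: mult_ac)
    also have "\<dots> = (\<Sum>t<n. (if r = t then y r else 0) * h (W t s))"
      using r by (simp add: if_distrib[of "\<lambda>x. x * _"] cong: if_cong)
    also have "\<dots> = (Y * H) $$ (r, s)"
      using r s by (simp add: Y_def H_def Wm_def scalar_prod_def lessThan_atLeast0)
    finally show "(H * M) $$ (r, s) = (Y * H) $$ (r, s)" .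
  qed (use car in auto)
  then have "det H * det M = det Y * det H"
    using det_mult[OF car(3,1)] det_mult[OF car(2,3)] by simp
  moreover have dH: "det H = h (det Wm)" unfolding H_def by (rule h.hom_det)
  moreover have "h (inverse (det Wm)) * h (det Wm) = 1"
    using det_Wm by (simp flip: h.hom_mult)
  ultimately have "det M = det Y"
    by (metis mult.assoc mult.commute mult_1)
  also have "det Y = (\<Prod>r<n. y r)"
  proof -
    have "upper_triangular Y" by (auto simp: Y_def upper_triangular_def)
    then have "det Y = prod_list (diag_mat Y)" by (rule det_upper_triangular[OF _ car(2)])
    also have "\<dots> = (\<Prod>r<n. y r)"
      unfolding prod_list_diag_prod by (simp add: Y_def lessThan_atLeast0)
    finally show ?thesis .
  qed
  finally show ?thesis unfolding meval_norm_poly[OF hi] M_def y_def .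
qed

end

section \<open>Points of the torus in general position\<close>

lemma meval_in_mpolys:
  assumes "p \<in> mpolys m" "\<And>c. \<kappa> c \<in> mpolys n" "\<And>i. i < m \<Longrightarrow> z i \<in> mpolys n"
  shows "meval \<kappa> z p \<in> mpolys n"
proof -
  have "z i \<in> mpolys n" if "t \<in> Poly_Mapping.keys p" "i \<in> Poly_Mapping.keys t" for t i
    using assms(1,3) that unfolding mpolys_def by blast
  then show ?thesis
    unfolding meval_def monom_eval_def
    by (intro mpolys_sum mpolys_mult mpolys_prod mpolys_power assms(2))
qed

definition ones :: "nat \<Rightarrow> nat \<Rightarrow> (nat \<Rightarrow>\<^sub>0 nat)" where
  "ones n m = (\<Sum>r<n. Poly_Mapping.single r m)"

lemma lookup_ones: "Poly_Mapping.lookup (ones n m) r = (if r < n then m else 0)"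
proof -
  have "Poly_Mapping.lookup (ones n m) r = (\<Sum>i<n. if i = r then m else 0)"
    unfolding ones_def lookup_sum by (intro sum.cong refl) (simp add: lookup_single when_def)
  then show ?thesis by simp
qed

definition mprod :: "nat \<Rightarrow> 'a::field mpoly" where
  "mprod n = (\<Prod>r<n. mvar r)"

lemma mprod_power: "mprod n ^ m = (Poly_Mapping.single (ones n m) 1 :: 'a::field mpoly)"
proof -
  have "mprod n = (Poly_Mapping.single (ones n 1) 1 :: 'a mpoly)"
    unfolding mprod_def ones_def
    by (induction n) (simp_all add: mvar_def mult_single lessThan_Suc add.commute)
  moreover have "Poly_Mapping.single (ones n 1) 1 ^ m = (Poly_Mapping.single (ones n m) 1 :: 'a mpoly)"
  proof (induction m)
    case 0
    have "ones n 0 = 0" by (rule poly_mapping_eqI) (simp add: lookup_ones)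
    then show ?case by simp
  next
    case (Suc m)
    have "ones n 1 + ones n m = ones n (Suc m)"
      by (rule poly_mapping_eqI) (simp add: lookup_ones lookup_add)
    then show ?case using Suc by (simp add: mult_single)
  qed
  ultimately show ?thesis by simp
qed

text \<open>Subtracting the minimal exponent throughout gives a normal form for monomials modulo
  powers of the product of all variables, that is, for characters of the torus.\<close>

definition red :: "nat \<Rightarrow> (nat \<Rightarrow>\<^sub>0 nat) \<Rightarrow> (nat \<Rightarrow>\<^sub>0 nat)" where
  "red n t = t - ones n (Min (Poly_Mapping.lookup t ` {..<n}))"

lemma red_add: "red n t + ones n (Min (Poly_Mapping.lookup t ` {..<n})) = t"
proof (rule poly_mapping_eqI)
  fix r
  show "Poly_Mapping.lookup (red n t + ones n (Min (Poly_Mapping.lookup t ` {..<n}))) r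
      = Poly_Mapping.lookup t r"
    by (cases "r < n") (simp_all add: red_def lookup_add lookup_minus lookup_ones)
qed

lemma red_zero:
  assumes "n > 0" obtains r where "r < n" "Poly_Mapping.lookup (red n t) r = 0"
proof -
  have "Min (Poly_Mapping.lookup t ` {..<n}) \<in> Poly_Mapping.lookup t ` {..<n}"
    by (rule Min_in) (use assms in auto)
  then obtain r where r: "r < n" "Poly_Mapping.lookup t r = Min (Poly_Mapping.lookup t ` {..<n})"
    by auto
  then have "Poly_Mapping.lookup (red n t) r = 0"
    by (simp add: red_def lookup_minus lookup_ones)
  then show thesis using that r(1) by blast
qed

lemma keys_red: "Poly_Mapping.keys (red n t) \<subseteq> Poly_Mapping.keys t"
  by (auto simp: red_def in_keys_iff lookup_minus)

text \<open>Modulo \<open>Y\<^sub>0 \<cdots> Y\<^sub>n\<^sub>-\<^sub>1 = 1\<close>, every polynomial is congruent to one all of whose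
  monomials miss a variable.\<close>

definition reduced :: "nat \<Rightarrow> 'a::field mpoly \<Rightarrow> 'a mpoly" where
  "reduced n p = (\<Sum>t\<in>Poly_Mapping.keys p. Poly_Mapping.single (red n t) (Poly_Mapping.lookup p t))"

text \<open>A monomial is its reduced form times a power of the product of all variables, and
  \<open>Y ^ m - 1\<close> is a multiple of \<open>Y - 1\<close>.\<close>

lemma reduced_cong:
  assumes p: "p \<in> mpolys n"
  obtains q where "q \<in> mpolys n" "p = reduced n p + (mprod n - 1) * q"
proof -
  define mu where "mu t = Min (Poly_Mapping.lookup t ` {..<n})" for t :: "nat \<Rightarrow>\<^sub>0 nat"
  let ?c = "\<lambda>t. Poly_Mapping.single (red n t) (Poly_Mapping.lookup p t)"
  define q where "q = (\<Sum>t\<in>Poly_Mapping.keys p. ?c t * (\<Sum>i<mu t. mprod n ^ i))"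
  have geo: "(mprod n - 1) * (\<Sum>i<m. mprod n ^ i) = (mprod n ^ m - 1 :: 'a mpoly)" for m
    by (rule power_diff_1_eq[symmetric])
  have s: "Poly_Mapping.single t (Poly_Mapping.lookup p t) = ?c t * mprod n ^ mu t" for t
    unfolding mprod_power mult_single mu_def red_add by simp
  have "p = (\<Sum>t\<in>Poly_Mapping.keys p. ?c t * mprod n ^ mu t)"
    using poly_mapping_sum_singles[of p] unfolding s by simp
  also have "\<dots> = (\<Sum>t\<in>Poly_Mapping.keys p. ?c t + (mprod n - 1) * (?c t * (\<Sum>i<mu t. mprod n ^ i)))"
    unfolding mult.left_commute[of "mprod n - 1"] geo
    by (intro sum.cong refl) (simp add: right_diff_distrib)
  also have "\<dots> = reduced n p + (mprod n - 1) * q"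
    by (simp add: reduced_def q_def sum.distrib sum_distrib_left)
  finally have e: "p = reduced n p + (mprod n - 1) * q" .
  have "?c t \<in> mpolys n" if "t \<in> Poly_Mapping.keys p" for t
    using keys_red[of n t] p that by (auto simp: mpolys_def split: if_splits)
  moreover have "mprod n \<in> mpolys n"
    unfolding mprod_def by (intro mpolys_prod mpolys_mvar) auto
  ultimately have "q \<in> mpolys n"
    unfolding q_def by (intro mpolys_sum mpolys_mult mpolys_power)
  then show thesis using that e by blast
qed

lemma reduced_keys:
  assumes "t \<in> Poly_Mapping.keys (reduced n p)"
  obtains t' where "t' \<in> Poly_Mapping.keys p" "t = red n t'"
proof -
  have "Poly_Mapping.lookup (reduced n p) t \<noteq> 0" using assms by (simp add: in_keys_iff)
  then obtain t' where "t' \<in> Poly_Mapping.keys p"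
    "Poly_Mapping.lookup (Poly_Mapping.single (red n t') (Poly_Mapping.lookup p t')) t \<noteq> 0"
    unfolding reduced_def lookup_sum by (meson sum.not_neutral_contains_not_neutral)
  then show thesis using that by (auto simp: lookup_single when_def split: if_splits)
qed

text \<open>On the torus, \<open>x \<mapsto> x\<^sup>n / N(x)\<close> separates the characters up to torsion, so that a function that
  vanishes on its image is zero.\<close>

lemma power_norm_nonvanishing:
  fixes \<epsilon> :: "'l::field \<Rightarrow> 'e::field"
  assumes eps: "field_hom \<epsilon>" and n: "n > 0" and p: "p \<in> mpolys n" "reduced n p \<noteq> 0"
    and e: "\<And>r. r < n \<Longrightarrow> e r \<noteq> 0" "(\<Prod>r<n. e r) = 1"
  obtains G where "G \<in> mpolys n" "G \<noteq> 0"
    "\<forall>x. meval (\<lambda>c. c) x G \<noteq> 0 \<longrightarrow>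
      (\<forall>r<n. x r \<noteq> 0) \<and> meval \<epsilon> (\<lambda>r. e r * x r ^ n / (\<Prod>s<n. x s)) p \<noteq> 0"
proof -
  interpret eps: field_hom \<epsilon> by (rule eps)
  have epsc: "comm_ring_hom \<epsilon>" by (rule field_hom_comm_ring_hom[OF eps])
  have idc: "comm_ring_hom (\<lambda>c::'e. c)" by unfold_locales auto
  define P where "P = reduced n p"
  define \<delta> where "\<delta> = hdeg P"
  have kP: "Poly_Mapping.keys t \<subseteq> {..<n}" if t: "t \<in> Poly_Mapping.keys P" for t
  proof -
    obtain t' where "t' \<in> Poly_Mapping.keys p" "t = red n t'" using reduced_keys t unfolding P_def by blast
    then show ?thesis using keys_red[of n t'] p(1) by (auto simp: mpolys_def)
  qed
  have zP: "\<exists>r<n. Poly_Mapping.lookup t r = 0" if t: "t \<in> Poly_Mapping.keys P" for t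
  proof -
    obtain t' where "t' \<in> Poly_Mapping.keys p" "t = red n t'" using reduced_keys t unfolding P_def by blast
    then show ?thesis using red_zero[OF n, of t'] by blast
  qed
  \<comment> \<open>The exponents of \<open>x\<close> in the monomial \<open>t\<close> taken at
    \<open>x ^ n / N(x)\<close>, made nonnegative by the factor \<open>N(x) ^ \<delta>\<close>:
    \<open>n\<close> times those of \<open>t\<close>, plus a common summand from the norm.\<close>
  define ex where "ex t = (\<Sum>r<n. Poly_Mapping.single r (n * Poly_Mapping.lookup t r + (\<delta> - tdeg t)))"
    for t :: "nat \<Rightarrow>\<^sub>0 nat"
  have lex: "Poly_Mapping.lookup (ex t) r = (if r < n then n * Poly_Mapping.lookup t r + (\<delta> - tdeg t) else 0)" for t r
  proof -
    have "Poly_Mapping.lookup (ex t) r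
        = (\<Sum>i<n. if i = r then n * Poly_Mapping.lookup t i + (\<delta> - tdeg t) else 0)"
      unfolding ex_def lookup_sum by (intro sum.cong refl) (simp add: lookup_single when_def)
    then show ?thesis by simp
  qed
  have inj: "t = s" if ts: "t \<in> Poly_Mapping.keys P" "s \<in> Poly_Mapping.keys P" "ex t = ex s" for t s
  proof -
    have eq: "n * Poly_Mapping.lookup t r + (\<delta> - tdeg t) = n * Poly_Mapping.lookup s r + (\<delta> - tdeg s)"
      if "r < n" for r
      using arg_cong[OF ts(3), of "\<lambda>u. Poly_Mapping.lookup u r"] that by (simp add: lex)
    obtain r0 where r0: "r0 < n" "Poly_Mapping.lookup t r0 = 0" using zP[OF ts(1)] by blast
    obtain r1 where r1: "r1 < n" "Poly_Mapping.lookup s r1 = 0" using zP[OF ts(2)] by blast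
    \<comment> \<open>A reduced monomial has an exponent 0, so the common summand is the least
      exponent of \<open>ex t\<close>. It can be recovered, and then \<open>t\<close> itself because
      \<open>n > 0\<close>.\<close>
    have d: "\<delta> - tdeg t = \<delta> - tdeg s"
      using eq[OF r0(1)] eq[OF r1(1)] r0(2) r1(2) by simp
    show ?thesis
    proof (rule poly_mapping_eqI)
      fix r
      show "Poly_Mapping.lookup t r = Poly_Mapping.lookup s r"
      proof (cases "r < n")
        case True
        then show ?thesis using eq[OF True] d n by simp
      next
        case False
        then have "r \<notin> Poly_Mapping.keys t" "r \<notin> Poly_Mapping.keys s" using kP ts by auto
        then show ?thesis by (simp add: in_keys_iff)
      qed
    qed
  qed
  have me: "monom_eval e t \<noteq> 0" if "t \<in> Poly_Mapping.keys P" for t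
    unfolding monom_eval_def using kP[OF that] e(1) by (auto simp: prod_zero_iff)
  define G where "G = (\<Sum>t\<in>Poly_Mapping.keys P. Poly_Mapping.single (ex t) (\<epsilon> (Poly_Mapping.lookup P t) * monom_eval e t))"
  have mpr: "mprod n \<in> mpolys n" for dummy :: 'e
    unfolding mprod_def by (intro mpolys_prod mpolys_mvar) auto
  have G: "G \<in> mpolys n"
    unfolding G_def
  proof (intro mpolys_sum)
    fix t assume "t \<in> Poly_Mapping.keys P"
    have "Poly_Mapping.keys (ex t) \<subseteq> {..<n}" by (auto simp: in_keys_iff lex split: if_splits)
    then show "Poly_Mapping.single (ex t) (\<epsilon> (Poly_Mapping.lookup P t) * monom_eval e t) \<in> mpolys n"
      by (auto simp: mpolys_def split: if_splits)
  qed
  obtain t0 where t0: "t0 \<in> Poly_Mapping.keys P" using p(2) unfolding P_def by (metis all_not_in_conv keys_eq_empty)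
  have "Poly_Mapping.lookup G (ex t0)
      = (\<Sum>t\<in>Poly_Mapping.keys P. if t = t0 then \<epsilon> (Poly_Mapping.lookup P t) * monom_eval e t else 0)"
    unfolding G_def lookup_sum
    by (intro sum.cong refl) (use inj t0 in \<open>auto simp: lookup_single when_def\<close>)
  also have "\<dots> = \<epsilon> (Poly_Mapping.lookup P t0) * monom_eval e t0" using t0 by simp
  also have "\<dots> \<noteq> 0" using t0 me[OF t0] by (simp add: in_keys_iff)
  finally have G0: "G \<noteq> 0" by auto
  interpret Mi: comm_ring_hom "meval (\<lambda>c. c) x" for x :: "nat \<Rightarrow> 'e"
    by (rule comm_ring_hom_meval[OF idc])
  have mpm: "meval (\<lambda>c. c) x (mprod n) = (\<Prod>r<n. x r)" for x :: "nat \<Rightarrow> 'e"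
    unfolding mprod_def Mi.hom_prod by (simp add: meval_mvar[OF idc])
  have mex: "monom_eval x (ex t) = monom_eval (\<lambda>r. x r ^ n) t * (\<Prod>r<n. x r) ^ (\<delta> - tdeg t)"
    if "t \<in> Poly_Mapping.keys P" for x :: "nat \<Rightarrow> 'e" and t
  proof -
    have "monom_eval x (ex t) = (\<Prod>r<n. x r ^ Poly_Mapping.lookup (ex t) r)"
      by (rule monom_eval_superset) (auto simp: in_keys_iff lex split: if_splits)
    also have "\<dots> = (\<Prod>r<n. (x r ^ n) ^ Poly_Mapping.lookup t r * x r ^ (\<delta> - tdeg t))"
      by (intro prod.cong refl) (simp add: lex power_add power_mult)
    also have "\<dots> = monom_eval (\<lambda>r. x r ^ n) t * (\<Prod>r<n. x r) ^ (\<delta> - tdeg t)"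
      by (simp add: prod.distrib prod_power_distrib monom_eval_superset[OF _ kP[OF that]])
    finally show ?thesis .
  qed
  have dP: "tdeg t \<le> \<delta>" if "t \<in> Poly_Mapping.keys P" for t
    unfolding \<delta>_def by (rule tdeg_le_hdeg[OF that])
  obtain q where q: "q \<in> mpolys n" "p = P + (mprod n - 1) * q"
    using reduced_cong[OF p(1)] unfolding P_def by blast
  show thesis
  \<comment> \<open>The factor \<open>mprod n\<close> forces all coordinates of \<open>x\<close> to
    be nonzero.\<close>
  proof (rule that[of "G * mprod n"])
    show "G * mprod n \<in> mpolys n" by (intro mpolys_mult G mpr)
    have "meval (\<lambda>c. c) (\<lambda>_. 1) (mprod n) = (1 :: 'e)" unfolding mpm by simp
    then have "mprod n \<noteq> (0 :: 'e mpoly)" by (auto simp: meval_def)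
    then show "G * mprod n \<noteq> 0" using G0 by simp
    show "\<forall>x. meval (\<lambda>c. c) x (G * mprod n) \<noteq> 0 \<longrightarrow>
      (\<forall>r<n. x r \<noteq> 0) \<and> meval \<epsilon> (\<lambda>r. e r * x r ^ n / (\<Prod>s<n. x s)) p \<noteq> 0"
    proof (intro allI impI)
    fix x :: "nat \<Rightarrow> 'e"
    assume nz: "meval (\<lambda>c. c) x (G * mprod n) \<noteq> 0"
    define X where "X = (\<Prod>r<n. x r)"
    define y where "y r = e r * x r ^ n / X" for r
    have X: "X \<noteq> 0" and Gx: "meval (\<lambda>c. c) x G \<noteq> 0" using nz unfolding Mi.hom_mult mpm X_def by auto
    have x0: "\<forall>r<n. x r \<noteq> 0" using X by (auto simp: X_def prod_zero_iff)
    have my: "monom_eval y t * X ^ tdeg t = monom_eval e t * monom_eval (\<lambda>r. x r ^ n) t" for t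
    proof -
      have "monom_eval y t * X ^ tdeg t = monom_eval (\<lambda>r. X * y r) t" by (simp add: monom_eval_scale)
      also have "\<dots> = monom_eval (\<lambda>r. e r * x r ^ n) t" using X by (simp add: y_def)
      also have "\<dots> = monom_eval e t * monom_eval (\<lambda>r. x r ^ n) t" by (simp add: monom_eval_def power_mult_distrib prod.distrib)
      finally show ?thesis .
    qed
    have "meval (\<lambda>c. c) x G = (\<Sum>t\<in>Poly_Mapping.keys P. \<epsilon> (Poly_Mapping.lookup P t) * monom_eval e t * monom_eval x (ex t))"
      unfolding G_def Mi.hom_sum by (simp add: meval_single[OF idc])
    also have "\<dots> = (\<Sum>t\<in>Poly_Mapping.keys P. X ^ \<delta> * (\<epsilon> (Poly_Mapping.lookup P t) * monom_eval y t))"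
    proof (intro sum.cong refl)
      fix t assume t: "t \<in> Poly_Mapping.keys P"
      have "monom_eval e t * monom_eval x (ex t) = monom_eval y t * (X ^ tdeg t * X ^ (\<delta> - tdeg t))"
        unfolding mex[OF t] X_def[symmetric] using my[of t] by (simp add: mult.assoc[symmetric])
      also have "X ^ tdeg t * X ^ (\<delta> - tdeg t) = X ^ \<delta>" using dP[OF t] by (simp flip: power_add)
      finally show "\<epsilon> (Poly_Mapping.lookup P t) * monom_eval e t * monom_eval x (ex t)
          = X ^ \<delta> * (\<epsilon> (Poly_Mapping.lookup P t) * monom_eval y t)"
        by (simp add: mult_ac)
    qed
    also have "\<dots> = X ^ \<delta> * meval \<epsilon> y P" by (simp add: meval_def sum_distrib_left)
    finally have yP: "meval \<epsilon> y P \<noteq> 0" using Gx by auto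
    interpret Me: comm_ring_hom "meval \<epsilon> y" by (rule comm_ring_hom_meval[OF epsc])
    have "(\<Prod>r<n. y r) = (\<Prod>r<n. e r) * X ^ n / X ^ n"
      unfolding y_def prod_dividef prod.distrib by (simp add: X_def prod_power_distrib)
    then have "meval \<epsilon> y (mprod n) = 1"
      unfolding mprod_def Me.hom_prod using e(2) X by (simp add: meval_mvar[OF epsc])
    then have "meval \<epsilon> y p = meval \<epsilon> y P"
      by (subst q(2)) (simp add: Me.hom_add Me.hom_mult Me.hom_minus)
    then show "(\<forall>r<n. x r \<noteq> 0) \<and> meval \<epsilon> (\<lambda>r. e r * x r ^ n / (\<Prod>s<n. x s)) p \<noteq> 0"
      using yP x0 unfolding y_def[abs_def] X_def by simp
    qed
  qed
qed

text \<open>Divisibility of polynomials over \<open>k\<close> descends from \<open>L\<close> to \<open>k\<close>, by a \<open>k\<close>-linear retraction of \<open>k \<rightarrow> L\<close>.\<close>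

lemma linear_retraction:
  assumes iota: "field_hom \<iota>"
  obtains \<pi> :: "'l::field \<Rightarrow> 'k::field" where "\<And>x y. \<pi> (x + y) = \<pi> x + \<pi> y"
    "\<And>c x. \<pi> (\<iota> c * x) = c * \<pi> x" "\<And>c. \<pi> (\<iota> c) = c"
proof -
  interpret vs: vector_space "scale_by \<iota>" by (rule vector_space_scale_by[OF iota])
  have "vs.independent {1}" by simp
  then obtain B where B: "{1} \<subseteq> B" "vs.independent B" and "UNIV \<subseteq> vs.span B"
    using vs.maximal_independent_subset_extend[OF subset_UNIV, of "{1}"] by metis
  then have span: "vs.span B = UNIV" by blast
  define \<pi> where "\<pi> x = vs.representation B x 1" for x
  have 1: "\<pi> (x + y) = \<pi> x + \<pi> y" for x y
    unfolding \<pi>_def using vs.representation_add[OF B(2), of y x] span by simp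
  have 2: "\<pi> (\<iota> c * x) = c * \<pi> x" for c x
    unfolding \<pi>_def using vs.representation_scale[OF B(2), of x c] span by (simp add: scale_by_def)
  have "\<pi> 1 = 1" unfolding \<pi>_def using vs.representation_basis[OF B(2), of 1] B(1) by simp
  then have "\<pi> (\<iota> c) = c" for c using 2[of c 1] by simp
  then show thesis using that 1 2 by blast
qed

lemma divides_descends:
  fixes \<iota> :: "'k::field \<Rightarrow> 'l::field"
  assumes iota: "field_hom \<iota>" and q: "q \<in> mpolys n"
    and eq: "meval (\<lambda>c. mconst (\<iota> c)) mvar A = meval (\<lambda>c. mconst (\<iota> c)) mvar B * q"
  obtains q' where "q' \<in> mpolys n" "A = B * q'"
proof -
  obtain \<pi> :: "'l \<Rightarrow> 'k" where pi: "\<And>x y. \<pi> (x + y) = \<pi> x + \<pi> y"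
    "\<And>c x. \<pi> (\<iota> c * x) = c * \<pi> x" "\<And>c. \<pi> (\<iota> c) = c"
    using linear_retraction[OF iota] by blast
  interpret iota: field_hom \<iota> by (rule iota)
  have ic: "comm_ring_hom (\<lambda>c. mconst (\<iota> c))"
    by (rule comm_ring_hom_comp[OF comm_ring_hom_mconst field_hom_comm_ring_hom[OF iota]])
  interpret I: comm_ring_hom "meval (\<lambda>c. mconst (\<iota> c)) mvar" by (rule comm_ring_hom_meval[OF ic])
  have pi0: "\<pi> 0 = 0" using pi(3)[of 0] by simp
  define p where "p r = Poly_Mapping.map \<pi> r" for r :: "'l mpoly"
  have lp: "Poly_Mapping.lookup (p r) t = \<pi> (Poly_Mapping.lookup r t)" for r t
    unfolding p_def by (simp add: Poly_Mapping.map.rep_eq when_def pi0)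
  have padd: "p (r + s) = p r + p s" for r s
    by (rule poly_mapping_eqI) (simp add: lp lookup_add pi)
  have p0: "p 0 = 0" by (rule poly_mapping_eqI) (simp add: lp pi0)
  have psum: "p (sum f S) = (\<Sum>x\<in>S. p (f x))" for f and S :: "(nat \<Rightarrow>\<^sub>0 nat) set"
    by (induction S rule: infinite_finite_induct) (simp_all add: padd p0)
  have ps: "p (Poly_Mapping.single t a) = Poly_Mapping.single t (\<pi> a)" for t a
    by (rule poly_mapping_eqI) (simp add: lp lookup_single when_def pi0)
  have Is: "meval (\<lambda>c. mconst (\<iota> c)) mvar (Poly_Mapping.single t a) = Poly_Mapping.single t (\<iota> a)" for t a
  proof -
    have "monom_eval mvar t = (Poly_Mapping.single t 1 :: 'l mpoly)"
      using meval_mconst_mvar[of "Poly_Mapping.single t (1::'l)"]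
      by (simp add: meval_single[OF comm_ring_hom_mconst] mconst_def)
    then show ?thesis unfolding meval_single[OF ic] by (simp add: mconst_def mult_single)
  qed
  \<comment> \<open>Linearity over the polynomials with coefficients in \<open>k\<close>; applied to
    both sides of \<open>eq\<close> it produces the quotient \<open>p q\<close>.\<close>
  have pIm: "p (meval (\<lambda>c. mconst (\<iota> c)) mvar B * r) = B * p r" for B r
  proof -
    let ?B = "\<Sum>t\<in>Poly_Mapping.keys B. Poly_Mapping.single t (Poly_Mapping.lookup B t)"
    let ?r = "\<Sum>t\<in>Poly_Mapping.keys r. Poly_Mapping.single t (Poly_Mapping.lookup r t)"
    have "p (meval (\<lambda>c. mconst (\<iota> c)) mvar ?B * ?r) = ?B * p ?r"
      by (simp add: I.hom_sum Is sum_product psum ps mult_single pi)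
    then show ?thesis unfolding poly_mapping_sum_singles .
  qed
  have "p (meval (\<lambda>c. mconst (\<iota> c)) mvar A * 1) = A * p 1" by (rule pIm)
  moreover have "p 1 = 1" using ps[of 0 1] pi(3)[of 1] by simp
  ultimately have "A = p (meval (\<lambda>c. mconst (\<iota> c)) mvar A)" by simp
  also have "\<dots> = B * p q" unfolding eq pIm ..
  finally have "A = B * p q" .
  moreover have "Poly_Mapping.keys (p q) \<subseteq> Poly_Mapping.keys q"
    by (rule subsetI, rule ccontr) (simp add: in_keys_iff lp pi0)
  then have "p q \<in> mpolys n" using q unfolding mpolys_def by blast
  ultimately show thesis using that by blast
qed

locale torus_embeddings = embeddings \<iota> K n \<omega> \<tau> + torus_function_field \<iota> j n \<omega> \<theta> N
  for \<iota> :: "'k::field \<Rightarrow> 'l::field" and K n \<omega> \<tau> and j :: "'k \<Rightarrow> 'f::field" and \<theta> N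
begin

text \<open>The point \<open>e\<close> is multiplied by \<open>x ^ n / N(x)\<close> for
  \<open>x\<close> in \<open>K\<close>, a point of norm 1 over \<open>k\<close>. In the coordinates
  given by the embeddings, a nonzero polynomial in \<open>x\<close> detects a suitable choice, and
  it has a nonzero value over the infinite field \<open>k\<close>.\<close>

lemma general_point:
  fixes \<epsilon> :: "'l \<Rightarrow> 'e::field"
  assumes eps: "field_hom \<epsilon>" and n: "n > 0" and D: "D \<in> mpolys n" "meval j \<zeta> D \<noteq> 0"
    and e: "\<And>r. r < n \<Longrightarrow> e r \<noteq> 0" "(\<Prod>r<n. e r) = 1" and inf: "infinite (UNIV :: 'k set)"
    and V: "\<And>i i'. i < n \<Longrightarrow> i' < n \<Longrightarrow> (\<Sum>r<n. V i r * W r i') = (if i = i' then 1 else 0)"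
      "\<And>r r'. r < n \<Longrightarrow> r' < n \<Longrightarrow> (\<Sum>i<n. W r i * V i r') = (if r = r' then 1 else 0)"
  shows "\<exists>c x. (\<forall>r. x r = (\<Sum>i<n. W r i * \<iota> (c i))) \<and> (\<forall>r<n. x r \<noteq> 0) \<and>
    meval (\<lambda>c. \<epsilon> (\<iota> c)) (\<lambda>i. \<Sum>r<n. \<epsilon> (V i r) * (e r * \<epsilon> (x r) ^ n / (\<Prod>s<n. \<epsilon> (x s)))) D \<noteq> 0"
proof -
  interpret eps: field_hom \<epsilon> by (rule eps)
  interpret iota: field_hom \<iota> by (rule iota)
  have epsc: "comm_ring_hom \<epsilon>" by (rule field_hom_comm_ring_hom[OF eps])
  have iotac: "comm_ring_hom \<iota>" by (rule field_hom_comm_ring_hom[OF iota])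
  have mic: "comm_ring_hom (\<lambda>c. mconst (\<iota> c))"
    by (rule comm_ring_hom_comp[OF comm_ring_hom_mconst iotac])
  have idc: "comm_ring_hom (\<lambda>c::'e. c)" by unfold_locales auto
  interpret mc: comm_ring_hom "mconst :: 'l \<Rightarrow> 'l mpoly" by (rule comm_ring_hom_mconst)
  \<comment> \<open>\<open>D\<close> in the coordinates that split the torus: \<open>V\<close>
    inverts the matrix of conjugates.\<close>
  define D' where "D' = meval (\<lambda>c. mconst (\<iota> c)) (\<lambda>i. \<Sum>r<n. mconst (V i r) * mvar r) D"
  have D': "D' \<in> mpolys n" unfolding D'_def
    by (intro meval_in_mpolys[OF D(1)] mpolys_mconst mpolys_sum mpolys_mult mpolys_mvar) auto
  have ev: "meval \<epsilon> y D' = meval (\<lambda>c. \<epsilon> (\<iota> c)) (\<lambda>i. \<Sum>r<n. \<epsilon> (V i r) * y r) D" for y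
  proof -
    interpret Me: comm_ring_hom "meval \<epsilon> y" by (rule comm_ring_hom_meval[OF epsc])
    show ?thesis unfolding D'_def hom_meval[OF comm_ring_hom_meval[OF epsc]]
      by (simp add: meval_mconst[OF epsc] meval_mvar[OF epsc] Me.hom_sum Me.hom_mult)
  qed
  \<comment> \<open>Otherwise the product of the variables minus 1 divides \<open>D'\<close>;
    substituting back, \<open>N - 1\<close> divides \<open>D\<close> over \<open>L\<close>, hence
    over \<open>k\<close>, and \<open>D\<close> vanishes at the generic point.\<close>
  have r0: "reduced n D' \<noteq> 0"
  proof
    assume "reduced n D' = 0"
    then obtain q where q: "q \<in> mpolys n" "D' = (mprod n - 1) * q"
      using reduced_cong[OF D'] by (metis add_0)
    define S where "S = meval mconst (\<lambda>r. \<Sum>i<n. mconst (W r i) * mvar i)"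
    interpret S: comm_ring_hom "S :: 'l mpoly \<Rightarrow> 'l mpoly"
      unfolding S_def by (rule comm_ring_hom_meval[OF comm_ring_hom_mconst])
    have Sv: "S (mvar r) = (\<Sum>i<n. mconst (W r i) * mvar i)" for r
      unfolding S_def by (rule meval_mvar[OF comm_ring_hom_mconst])
    have Sc: "S (mconst c) = mconst c" for c
      unfolding S_def by (rule meval_mconst[OF comm_ring_hom_mconst])
    have SV: "(\<Sum>r<n. S (mconst (V i r) * mvar r)) = mvar i" if i: "i < n" for i
    proof -
      have "(\<Sum>r<n. S (mconst (V i r) * mvar r)) = (\<Sum>r<n. \<Sum>i'<n. mconst (V i r * W r i') * mvar i')"
        by (simp add: S.hom_mult Sv Sc sum_distrib_left mc.hom_mult mult.assoc)
      also have "\<dots> = (\<Sum>i'<n. mconst (\<Sum>r<n. V i r * W r i') * mvar i')"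
        by (subst sum.swap) (simp add: mc.hom_sum sum_distrib_right)
      also have "\<dots> = (\<Sum>i'<n. if i' = i then mvar i' else 0)"
        by (intro sum.cong refl) (auto simp: V(1)[OF i])
      also have "\<dots> = mvar i" using i by simp
      finally show ?thesis .
    qed
    have "S D' = meval (\<lambda>c. mconst (\<iota> c)) mvar D"
      unfolding D'_def hom_meval[OF S.comm_ring_hom_axioms]
      unfolding Sc S.hom_sum by (rule meval_cong[OF D(1)]) (rule SV)
    moreover have "S (mprod n) = meval (\<lambda>c. mconst (\<iota> c)) mvar N"
      unfolding mprod_def S.hom_prod Sv N_def norm_eq_prod[OF comm_ring_hom_mconst] ..
    moreover have "meval (\<lambda>c. mconst (\<iota> c)) mvar (N - 1) = meval (\<lambda>c. mconst (\<iota> c)) mvar N - 1"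
    proof -
      interpret I: comm_ring_hom "meval (\<lambda>c. mconst (\<iota> c)) mvar" by (rule comm_ring_hom_meval[OF mic])
      show ?thesis by (simp add: I.hom_minus)
    qed
    moreover have "S D' = (S (mprod n) - 1) * S q" unfolding q(2) by (simp add: S.hom_mult S.hom_minus)
    ultimately have eq: "meval (\<lambda>c. mconst (\<iota> c)) mvar D = meval (\<lambda>c. mconst (\<iota> c)) mvar (N - 1) * S q"
      by simp
    have "S q \<in> mpolys n" unfolding S_def
      by (intro meval_in_mpolys[OF q(1)] mpolys_mconst mpolys_sum mpolys_mult mpolys_mvar) auto
    then obtain q' where D_eq: "D = (N - 1) * q'" using divides_descends[OF iota _ eq] by blast
    interpret J: comm_ring_hom "meval j \<zeta>" by (rule comm_ring_hom_meval[OF j'])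
    have "meval j \<zeta> D = 0" unfolding D_eq by (simp add: J.hom_mult J.hom_minus zeta_N)
    then show False using D(2) by simp
  qed
  obtain G where G: "G \<in> mpolys n" "G \<noteq> 0"
    and Gx: "\<forall>x. meval (\<lambda>c. c) x G \<noteq> 0 \<longrightarrow>
      (\<forall>r<n. x r \<noteq> 0) \<and> meval \<epsilon> (\<lambda>r. e r * x r ^ n / (\<Prod>s<n. x s)) D' \<noteq> 0"
    using power_norm_nonvanishing[OF eps n D' r0 e] by blast
  \<comment> \<open>\<open>G\<close> as a polynomial in the coordinates of \<open>x\<close> with
    respect to the basis, so that they can be chosen in the image of \<open>k\<close>.\<close>
  define G2 where "G2 = meval mconst (\<lambda>r. \<Sum>i<n. mconst (\<epsilon> (W r i)) * mvar i) G"
  have G2: "meval (\<lambda>c. c) c G2 = meval (\<lambda>c. c) (\<lambda>r. \<Sum>i<n. \<epsilon> (W r i) * c i) G" for c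
  proof -
    interpret Mi: comm_ring_hom "meval (\<lambda>c. c) c" by (rule comm_ring_hom_meval[OF idc])
    show ?thesis unfolding G2_def hom_meval[OF comm_ring_hom_meval[OF idc]]
      by (simp add: meval_mconst[OF idc] meval_mvar[OF idc] Mi.hom_sum Mi.hom_mult)
  qed
  have injei: "inj (\<lambda>c. \<epsilon> (\<iota> c))" by (rule injI) simp
  then have infS: "infinite (range (\<lambda>c. \<epsilon> (\<iota> c)))" using inf finite_imageD by blast
  then have infE: "infinite (UNIV :: 'e set)" by (rule infinite_super[OF subset_UNIV])
  \<comment> \<open>A point where \<open>G\<close> is nonzero exists over the large field; carried
    back by \<open>V\<close>, it shows that \<open>G2\<close> is not the zero polynomial.\<close>
  have "\<exists>x. meval (\<lambda>c. c) x G \<noteq> 0"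
    by (rule mpoly_nonvanishing[OF G(2) infE]) auto
  then obtain x where x: "meval (\<lambda>c. c) x G \<noteq> 0" by blast
  have "meval (\<lambda>c. c) (\<lambda>i. \<Sum>r<n. \<epsilon> (V i r) * x r) G2 = meval (\<lambda>c. c) x G"
    unfolding G2
  proof (rule meval_cong[OF G(1)])
    fix r assume r: "r < n"
    have "(\<Sum>i<n. \<epsilon> (W r i) * (\<Sum>r'<n. \<epsilon> (V i r') * x r'))
        = (\<Sum>i<n. \<Sum>r'<n. \<epsilon> (W r i * V i r') * x r')"
      by (simp add: sum_distrib_left eps.hom_mult mult.assoc)
    also have "\<dots> = (\<Sum>r'<n. \<epsilon> (\<Sum>i<n. W r i * V i r') * x r')"
      by (subst sum.swap) (simp add: eps.hom_sum sum_distrib_right)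
    also have "\<dots> = (\<Sum>r'<n. if r' = r then x r' else 0)"
      by (intro sum.cong refl) (auto simp: V(2)[OF r])
    also have "\<dots> = x r" using r by simp
    finally show "(\<Sum>i<n. \<epsilon> (W r i) * (\<Sum>r'<n. \<epsilon> (V i r') * x r')) = x r" .
  qed
  then have G2nz: "G2 \<noteq> 0" using x by (auto simp: meval_def)
  have S1: "1 \<in> range (\<lambda>c. \<epsilon> (\<iota> c))" by (rule range_eqI[of _ _ 1]) simp
  have S2: "u * v \<in> range (\<lambda>c. \<epsilon> (\<iota> c))" if uv: "u \<in> range (\<lambda>c. \<epsilon> (\<iota> c))" "v \<in> range (\<lambda>c. \<epsilon> (\<iota> c))" for u v
  proof -
    obtain a b where "u = \<epsilon> (\<iota> a)" "v = \<epsilon> (\<iota> b)" using uv by blast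
    then have "u * v = \<epsilon> (\<iota> (a * b))" by (simp add: eps.hom_mult iota.hom_mult)
    then show ?thesis by blast
  qed
  have "\<exists>d. (\<forall>i. d i \<in> range (\<lambda>c. \<epsilon> (\<iota> c))) \<and> meval (\<lambda>c. c) d G2 \<noteq> 0"
    by (rule mpoly_nonvanishing[OF G2nz infS S1 S2]) blast+
  then obtain d where d: "\<And>i. d i \<in> range (\<lambda>c. \<epsilon> (\<iota> c))" "meval (\<lambda>c. c) d G2 \<noteq> 0" by blast
  then have "\<forall>i. \<exists>c. d i = \<epsilon> (\<iota> c)" by blast
  then obtain c where c: "\<And>i. d i = \<epsilon> (\<iota> (c i))" by metis
  define y where "y r = (\<Sum>i<n. W r i * \<iota> (c i))" for r
  have "(\<lambda>r. \<Sum>i<n. \<epsilon> (W r i) * d i) = (\<lambda>r. \<epsilon> (y r))"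
    by (rule ext) (simp add: y_def c eps.hom_sum eps.hom_mult)
  then have "meval (\<lambda>c. c) (\<lambda>r. \<epsilon> (y r)) G \<noteq> 0" using d(2) unfolding G2 by simp
  with Gx have f: "\<And>r. r < n \<Longrightarrow> y r \<noteq> 0"
    "meval \<epsilon> (\<lambda>r. e r * \<epsilon> (y r) ^ n / (\<Prod>s<n. \<epsilon> (y s))) D' \<noteq> 0" by auto
  show ?thesis
    by (rule exI[of _ c], rule exI[of _ y], intro conjI allI impI) (fact y_def f(1) f(2)[unfolded ev])+
qed

end

section \<open>The contradiction along a line\<close>

definition base :: "'a::field \<Rightarrow> 'a tower" where
  "base x = cst (cst (cst (cst x)))"

lemma field_hom_base: "field_hom base"
  by (rule field_homI) (simp_all add: base_def cst.hom_add cst.hom_mult)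

lemma conC_prod: "conA * conB * conC = (1 :: 'a::field poly fract)"
  unfolding conC_def by (rule right_inverse) simp

lemma tower_level_homs:
  assumes g: "field_hom g"
  shows "field_hom (lft g False 1)" "field_hom (lft (lft g False 1) e1 conA)"
    "field_hom (lft (lft (lft g False 1) e1 conA) e2 (cst conB))" "field_hom (tower e1 e2 e3 g)"
proof -
  show 1: "field_hom (lft g False 1)" by (rule field_hom_lft[OF g]) simp
  show 2: "field_hom (lft (lft g False 1) e1 conA)" by (rule field_hom_lft[OF 1]) simp
  show 3: "field_hom (lft (lft (lft g False 1) e1 conA) e2 (cst conB))" by (rule field_hom_lft[OF 2]) simp
  show "field_hom (tower e1 e2 e3 g)" unfolding tower_def by (rule field_hom_lft[OF 3]) simp
qed

lemma tower_apply:
  assumes g: "field_hom g"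
  shows "tower e1 e2 e3 g (base x) = base (g x)"
    "tower e1 e2 e3 g (cst (cst var)) = (if e1 then cst (cst (cst conA)) / cst (cst var) else cst (cst var))"
    "tower e1 e2 e3 g (cst var) = (if e2 then cst (cst (cst conB)) / cst var else cst var)"
    "tower e1 e2 e3 g var = (if e3 then cst (cst (cst conC)) / var else var)"
    "tower e1 e2 e3 g (cst (cst (cst conA))) = cst (cst (cst conA))"
    "tower e1 e2 e3 g (cst (cst (cst conB))) = cst (cst (cst conB))"
    "tower e1 e2 e3 g (cst (cst (cst conC))) = cst (cst (cst conC))"
proof -
  note h = tower_level_homs[OF g]
  have c3: "tower e1 e2 e3 g (cst u) = cst (lft (lft (lft g False 1) e1 conA) e2 (cst conB) u)" for u
    unfolding tower_def by (rule lft_cst[OF h(3)]) simp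
  have c2: "lft (lft (lft g False 1) e1 conA) e2 (cst conB) (cst u) = cst (lft (lft g False 1) e1 conA u)" for u
    by (rule lft_cst[OF h(2)]) simp
  have c1: "lft (lft g False 1) e1 conA (cst u) = cst (lft g False 1 u)" for u
    by (rule lft_cst[OF h(1)]) simp
  have c0: "lft g False 1 (cst u) = cst (g u)" for u
    by (rule lft_cst[OF g]) simp
  have v3: "tower e1 e2 e3 g var = tw e3 (cst (cst conC))"
    unfolding tower_def by (rule lft_var[OF h(3)]) simp
  have v2: "lft (lft (lft g False 1) e1 conA) e2 (cst conB) var = tw e2 (cst conB)"
    by (rule lft_var[OF h(2)]) simp
  have v1: "lft (lft g False 1) e1 conA var = tw e1 conA"
    by (rule lft_var[OF h(1)]) simp
  show "tower e1 e2 e3 g (base x) = base (g x)" unfolding base_def c3 c2 c1 c0 ..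
  show "tower e1 e2 e3 g (cst (cst var)) = (if e1 then cst (cst (cst conA)) / cst (cst var) else cst (cst var))"
    unfolding c3 c2 v1 by (simp add: tw_def cst.hom_div)
  show "tower e1 e2 e3 g (cst var) = (if e2 then cst (cst (cst conB)) / cst var else cst var)"
    unfolding c3 v2 by (simp add: tw_def cst.hom_div)
  show "tower e1 e2 e3 g var = (if e3 then cst (cst (cst conC)) / var else var)"
    unfolding v3 by (simp add: tw_def)
  show "tower e1 e2 e3 g (cst (cst (cst conA))) = cst (cst (cst conA))"
    "tower e1 e2 e3 g (cst (cst (cst conB))) = cst (cst (cst conB))"
    "tower e1 e2 e3 g (cst (cst (cst conC))) = cst (cst (cst conC))"
    unfolding c3 c2 c1 lft_var_diff[OF g] by simp_all
qed

text \<open>In the application, \<open>p0, p1\<close> are the fixed points of the first involution,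
  \<open>a, b\<close> those of the second, and \<open>c, d\<close> those of their product.\<close>

definition tower_coord :: "'p \<Rightarrow> 'p \<Rightarrow> 'p \<Rightarrow> 'p \<Rightarrow> 'p \<Rightarrow> 'p \<Rightarrow> 'p \<Rightarrow> 'a::field tower" where
  "tower_coord p0 p1 a b c d P =
    (if P = p0 then cst (cst var) else if P = p1 then cst (cst (cst conA)) / cst (cst var)
     else if P = a then cst var else if P = b then cst (cst (cst conB)) / cst var
     else if P = c then var else if P = d then cst (cst (cst conC)) / var else 1)"

lemma tower_coord_nonzero: "tower_coord p0 p1 a b c d P \<noteq> 0"
  by (simp add: tower_coord_def)

lemma tower_coord_prod:
  fixes p0 :: "'p::finite"
  assumes "distinct [p0, p1, a, b, c, d]"
  shows "(\<Prod>P\<in>UNIV. tower_coord p0 p1 a b c d P) = (1 :: 'a::field tower)"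
proof -
  let ?S = "{p0, p1, a, b, c, d}"
  let ?e = "tower_coord p0 p1 a b c d :: 'p \<Rightarrow> 'a tower"
  have d: "p1 \<noteq> p0" "a \<noteq> p0" "b \<noteq> p0" "c \<noteq> p0" "d \<noteq> p0" "a \<noteq> p1" "b \<noteq> p1" "c \<noteq> p1" "d \<noteq> p1"
    "b \<noteq> a" "c \<noteq> a" "d \<noteq> a" "c \<noteq> b" "d \<noteq> b" "d \<noteq> c" using assms by auto
  have "(\<Prod>P\<in>UNIV. tower_coord p0 p1 a b c d P) = (\<Prod>P\<in>?S. tower_coord p0 p1 a b c d P :: 'a tower)"
    by (rule prod.mono_neutral_right) (auto simp: tower_coord_def)
  also have "\<dots> = (?e p0 * ?e p1) * (?e a * ?e b) * (?e c * ?e d)"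
    using assms by (simp only: distinct.simps list.set prod.insert finite.intros prod.empty insert_iff
        empty_iff de_Morgan_disj simp_thms mult.assoc mult_1_right if_True)
  also have "?e p0 * ?e p1 = cst (cst (cst conA))"
    unfolding tower_coord_def using d by simp
  also have "?e a * ?e b = cst (cst (cst conB))"
    unfolding tower_coord_def using d by simp
  also have "?e c * ?e d = cst (cst (cst conC))"
    unfolding tower_coord_def using d by simp
  also have "cst (cst (cst conA)) * cst (cst (cst conB)) * cst (cst (cst conC))
      = (cst (cst (cst (conA * conB * conC))) :: 'a tower)"
    by (simp only: cst.hom_mult)
  also have "\<dots> = 1" unfolding conC_prod by simp
  finally show ?thesis .
qed

text \<open>The functions \<open>Yt P\<close> are the coordinates, cleared of denominators, of the image under the retraction of the
  line from a preimage of the general point to a point over \<open>k\<close>. Their product is an \<open>n\<close>-th power.\<close>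

lemma (in torus_embeddings) not_retract_rational:
  fixes g1 g2 :: "'l \<Rightarrow> 'l" and NN :: "('l \<Rightarrow> 'l) set" and T :: "'p::finite \<Rightarrow> 'l \<Rightarrow> 'l"
  assumes K: "klein g1 g2 NN" and pt: "bij_betw pt {..<n} (UNIV :: 'p set)"
    and T: "\<And>r. r < n \<Longrightarrow> \<tau> r = T (pt r)"
    and g1: "\<And>P x. x \<in> K \<Longrightarrow> g1 (T P x) = T (\<pi>1 P) x" "\<And>c. g1 (\<iota> c) = \<iota> c"
    and g2: "\<And>P x. x \<in> K \<Longrightarrow> g2 (T P x) = T (\<pi>2 P) x" "\<And>c. g2 (\<iota> c) = \<iota> c"
    and NN: "\<And>\<nu> P x. \<nu> \<in> NN \<Longrightarrow> x \<in> K \<Longrightarrow> \<nu> (T P x) = T P x" "\<And>\<nu> c. \<nu> \<in> NN \<Longrightarrow> \<nu> (\<iota> c) = \<iota> c"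
    and n: "even n" and inf: "infinite (UNIV :: 'k set)"
    and pi1: "\<And>P. \<pi>1 (\<pi>1 P) = P" "\<And>P. \<pi>1 P = P \<longleftrightarrow> P = p0 \<or> P = p1"
    and pi2: "\<And>P. \<pi>2 (\<pi>2 P) = P" "\<pi>2 p0 = p1" "\<pi>2 p1 = p0"
    and ab: "\<pi>1 a = b" "\<pi>1 b = a" "\<pi>2 a = a" "\<pi>2 b = b"
    and cd: "\<pi>1 c = d" "\<pi>1 d = c" "\<pi>2 c = d" "\<pi>2 d = c"
    and dist: "distinct [p0, p1, a, b, c, d]"
  shows "\<not> retract_rational j"
proof
  assume r: "retract_rational j"
  interpret K: klein g1 g2 NN by (rule K)
  define S1 where "S1 = tower False True True g1"
  define S2 where "S2 = tower True False True g2"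
  define N3 where "N3 = tower False False False ` NN"
  interpret K3: klein S1 S2 N3 unfolding S1_def S2_def N3_def by (rule K.klein_tower3)
  interpret base: field_hom "base :: 'l \<Rightarrow> 'l tower" by (rule field_hom_base)
  interpret iota: field_hom \<iota> by (rule iota)
  have basec: "comm_ring_hom (base :: 'l \<Rightarrow> 'l tower)" by (rule field_hom_comm_ring_hom[OF field_hom_base])
  define \<kappa> where "\<kappa> c = (base (\<iota> c) :: 'l tower)" for c
  have \<kappa>: "comm_ring_hom \<kappa>" unfolding \<kappa>_def[abs_def]
    by (rule comm_ring_hom_comp[OF basec field_hom_comm_ring_hom[OF iota]])
  have cardP: "card (UNIV :: 'p set) = n" using bij_betw_same_card[OF pt] by simp
  have "card (UNIV :: 'p set) > 0" by (simp add: card_gt_0_iff)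
  then have n0: "n > 0" unfolding cardP .

  \<comment> \<open>The special point of the torus and its symmetries\<close>
  define e where "e = (tower_coord p0 p1 a b c d :: 'p \<Rightarrow> 'l tower)"
  have e0: "e P \<noteq> 0" for P unfolding e_def by (rule tower_coord_nonzero)
  have eprod: "(\<Prod>P\<in>UNIV. e P) = 1" unfolding e_def by (rule tower_coord_prod[OF dist])
  have d1: "p0 \<noteq> p1" "p0 \<noteq> a" "p0 \<noteq> b" "p0 \<noteq> c" "p0 \<noteq> d" "p1 \<noteq> a" "p1 \<noteq> b" "p1 \<noteq> c" "p1 \<noteq> d"
    "a \<noteq> b" "a \<noteq> c" "a \<noteq> d" "b \<noteq> c" "b \<noteq> d" "c \<noteq> d" using dist by auto
  have d2: "p1 \<noteq> p0" "a \<noteq> p0" "b \<noteq> p0" "c \<noteq> p0" "d \<noteq> p0" "a \<noteq> p1" "b \<noteq> p1" "c \<noteq> p1" "d \<noteq> p1"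
    "b \<noteq> a" "c \<noteq> a" "d \<noteq> a" "c \<noteq> b" "d \<noteq> b" "d \<noteq> c" using dist by auto
  have ev: "e p0 = cst (cst var)" "e p1 = cst (cst (cst conA)) / cst (cst var)"
    "e a = cst var" "e b = cst (cst (cst conB)) / cst var" "e c = var" "e d = cst (cst (cst conC)) / var"
    using d1 d2 by (simp_all add: e_def tower_coord_def)
  have e1: "e P = 1" if "P \<notin> {p0, p1, a, b, c, d}" for P
    using that by (simp add: e_def tower_coord_def)
  have p1fix: "\<pi>1 p0 = p0" "\<pi>1 p1 = p1" using pi1(2) by blast+
  interpret S1: field_hom S1 by (rule K3.hom1)
  interpret S2: field_hom S2 by (rule K3.hom2)
  have S1e: "S1 (e P) = e (\<pi>1 P)" for P
  proof (cases "P \<in> {p0, p1, a, b, c, d}")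
    case True
    then show ?thesis
      unfolding insert_iff empty_iff
      by (elim disjE FalseE) (simp_all add: p1fix ab cd ev tower_apply[OF K.hom1, of False True True, folded S1_def] S1.hom_div)
  next
    case False
    have "\<pi>1 R \<in> {p0, p1, a, b, c, d}" if "R \<in> {p0, p1, a, b, c, d}" for R
      using that unfolding insert_iff empty_iff
      by (elim disjE FalseE) (simp_all add: p1fix ab cd)
    from this[of "\<pi>1 P"] False have "\<pi>1 P \<notin> {p0, p1, a, b, c, d}" unfolding pi1(1) by argo
    then show ?thesis using e1 False by simp
  qed
  have S2e: "S2 (e P) = e (\<pi>2 P)" for P
  proof (cases "P \<in> {p0, p1, a, b, c, d}")
    case True
    then show ?thesis
      unfolding insert_iff empty_iff
      by (elim disjE FalseE) (simp_all add: pi2(2,3) ab cd ev tower_apply[OF K.hom2, of True False True, folded S2_def] S2.hom_div)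
  next
    case False
    have "\<pi>2 R \<in> {p0, p1, a, b, c, d}" if "R \<in> {p0, p1, a, b, c, d}" for R
      using that unfolding insert_iff empty_iff
      by (elim disjE FalseE) (simp_all add: pi2(2,3) ab cd)
    from this[of "\<pi>2 P"] False have "\<pi>2 P \<notin> {p0, p1, a, b, c, d}" unfolding pi2(1) by argo
    then show ?thesis using e1 False by simp
  qed
  have N3e: "\<nu> (e P) = e P" if nu: "\<nu> \<in> N3" for \<nu> P
  proof -
    obtain \<mu> where m: "\<mu> \<in> NN" "\<nu> = tower False False False \<mu>" using nu unfolding N3_def by blast
    interpret \<nu>: field_hom \<nu> by (rule K3.homN[OF nu])
    show ?thesis
    proof (cases "P \<in> {p0, p1, a, b, c, d}")
      case True
      then show ?thesis
        unfolding insert_iff empty_iff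
        by (elim disjE FalseE) (simp_all add: ev tower_apply[OF K.homN[OF m(1)], of False False False, folded m(2)] \<nu>.hom_div)
    next
      case False
      then show ?thesis using e1 by simp
    qed
  qed

  \<comment> \<open>A translate of the special point in the domain of the section\<close>
  have "\<exists>m A B P Q D. (\<forall>i<n. A i \<in> mpolys m) \<and> B \<in> mpolys m \<and> B \<noteq> 0 \<and> meval mconst A N = B ^ n \<and>
    D \<in> mpolys n \<and> meval j \<zeta> D \<noteq> 0 \<and> (\<forall>l<m. P l \<in> mpolys n) \<and> Q \<in> mpolys n \<and>
    (\<forall>(\<kappa> :: 'k \<Rightarrow> 'l tower) z \<xi>. comm_ring_hom \<kappa> \<longrightarrow> meval \<kappa> z N = 1 \<longrightarrow>
      meval \<kappa> z D \<noteq> 0 \<longrightarrow> \<xi> = (\<lambda>l. meval \<kappa> z (P l) / meval \<kappa> z Q) \<longrightarrow>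
      meval \<kappa> \<xi> B \<noteq> 0 \<and> (\<forall>i<n. meval \<kappa> \<xi> (A i) = z i * meval \<kappa> \<xi> B))"
  proof (rule torus_point_map[OF r, where 'e = "'l tower"], goal_cases)
    case (1 m A B P Q D)
    show ?case
    proof (rule exI[of _ m], rule exI[of _ A], rule exI[of _ B], rule exI[of _ P], rule exI[of _ Q],
        rule exI[of _ D], intro conjI)
      show "\<forall>i<n. A i \<in> mpolys m" "\<forall>l<m. P l \<in> mpolys n" using 1(1,7) by blast+
      show "\<forall>(\<kappa> :: 'k \<Rightarrow> 'l tower) z \<xi>. comm_ring_hom \<kappa> \<longrightarrow> meval \<kappa> z N = 1 \<longrightarrow>
      meval \<kappa> z D \<noteq> 0 \<longrightarrow> \<xi> = (\<lambda>l. meval \<kappa> z (P l) / meval \<kappa> z Q) \<longrightarrow>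
      meval \<kappa> \<xi> B \<noteq> 0 \<and> (\<forall>i<n. meval \<kappa> \<xi> (A i) = z i * meval \<kappa> \<xi> B)"
        using 1(9) by metis
    qed (fact 1)+
  qed
  then obtain m A B P Q D where A': "\<forall>i<n. A i \<in> mpolys m" and B: "B \<in> mpolys m" "B \<noteq> 0"
    and AB: "meval mconst A N = B ^ n" and D: "D \<in> mpolys n" "meval j \<zeta> D \<noteq> 0"
    and PQ': "\<forall>l<m. P l \<in> mpolys n" "Q \<in> mpolys n"
    and pm: "\<forall>(\<kappa> :: 'k \<Rightarrow> 'l tower) z \<xi>. comm_ring_hom \<kappa> \<longrightarrow> meval \<kappa> z N = 1 \<longrightarrow>
      meval \<kappa> z D \<noteq> 0 \<longrightarrow> \<xi> = (\<lambda>l. meval \<kappa> z (P l) / meval \<kappa> z Q) \<longrightarrow>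
      meval \<kappa> \<xi> B \<noteq> 0 \<and> (\<forall>i<n. meval \<kappa> \<xi> (A i) = z i * meval \<kappa> \<xi> B)"
    by (elim exE conjE)
  have A: "A i \<in> mpolys m" if "i < n" for i using A' that by blast
  have PQ: "\<And>l. l < m \<Longrightarrow> P l \<in> mpolys n" "Q \<in> mpolys n" using PQ' by blast+
  obtain V where V: "\<And>i i'. i < n \<Longrightarrow> i' < n \<Longrightarrow> (\<Sum>r<n. V i r * W r i') = (if i = i' then 1 else 0)"
      "\<And>r r'. r < n \<Longrightarrow> r' < n \<Longrightarrow> (\<Sum>i<n. W r i * V i r') = (if r = r' then 1 else 0)"
    using W_inverse by blast
  have reindex: "(\<Prod>r<n. f (pt r)) = (\<Prod>P\<in>UNIV. f P)" for f :: "'p \<Rightarrow> 'c::comm_monoid_mult"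
    by (rule prod.reindex_bij_betw[OF pt])
  have ept: "(\<Prod>r<n. e (pt r)) = 1" unfolding reindex by (rule eprod)
  obtain cc x0 where x0: "\<And>r. x0 r = (\<Sum>i<n. W r i * \<iota> (cc i))" "\<And>r. r < n \<Longrightarrow> x0 r \<noteq> 0"
    and Dz: "meval (\<lambda>c. base (\<iota> c)) (\<lambda>i. \<Sum>r<n. base (V i r) * (e (pt r) * base (x0 r) ^ n / (\<Prod>s<n. base (x0 s)))) D \<noteq> 0"
    using general_point[OF field_hom_base n0 D e0 ept inf V] by blast
  define w where "w P i = T P (\<omega> i)" for P i
  have wW: "W r i = w (pt r) i" if "r < n" for r i unfolding W_def w_def T[OF that] ..
  define x where "x P = (\<Sum>i<n. w P i * \<iota> (cc i))" for P
  have xpt: "x0 r = x (pt r)" if "r < n" for r unfolding x0 x_def by (simp add: wW[OF that])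
  have ptex: "\<exists>r<n. pt r = P" for P 
  proof -
    have "P \<in> pt ` {..<n}" using pt by (simp add: bij_betw_def)
    then show ?thesis by blast
  qed
  have xnz: "x P \<noteq> 0" for P using ptex[of P] xpt x0(2) by metis
  define X where "X = (\<Prod>P\<in>UNIV. x P)"
  have X0: "X \<noteq> 0" unfolding X_def by (simp add: prod_zero_iff xnz)
  have Xpt: "(\<Prod>s<n. base (x0 s)) = base X"
  proof -
    have "(\<Prod>s<n. base (x0 s)) = (\<Prod>s<n. base (x (pt s)))" by (intro prod.cong refl) (simp add: xpt)
    also have "\<dots> = base X" unfolding reindex[of "\<lambda>P. base (x P)"] X_def base.hom_prod ..
    finally show ?thesis .
  qed
  \<comment> \<open>The factor by which \<open>e\<close> is multiplied comes from a point over
    \<open>k\<close>, so the coordinates \<open>y P\<close> are permuted in the same way as the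
    \<open>e P\<close>.\<close>
  define y where "y P = e P * base (x P) ^ n / base X" for P
  define z where "z i = (\<Sum>r<n. base (V i r) * y (pt r))" for i
  have zD: "meval \<kappa> z D \<noteq> 0"
  proof -
    have "(\<lambda>i. \<Sum>r<n. base (V i r) * (e (pt r) * base (x0 r) ^ n / (\<Prod>s<n. base (x0 s)))) = z"
      unfolding z_def y_def Xpt by (rule ext, rule sum.cong) (simp_all add: xpt)
    then show ?thesis using Dz unfolding \<kappa>_def[abs_def] by simp
  qed
  have Wz: "(\<Sum>i<n. base (W r i) * z i) = y (pt r)" if r: "r < n" for r
  proof -
    have "(\<Sum>i<n. base (W r i) * z i) = (\<Sum>i<n. \<Sum>r'<n. base (W r i * V i r') * y (pt r'))"
      by (simp add: z_def sum_distrib_left base.hom_mult mult.assoc)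
    also have "\<dots> = (\<Sum>r'<n. base (\<Sum>i<n. W r i * V i r') * y (pt r'))"
      by (subst sum.swap) (simp add: base.hom_sum sum_distrib_right)
    also have "\<dots> = (\<Sum>r'<n. if r' = r then y (pt r') else 0)"
      by (intro sum.cong refl) (auto simp: V(2)[OF r])
    also have "\<dots> = y (pt r)" using r by simp
    finally show ?thesis .
  qed
  have wz: "(\<Sum>i<n. base (w P i) * z i) = y P" for P
  proof -
    obtain r where r: "r < n" "pt r = P" using ptex by blast
    show ?thesis using Wz[OF r(1)] wW[OF r(1)] r(2) by simp
  qed
  \<comment> \<open>The coordinates \<open>z\<close> in the basis are determined by the
    \<open>y P\<close>; this turns the equivariance of \<open>y\<close> into invariance of
    \<open>z\<close>.\<close>
  have zuniq: "z' i = z i" if z': "\<And>P. (\<Sum>i<n. base (w P i) * z' i) = y P" and i: "i < n" for z' i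
  proof -
    have "z i = (\<Sum>r<n. base (V i r) * (\<Sum>i'<n. base (W r i') * z' i'))"
      unfolding z_def by (intro sum.cong refl) (simp add: z'[symmetric] wW)
    also have "\<dots> = (\<Sum>r<n. \<Sum>i'<n. base (V i r * W r i') * z' i')"
      by (simp add: sum_distrib_left base.hom_mult mult.assoc)
    also have "\<dots> = (\<Sum>i'<n. base (\<Sum>r<n. V i r * W r i') * z' i')"
      by (subst sum.swap) (simp add: base.hom_sum sum_distrib_right)
    also have "\<dots> = (\<Sum>i'<n. if i' = i then z' i' else 0)"
      by (intro sum.cong refl) (auto simp: V(1)[OF i])
    also have "\<dots> = z' i" using i by simp
    finally show ?thesis by simp
  qed
  have zN: "meval \<kappa> z N = 1"
  proof -
    have "meval \<kappa> z N = (\<Prod>r<n. y (pt r))"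
      unfolding N_def \<kappa>_def[abs_def] norm_eq_prod[OF basec] by (intro prod.cong refl) (simp add: Wz)
    also have "\<dots> = (\<Prod>P\<in>UNIV. y P)" by (rule reindex)
    also have "\<dots> = (\<Prod>P\<in>UNIV. e P) * base X ^ n / base X ^ n"
      unfolding y_def prod_dividef prod.distrib X_def base.hom_prod by (simp add: prod_power_distrib cardP)
    also have "\<dots> = 1" unfolding eprod using X0 by simp
    finally show ?thesis .
  qed
  define \<xi> where "\<xi> l = meval \<kappa> z (P l) / meval \<kappa> z Q" for l
  have pm': "meval \<kappa> \<xi> B \<noteq> 0" "\<And>i. i < n \<Longrightarrow> meval \<kappa> \<xi> (A i) = z i * meval \<kappa> \<xi> B"
    using pm[rule_format, OF \<kappa> zN zD, of \<xi>] by (auto simp: \<xi>_def[abs_def])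
  define \<beta> where "\<beta> = meval \<kappa> \<xi> B"
  \<comment> \<open>One argument for \<open>S1\<close>, \<open>S2\<close> and the elements of
    \<open>N3\<close>: \<open>s\<close> permutes the \<open>y P\<close> as \<open>g\<close> permutes
    the embeddings, so it fixes the \<open>z i\<close> by uniqueness, and with them everything
    computed from them over \<open>k\<close>.\<close>
  have equi: "(\<forall>P. s (base (w P i)) = base (w (\<pi> P) i)) \<and> (\<forall>c. s (\<kappa> c) = \<kappa> c) \<and> (\<forall>l<m. s (\<xi> l) = \<xi> l)
      \<and> s \<beta> = \<beta>"
    if s: "field_hom s" and g: "field_hom g" and sg: "\<And>u. s (base u) = base (g u)"
      and gT: "\<And>P x. x \<in> K \<Longrightarrow> g (T P x) = T (\<pi> P) x" and gi: "\<And>c. g (\<iota> c) = \<iota> c"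
      and se: "\<And>P. s (e P) = e (\<pi> P)" and pp: "\<And>P. \<pi> (\<pi>' P) = P" "\<And>P. \<pi>' (\<pi> P) = P" and i: "i < n"
    for s :: "'l tower \<Rightarrow> 'l tower" and g \<pi> \<pi>' i
  proof -
    interpret s: field_hom s by (rule s)
    interpret g: field_hom g by (rule g)
    have gw: "g (w P i) = w (\<pi> P) i" if "i < n" for P i unfolding w_def by (rule gT[OF omega_K[OF that]])
    have gx: "g (x P) = x (\<pi> P)" for P
      unfolding x_def g.hom_sum by (intro sum.cong refl) (simp add: g.hom_mult gw gi)
    have "g X = (\<Prod>P\<in>UNIV. x (\<pi> P))" unfolding X_def g.hom_prod gx ..
    also have "\<dots> = X" unfolding X_def
      by (rule prod.reindex_bij_betw[OF bij_betw_byWitness[where f' = \<pi>']]) (use pp in auto)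
    finally have gX: "g X = X" .
    have sy: "s (y P) = y (\<pi> P)" for P
      unfolding y_def s.hom_div s.hom_mult s.hom_power se sg gx gX ..
    have sz: "s (z i) = z i" if i: "i < n" for i
    proof (rule zuniq[of "\<lambda>i. s (z i)", OF _ i])
      fix P
      have "(\<Sum>i<n. base (w P i) * s (z i)) = (\<Sum>i<n. s (base (w (\<pi>' P) i) * z i))"
        by (intro sum.cong refl) (simp add: s.hom_mult sg gw pp)
      also have "\<dots> = s (y (\<pi>' P))" unfolding s.hom_sum[symmetric] wz ..
      also have "\<dots> = y P" unfolding sy pp ..
      finally show "(\<Sum>i<n. base (w P i) * s (z i)) = y P" .
    qed
    have sk: "s (\<kappa> c) = \<kappa> c" for c unfolding \<kappa>_def sg gi ..
    have sm: "s (meval \<kappa> z p) = meval \<kappa> z p" if "p \<in> mpolys n" for p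
      unfolding hom_meval[OF field_hom_comm_ring_hom[OF s]] sk by (rule meval_cong[OF that sz])
    have sx: "s (\<xi> l) = \<xi> l" if "l < m" for l
      unfolding \<xi>_def s.hom_div sm[OF PQ(1)[OF that]] sm[OF PQ(2)] ..
    have "s \<beta> = \<beta>" unfolding \<beta>_def hom_meval[OF field_hom_comm_ring_hom[OF s]] sk
      by (rule meval_cong[OF B(1) sx])
    then show ?thesis using sk sx gw[OF i] sg by auto
  qed

  \<comment> \<open>The line to a point over the ground field\<close>
  have "\<exists>a0. meval (\<lambda>c. c) a0 B \<noteq> 0"
    by (rule mpoly_nonvanishing[OF B(2) inf]) auto
  then obtain a0 where a0: "meval (\<lambda>c. c) a0 B \<noteq> 0" by blast
  define kp where "kp c = [:\<kappa> c:]" for c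
  interpret k: comm_ring_hom \<kappa> by (rule \<kappa>)
  have kp: "comm_ring_hom kp" by unfold_locales (simp_all add: kp_def k.hom_add k.hom_mult one_pCons)
  have bp: "comm_ring_hom (\<lambda>u. [:base u:] :: 'l tower poly)"
    by unfold_locales (simp_all add: base.hom_add base.hom_mult one_pCons)
  \<comment> \<open>The line from \<open>\<xi>\<close> at parameter 0 to the point \<open>a0\<close>
    over \<open>k\<close> at parameter 1, where \<open>B\<close> is nonzero by the choice of
    \<open>a0\<close>.\<close>
  define \<Xi> where "\<Xi> l = [:\<xi> l, \<kappa> (a0 l) - \<xi> l:]" for l
  define At where "At i = meval kp \<Xi> (A i)" for i
  define Bt where "Bt = meval kp \<Xi> B"
  define Yt where "Yt P = (\<Sum>i<n. [:base (w P i):] * At i)" for P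
  have ph: "comm_ring_hom (\<lambda>p. poly p t)" for t :: "'l tower"
    by unfold_locales simp_all
  have pe: "poly (meval kp \<Xi> p) t = meval \<kappa> (\<lambda>l. \<xi> l + t * (\<kappa> (a0 l) - \<xi> l)) p" for p t
    unfolding hom_meval[OF ph] by (simp add: kp_def \<Xi>_def)
  have pe0: "poly (meval kp \<Xi> p) 0 = meval \<kappa> \<xi> p" for p unfolding pe by simp
  have pe1: "poly (meval kp \<Xi> p) 1 = \<kappa> (meval (\<lambda>c. c) a0 p)" for p
    unfolding pe hom_meval[OF \<kappa>] by simp
  have Bt1: "poly Bt 1 \<noteq> 0"
    unfolding Bt_def pe1 \<kappa>_def using a0 by simp
  then have Bt0: "Bt \<noteq> 0" by auto
  have Yprod: "(\<Prod>P\<in>UNIV. Yt P) = Bt ^ n"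
  proof -
    interpret M: comm_ring_hom "meval kp \<Xi>" by (rule comm_ring_hom_meval[OF kp])
    have "(\<Prod>P\<in>UNIV. Yt P) = (\<Prod>r<n. Yt (pt r))" unfolding reindex ..
    also have "\<dots> = (\<Prod>r<n. \<Sum>i<n. [:base (W r i):] * At i)"
      by (intro prod.cong refl) (simp add: Yt_def wW)
    also have "\<dots> = meval kp At N"
      unfolding N_def using norm_eq_prod[OF bp, of At] by (simp add: kp_def[abs_def] \<kappa>_def)
    also have "\<dots> = meval kp \<Xi> (meval mconst A N)"
      unfolding hom_meval[OF comm_ring_hom_meval[OF kp]] meval_mconst[OF kp] At_def[abs_def] ..
    also have "\<dots> = Bt ^ n" unfolding AB M.hom_power Bt_def ..
    finally show ?thesis .
  qed
  have Yequi: "map_poly s (Yt P) = Yt (\<pi> P)"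
    if s: "field_hom s" and eq: "\<And>i. i < n \<Longrightarrow> (\<forall>P. s (base (w P i)) = base (w (\<pi> P) i)) \<and> (\<forall>c. s (\<kappa> c) = \<kappa> c)
      \<and> (\<forall>l<m. s (\<xi> l) = \<xi> l) \<and> s \<beta> = \<beta>" for s :: "'l tower \<Rightarrow> 'l tower" and \<pi> P
  proof -
    interpret s: field_hom s by (rule s)
    interpret ms: map_poly_comm_ring_hom s by unfold_locales
    have sk: "s (\<kappa> c) = \<kappa> c" "\<And>l. l < m \<Longrightarrow> s (\<xi> l) = \<xi> l" for c using eq[OF n0] by auto
    have sX: "map_poly s (\<Xi> l) = \<Xi> l" if "l < m" for l
      unfolding \<Xi>_def by (simp add: s.map_poly_pCons_hom s.hom_minus sk that)
    have skp: "map_poly s (kp c) = kp c" for c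
      unfolding kp_def by (simp add: s.map_poly_pCons_hom sk)
    have sA: "map_poly s (At i) = At i" if "i < n" for i
      unfolding At_def hom_meval[OF ms.comm_ring_hom_axioms] skp by (rule meval_cong[OF A[OF that] sX])
    show ?thesis unfolding Yt_def ms.hom_sum
    proof (intro sum.cong refl)
      fix i assume "i \<in> {..<n}"
      then have i: "i < n" by simp
      then have "s (base (w P i)) = base (w (\<pi> P) i)" using eq by blast
      then show "map_poly s ([:base (w P i):] * At i) = [:base (w (\<pi> P) i):] * At i"
        unfolding ms.hom_mult sA[OF i] by (simp add: s.map_poly_pCons_hom)
    qed
  qed
  note E1 = equi[OF K3.hom1 K.hom1 _ g1 S1e pi1(1) pi1(1)]
  note E2 = equi[OF K3.hom2 K.hom2 _ g2 S2e pi2(1) pi2(1)]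
  have S1b: "S1 (base u) = base (g1 u)" for u unfolding S1_def by (rule tower_apply(1)[OF K.hom1])
  have S2b: "S2 (base u) = base (g2 u)" for u unfolding S2_def by (rule tower_apply(1)[OF K.hom2])
  have Y1: "map_poly S1 (Yt P) = Yt (\<pi>1 P)" for P by (rule Yequi[OF K3.hom1 E1[OF S1b]])
  have Y2: "map_poly S2 (Yt P) = Yt (\<pi>2 P)" for P by (rule Yequi[OF K3.hom2 E2[OF S2b]])
  have EN: "(\<forall>P. \<nu> (base (w P i)) = base (w P i)) \<and> (\<forall>c. \<nu> (\<kappa> c) = \<kappa> c) \<and> (\<forall>l<m. \<nu> (\<xi> l) = \<xi> l) \<and> \<nu> \<beta> = \<beta>"
    if nu: "\<nu> \<in> N3" and i: "i < n" for \<nu> i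
  proof -
    obtain \<mu> where m: "\<mu> \<in> NN" "\<nu> = tower False False False \<mu>" using nu unfolding N3_def by blast
    have b: "\<nu> (base u) = base (\<mu> u)" for u unfolding m by (rule tower_apply(1)[OF K.homN[OF m(1)]])
    show ?thesis
      by (rule equi[OF K3.homN[OF nu] K.homN[OF m(1)] b NN(1)[OF m(1)] NN(2)[OF m(1)] N3e[OF nu] refl refl i])
  qed
  have YN: "map_poly \<nu> (Yt P) = Yt P" if "\<nu> \<in> N3" for \<nu> P
    by (rule Yequi[OF K3.homN[OF that] EN[OF that]])

  \<comment> \<open>The norm equation along the line and its two ends\<close>
  have "\<exists>h c'. c' \<noteq> 0 \<and> h \<noteq> 0 \<and> map_poly S2 h = h \<and> (\<forall>\<nu>\<in>N3. map_poly \<nu> h = h) \<and>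
      Yt p0 * Yt p1 = smult c' (h * map_poly S1 h)"
  proof (rule K3.norm_splitting[OF Y1 Y2 YN Yprod n Bt0 pi1 d1(1) pi2(2,3)], goal_cases)
    case 1
    then show ?case .
  next
    case (2 h c')
    have "\<forall>\<nu>\<in>N3. map_poly \<nu> h = h" using 2(4) by blast
    then show ?case using 2(1-3,5) by blast
  qed
  then obtain h c' where c': "c' \<noteq> 0" and h: "h \<noteq> 0" "map_poly S2 h = h" "\<forall>\<nu>\<in>N3. map_poly \<nu> h = h"
    and Yh: "Yt p0 * Yt p1 = smult c' (h * map_poly S1 h)"
    by (elim exE conjE)
  define h0 where "h0 = poly h 0"
  define h1 where "h1 = poly h 1"
  have ps: "poly (map_poly S1 h) 0 = S1 h0" "poly (map_poly S1 h) 1 = S1 h1"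
    unfolding h0_def h1_def using S1.poly_map_poly[of h 0] S1.poly_map_poly[of h 1] by simp_all
  \<comment> \<open>At parameter 0 the values are the \<open>y P\<close> times
    \<open>\<beta>\<close>, the value of \<open>B\<close> at \<open>\<xi>\<close>; at parameter 1
    they come from \<open>L\<close>.\<close>
  have Y0: "poly (Yt P) 0 = y P * \<beta>" for P
  proof -
    have "poly (Yt P) 0 = (\<Sum>i<n. base (w P i) * (z i * \<beta>))"
      unfolding Yt_def poly_sum by (intro sum.cong refl) (simp add: At_def pe0 pm'(2) \<beta>_def)
    also have "\<dots> = y P * \<beta>" by (simp only: wz[symmetric] sum_distrib_right mult.assoc)
    finally show ?thesis .
  qed
  define u where "u P = (\<Sum>i<n. w P i * \<iota> (meval (\<lambda>c. c) a0 (A i)))" for P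
  have Y1': "poly (Yt P) 1 = base (u P)" for P
    unfolding Yt_def poly_sum u_def base.hom_sum
    by (intro sum.cong refl) (simp add: At_def pe1 \<kappa>_def base.hom_mult)
  have "(\<Prod>P\<in>UNIV. base (u P)) = poly Bt 1 ^ n"
    unfolding Y1'[symmetric] poly_prod[symmetric] Yprod by simp
  then have un: "(\<Prod>P\<in>UNIV. base (u P)) \<noteq> 0" using Bt1 by simp
  have u0: "u P \<noteq> 0" for P
  proof
    assume "u P = 0"
    then have "base (u P) = 0" by simp
    then have "(\<Prod>P\<in>UNIV. base (u P)) = 0" by (intro prod_zero bexI[of _ P]) auto
    then show False using un by blast
  qed
  have "poly (Yt p0) 0 * poly (Yt p1) 0 = c' * (poly h 0 * poly (map_poly S1 h) 0)"
    using arg_cong[OF Yh, of "\<lambda>p. poly p 0"] by (simp only: poly_mult poly_smult)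
  then have eq0: "y p0 * \<beta> * (y p1 * \<beta>) = c' * (h0 * S1 h0)"
    unfolding Y0 ps h0_def[symmetric] .
  have "poly (Yt p0) 1 * poly (Yt p1) 1 = c' * (poly h 1 * poly (map_poly S1 h) 1)"
    using arg_cong[OF Yh, of "\<lambda>p. poly p 1"] by (simp only: poly_mult poly_smult)
  then have eq1: "base (u p0 * u p1) = c' * (h1 * S1 h1)"
    unfolding Y1' ps h1_def[symmetric] base.hom_mult .
  \<comment> \<open>The contribution of the translation to \<open>y p0 * y p1\<close>, a nonzero
    element of \<open>L\<close>.\<close>
  define t where "t = (x p0 * x p1) ^ n / X ^ 2"
  have yy: "y p0 * y p1 = cst (cst (cst conA)) * base t"
  proof -
    have g: "v * s ^ n / X' * (A' / v * s' ^ n / X') = A' * ((s * s') ^ n / X' ^ 2)" if "v \<noteq> 0"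
      for v s s' A' X' :: "'l tower"
      using that by (simp add: power_mult_distrib power2_eq_square)
    show ?thesis unfolding y_def ev t_def base.hom_div base.hom_power base.hom_mult by (rule g) simp
  qed
  have t0: "t \<noteq> 0" unfolding t_def using xnz X0 by simp
  have \<beta>0: "\<beta> \<noteq> 0" unfolding \<beta>_def by (rule pm'(1))
  have S1\<beta>: "S1 \<beta> = \<beta>" using E1[OF S1b _ n0] by blast
  have S2\<beta>: "S2 \<beta> = \<beta>" using E2[OF S2b _ n0] by blast
  have uu: "u p0 * u p1 \<noteq> 0" using u0 by simp
  have h1nz: "h1 \<noteq> 0" "S1 h1 \<noteq> 0" using eq1 uu by auto
  have "y p0 * y p1 \<noteq> 0" unfolding yy using t0 by simp
  then have h0nz: "h0 \<noteq> 0" using eq0 \<beta>0 by auto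
  \<comment> \<open>Dividing the values of \<open>h\<close> at the two ends cancels
    \<open>c'\<close>, and the square of \<open>\<beta>\<close> is absorbed because
    \<open>S1\<close> fixes \<open>\<beta>\<close>.\<close>
  define H where "H = h0 / (h1 * \<beta>)"
  have H0: "H \<noteq> 0" unfolding H_def using h0nz h1nz \<beta>0 by simp
  have HS: "H * S1 H = cst (cst (cst (cst (t / (u p0 * u p1)) * conA)))"
  proof -
    have "H * S1 H * (c' * (h1 * S1 h1)) = c' * (h0 * S1 h0) / (\<beta> * \<beta>)"
    proof -
      have "a0 / (a1 * b) * (s0 / (s1 * b)) * (c * (a1 * s1)) = c * (a0 * s0) / (b * b)"
        if "a1 \<noteq> 0" "s1 \<noteq> 0" "b \<noteq> 0" for a0 a1 s0 s1 b c :: "'l tower"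
        using that by (simp add: field_simps)
      from this[OF h1nz \<beta>0] show ?thesis unfolding H_def S1.hom_div S1.hom_mult S1\<beta> .
    qed
    also have "\<dots> = y p0 * y p1"
    proof -
      have "v * b * (v' * b) / (b * b) = v * v'" if "b \<noteq> 0" for v v' b :: "'l tower"
        using that by simp
      from this[OF \<beta>0] show ?thesis unfolding eq0[symmetric] .
    qed
    finally have "H * S1 H * base (u p0 * u p1) = cst (cst (cst conA)) * base t"
      unfolding eq1 yy .
    then have "H * S1 H = cst (cst (cst conA)) * base t / base (u p0 * u p1)"
      using uu by (intro nonzero_eq_divide_eq[THEN iffD2]) simp_all
    also have "\<dots> = cst (cst (cst (cst (t / (u p0 * u p1)) * conA)))"
      by (simp only: base_def cst.hom_mult cst.hom_div mult.commute times_divide_eq_right)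
    finally show ?thesis .
  qed
  have fixp: "s (poly h v) = poly h v" if "field_hom s" "map_poly s h = h" "s v = v" for s :: "'l tower \<Rightarrow> 'l tower" and v
  proof -
    interpret s: field_hom s by (rule that(1))
    show ?thesis using s.poly_map_poly[of h v] that(2,3) by simp
  qed
  have S2H: "S2 H = H"
    unfolding H_def S2.hom_div S2.hom_mult S2\<beta> h0_def h1_def
    using fixp[OF K3.hom2 h(2)] by simp
  have NH: "H \<in> Fix N3"
    unfolding Fix_def
  proof (rule CollectI, rule ballI)
    fix \<nu> assume nu: "\<nu> \<in> N3"
    interpret \<nu>: field_hom \<nu> by (rule K3.homN[OF nu])
    have "\<nu> \<beta> = \<beta>" using EN[OF nu n0] by blast
    then show "\<nu> H = H"
      unfolding H_def \<nu>.hom_div \<nu>.hom_mult h0_def h1_def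
      using fixp[OF K3.homN[OF nu] bspec[OF h(3) nu]] by simp
  qed
  have "t / (u p0 * u p1) \<noteq> 0" using t0 uu by simp
  then show False
    using K.tower_obstruction[of "t / (u p0 * u p1)" H] NH H0 HS S2H
    unfolding S1_def S2_def N3_def by blast
qed

section \<open>Finite fields\<close>

text \<open>Multiplication by \<open>x\<close> permutes \<open>S\<close>; comparing the products
  over \<open>S\<close> gives the claim, as for Fermat's little theorem.\<close>

lemma finite_mult_closed_power:
  fixes S :: "'a::field set"
  assumes S: "finite S" "0 \<notin> S" and m: "\<And>x y. x \<in> S \<Longrightarrow> y \<in> S \<Longrightarrow> x * y \<in> S" and x: "x \<in> S"
  shows "x ^ card S = 1"
proof -
  have x0: "x \<noteq> 0" using x S by auto
  have inj: "inj_on ((*) x) S" using x0 by (auto simp: inj_on_def)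
  have "(*) x ` S \<subseteq> S" using m x by auto
  then have im: "(*) x ` S = S" using endo_inj_surj[OF S(1) _ inj] by blast
  have "prod id S = prod id ((*) x ` S)" using im by simp
  also have "\<dots> = (\<Prod>y\<in>S. x * y)" by (simp add: prod.reindex[OF inj])
  also have "\<dots> = x ^ card S * prod id S" by (simp add: prod.distrib)
  finally have "x ^ card S * prod id S = 1 * prod id S" by simp
  moreover have "prod id S \<noteq> 0" using S by (simp add: prod_zero_iff)
  ultimately show ?thesis by simp
qed

lemma card_roots_of_unity:
  fixes S :: "'a::field set"
  assumes "\<And>x. x \<in> S \<Longrightarrow> x ^ m = 1" "m > 0"
  shows "card S \<le> m" "card S = m \<Longrightarrow> y ^ m = 1 \<Longrightarrow> y \<in> S"
proof -
  let ?p = "monom 1 m - 1 :: 'a poly"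
  have "coeff ?p m = 1" using assms(2) by simp
  then have p0: "?p \<noteq> 0" by (metis coeff_0 zero_neq_one)
  have "degree ?p \<le> m" by (intro degree_diff_le) (simp_all add: degree_monom_le)
  then have c: "card {x. poly ?p x = 0} \<le> m" using card_poly_roots_bound[OF p0] by simp
  have f: "finite {x. poly ?p x = 0}" by (rule poly_roots_finite[OF p0])
  have sub: "S \<subseteq> {x. poly ?p x = 0}" using assms(1) by (auto simp: poly_monom)
  show "card S \<le> m" using card_mono[OF f sub] c by simp
  assume "card S = m" "y ^ m = 1"
  then have "S = {x. poly ?p x = 0}" using card_subset_eq[OF f sub] card_mono[OF f sub] c by simp
  then show "y \<in> S" using \<open>y ^ m = 1\<close> by (simp add: poly_monom)
qed

text \<open>The nonzero elements of \<open>K\<close> are all the roots of \<open>x ^ m = 1\<close>,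
  where \<open>m\<close> is their number, and a homomorphism preserves this equation.\<close>

lemma finite_subfield_stable:
  fixes K :: "'a::field set"
  assumes K: "finite K" "1 \<in> K" "\<And>x y. x \<in> K \<Longrightarrow> y \<in> K \<Longrightarrow> x * y \<in> K" and g: "field_hom g"
  shows "g ` K = K"
proof -
  interpret field_hom g by (rule g)
  define S where "S = K - {0}"
  have S: "finite S" "0 \<notin> S" "\<And>x y. x \<in> S \<Longrightarrow> y \<in> S \<Longrightarrow> x * y \<in> S" "1 \<in> S" using K by (auto simp: S_def)
  have c0: "card S > 0" using S by (auto simp: card_gt_0_iff)
  have p: "x ^ card S = 1" if "x \<in> S" for x by (rule finite_mult_closed_power[OF S(1-3) that])
  have "g x \<in> K" if "x \<in> K" for x
  proof (cases "x = 0")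
    case False
    then have "x ^ card S = 1" using p that by (simp add: S_def)
    then have "g x ^ card S = 1" by (metis hom_one hom_power)
    then have "g x \<in> S" using card_roots_of_unity(2)[OF p c0 refl] by simp
    then show ?thesis by (simp add: S_def)
  qed (use that in simp)
  then have "g ` K \<subseteq> K" by blast
  then show ?thesis using endo_inj_surj[OF K(1)] by (simp add: inj_on_def)
qed

text \<open>Translation by 1 permutes the field and so leaves the sum of all elements unchanged,
  whence \<open>q = 0\<close> in the field; with \<open>q\<close> odd and \<open>2 = 0\<close> this
  would read \<open>1 = 0\<close>.\<close>

lemma finite_field_char_not_2:
  assumes "odd CARD('q::{field,finite})" shows "(1::'q::{field,finite}) \<noteq> - 1"
proof
  assume e: "(1::'q) = - 1"
  have "(\<Sum>x\<in>UNIV. x) = (\<Sum>x\<in>UNIV. x + (1::'q))"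
    by (rule sum.reindex_bij_betw[symmetric]) (rule bij_betw_byWitness[where f' = "\<lambda>x. x - 1"], auto)
  then have z: "of_nat CARD('q) = (0::'q)" by (simp add: sum.distrib)
  obtain k where "CARD('q) = 2 * k + 1" using assms by (elim oddE)
  then have "of_nat CARD('q) = (1 + 1) * of_nat k + (1::'q)" by simp
  also have "(1 + 1 :: 'q) = 0" using e by (metis add.right_inverse)
  finally show False using z by simp
qed

text \<open>With \<open>q = 4 * k + 1\<close>, at most \<open>2 * k\<close> of the
  \<open>4 * k\<close> nonzero elements satisfy \<open>x ^ (2 * k) = 1\<close>; for any other one
  this power is \<open>- 1\<close>, and \<open>x ^ k\<close> is the root.\<close>

lemma sqrt_minus_one_exists:
  assumes "CARD('q::{field,finite}) mod 4 = 1" obtains i :: "'q::{field,finite}" where "i * i = - 1"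
proof -
  define k where "k = CARD('q) div 4"
  have k: "CARD('q) = 4 * k + 1" using assms unfolding k_def by presburger
  have "card {0, 1 :: 'q} \<le> CARD('q)" by (rule card_mono) auto
  then have k0: "k > 0" using k by simp
  define S where "S = UNIV - {0 :: 'q}"
  have S: "finite S" "0 \<notin> S" "card S = 4 * k" by (simp_all add: S_def card_Diff_subset k)
  have p: "x ^ (4 * k) = 1" if "x \<in> S" for x
    using finite_mult_closed_power[of S x] S that by (auto simp: S_def)
  have "\<exists>x\<in>S. x ^ (2 * k) \<noteq> 1"
  proof (rule ccontr)
    assume "\<not> ?thesis"
    then have "card S \<le> 2 * k" using card_roots_of_unity(1)[of S "2 * k"] k0 by simp
    then show False using S k0 by simp
  qed
  then obtain x where x: "x \<in> S" "x ^ (2 * k) \<noteq> 1" by blast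
  have "4 * k = 2 * k + 2 * k" by simp
  then have "x ^ (2 * k) * x ^ (2 * k) = 1" using p[OF x(1)] by (metis power_add)
  then have "(x ^ (2 * k) - 1) * (x ^ (2 * k) + 1) = 0" by (simp add: algebra_simps)
  then have "x ^ (2 * k) = - 1" using x(2) by (simp add: eq_neg_iff_add_eq_0)
  then have "x ^ k * x ^ k = - 1" by (simp add: mult_2 power_add)
  then show thesis by (rule that)
qed

section \<open>The Galois group acting on cosets\<close>

lemma Gal_hom: "g \<in> Gal M \<Longrightarrow> field_hom g"
  by (simp add: Gal_def)

lemma Gal_id: "id \<in> Gal M"
  using field_hom_id by (simp add: Gal_def)

lemma Gal_comp: "g \<in> Gal M \<Longrightarrow> h \<in> Gal M \<Longrightarrow> g \<circ> h \<in> Gal M"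
  unfolding Gal_def using field_hom_comp[of g h] bij_comp[of h g] by (auto simp: comp_def)

lemma Gal_inverse: assumes "g \<in> Gal M" obtains h where "h \<in> Gal M" "h \<circ> g = id" "g \<circ> h = id"
proof -
  have b: "bij g" and hom: "field_hom g" and f: "\<And>x. x \<in> M \<Longrightarrow> g x = x" using assms by (auto simp: Gal_def)
  interpret field_hom g by (rule hom)
  have gi: "g (inv_into UNIV g x) = x" and ig: "inv_into UNIV g (g x) = x" for x
    using b by (simp_all add: bij_is_surj surj_f_inv_f bij_is_inj inv_f_f)
  have "field_hom (inv_into UNIV g)"
  proof (rule field_homI)
    show "inv_into UNIV g 1 = 1" using ig[of 1] by simp
    show "inv_into UNIV g (x + y) = inv_into UNIV g x + inv_into UNIV g y" "inv_into UNIV g (x * y) = inv_into UNIV g x * inv_into UNIV g y" for x y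
      using ig[of "inv_into UNIV g x + inv_into UNIV g y"] ig[of "inv_into UNIV g x * inv_into UNIV g y"] by (simp_all add: hom_add hom_mult gi)
  qed
  moreover have "inv_into UNIV g x = x" if "x \<in> M" for x using ig[of x] f[OF that] by simp
  ultimately have "inv_into UNIV g \<in> Gal M" using bij_imp_bij_inv[OF b] by (simp add: Gal_def)
  moreover have "inv_into UNIV g \<circ> g = id" "g \<circ> inv_into UNIV g = id" using gi ig by auto
  ultimately show thesis using that by blast
qed

lemma left_coset_comp: "left_coset g (left_coset h X) = left_coset (g \<circ> h) X"
  by (auto simp: left_coset_def image_image comp_assoc)

text \<open>With the next lemma: cosets of \<open>Gal K\<close> correspond to embeddings of
  \<open>K\<close>, as two automorphisms lie in the same coset exactly if they agree on
  \<open>K\<close>.\<close>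

lemma left_coset_Gal_eqI:
  assumes g: "g \<in> Gal M" "h \<in> Gal M" and eq: "\<And>x. x \<in> K \<Longrightarrow> g x = h x"
  shows "left_coset g (Gal K) = left_coset h (Gal K)"
proof -
  have sub: "left_coset g (Gal K) \<subseteq> left_coset h (Gal K)"
    if g: "g \<in> Gal M" "h \<in> Gal M" and eq: "\<And>x. x \<in> K \<Longrightarrow> g x = h x" for g h
  proof
    obtain h' where h': "h' \<in> Gal M" "h' \<circ> h = id" "h \<circ> h' = id" using Gal_inverse[OF g(2)] by blast
    have "h' \<circ> g \<in> Gal M" by (rule Gal_comp[OF h'(1) g(1)])
    moreover have "(h' \<circ> g) x = x" if "x \<in> K" for x
      using eq[OF that] fun_cong[OF h'(2), of x] by simp
    ultimately have k: "h' \<circ> g \<in> Gal K" by (simp add: Gal_def)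
    fix f assume "f \<in> left_coset g (Gal K)"
    then obtain s where s: "s \<in> Gal K" "f = g \<circ> s" by (auto simp: left_coset_def)
    have "f = h \<circ> ((h' \<circ> g) \<circ> s)" unfolding s(2) comp_assoc[symmetric] h'(3) by simp
    then show "f \<in> left_coset h (Gal K)" unfolding left_coset_def using Gal_comp[OF k s(1)] by blast
  qed
  show ?thesis using sub[OF g eq] sub[OF g(2,1) eq[symmetric]] by blast
qed

lemma left_coset_Gal_eqD:
  assumes "left_coset g (Gal K) = left_coset h (Gal K)" "x \<in> K" shows "g x = h x"
proof -
  have "g \<circ> id \<in> left_coset g (Gal K)" unfolding left_coset_def using Gal_id by blast
  then obtain s where "s \<in> Gal K" "g = h \<circ> s" unfolding assms(1) by (auto simp: left_coset_def)
  then show ?thesis using assms(2) by (simp add: Gal_def)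
qed

locale coset_action =
  fixes M K :: "'l::field set" and \<phi> :: "('l \<Rightarrow> 'l) set \<Rightarrow> 'p"
  assumes phi: "bij_betw \<phi> (cosets (Gal M) (Gal K)) UNIV"
begin

definition co :: "'p \<Rightarrow> ('l \<Rightarrow> 'l) set" where
  "co = the_inv_into (cosets (Gal M) (Gal K)) \<phi>"

definition act :: "('l \<Rightarrow> 'l) \<Rightarrow> 'p \<Rightarrow> 'p" where
  "act g P = \<phi> (left_coset g (co P))"

text \<open>A representative of the coset. Only its restriction to \<open>K\<close> is determined,
  namely the embedding of \<open>K\<close> that belongs to the point \<open>P\<close>.\<close>

definition T :: "'p \<Rightarrow> 'l \<Rightarrow> 'l" where
  "T P = (SOME g. g \<in> Gal M \<and> left_coset g (Gal K) = co P)"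

lemma co_mem: "co P \<in> cosets (Gal M) (Gal K)" and phi_co: "\<phi> (co P) = P"
  and co_phi: "c \<in> cosets (Gal M) (Gal K) \<Longrightarrow> co (\<phi> c) = c"
proof -
  have inj: "inj_on \<phi> (cosets (Gal M) (Gal K))" and im: "\<phi> ` cosets (Gal M) (Gal K) = UNIV"
    using phi by (auto simp: bij_betw_def)
  show "co P \<in> cosets (Gal M) (Gal K)"
    unfolding co_def by (rule the_inv_into_into[OF inj]) (auto simp: im)
  show "\<phi> (co P) = P" unfolding co_def by (rule f_the_inv_into_f[OF inj]) (simp add: im)
  show "c \<in> cosets (Gal M) (Gal K) \<Longrightarrow> co (\<phi> c) = c"
    unfolding co_def by (rule the_inv_into_f_f[OF inj])
qed

lemma coset_perms_eq: "coset_perms (Gal M) (Gal K) \<phi> = act ` Gal M"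
  unfolding coset_perms_def act_def[abs_def] co_def ..

lemma T_prop: "T P \<in> Gal M" "left_coset (T P) (Gal K) = co P"
proof -
  have "\<exists>g. g \<in> Gal M \<and> left_coset g (Gal K) = co P"
    using co_mem[of P] unfolding cosets_def by auto
  from someI_ex[OF this] show "T P \<in> Gal M" "left_coset (T P) (Gal K) = co P"
    unfolding T_def by auto
qed

lemma left_coset_co: assumes "g \<in> Gal M" shows "left_coset g (co P) = left_coset (g \<circ> T P) (Gal K)"
  by (simp add: T_prop(2)[symmetric] left_coset_comp)

lemma co_act: assumes "g \<in> Gal M" shows "co (act g P) = left_coset g (co P)"
proof -
  have "left_coset g (co P) \<in> cosets (Gal M) (Gal K)"
    unfolding left_coset_co[OF assms] cosets_def using Gal_comp[OF assms T_prop(1)] by blast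
  then show ?thesis unfolding act_def by (rule co_phi)
qed

lemma act_T: assumes "g \<in> Gal M" "x \<in> K" shows "g (T P x) = T (act g P) x"
proof -
  have "left_coset (g \<circ> T P) (Gal K) = left_coset (T (act g P)) (Gal K)"
    unfolding T_prop(2) co_act[OF assms(1)] left_coset_co[OF assms(1)] ..
  from left_coset_Gal_eqD[OF this assms(2)] show ?thesis by simp
qed

lemma act_comp: assumes "g \<in> Gal M" "h \<in> Gal M" shows "act (g \<circ> h) = act g \<circ> act h"
proof
  fix P
  have "act (g \<circ> h) P = \<phi> (left_coset g (left_coset h (co P)))"
    by (simp only: act_def[of "g \<circ> h"] left_coset_comp)
  also have "\<dots> = (act g \<circ> act h) P" by (simp only: comp_apply act_def[of g] co_act[OF assms(2)])
  finally show "act (g \<circ> h) P = (act g \<circ> act h) P" .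
qed

lemma act_id: "act id = id"
  by (rule ext) (simp add: act_def left_coset_def phi_co)

lemma T_inj: assumes "\<And>x. x \<in> K \<Longrightarrow> T P x = T Q x" shows "P = Q"
proof -
  have "co P = co Q"
    unfolding T_prop(2)[symmetric] by (rule left_coset_Gal_eqI[OF T_prop(1) T_prop(1) assms])
  then show ?thesis by (metis phi_co)
qed

definition NN :: "('l \<Rightarrow> 'l) set" where "NN = {g \<in> Gal M. act g = id}"

text \<open>Automorphisms with the same permutation differ by an element of the kernel
  \<open>NN\<close> of the action, so relations between permutations lift to relations modulo
  \<open>NN\<close>.\<close>

lemma klein_act:
  assumes g1: "g1 \<in> Gal M" and g2: "g2 \<in> Gal M"
    and sq: "act g1 \<circ> act g1 = id" "act g2 \<circ> act g2 = id" and c: "act g1 \<circ> act g2 = act g2 \<circ> act g1"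
  shows "klein g1 g2 NN"
proof -
  have inv: "\<exists>\<mu>\<in>NN. f = h \<circ> \<mu>" if f: "f \<in> Gal M" and h: "h \<in> Gal M" and e: "act f = act h" for f h
  proof -
    obtain h' where h': "h' \<in> Gal M" "h' \<circ> h = id" "h \<circ> h' = id" using Gal_inverse[OF h] by blast
    have "act (h' \<circ> f) = act h' \<circ> act h" using act_comp[OF h'(1) f] e by simp
    also have "\<dots> = id" using act_comp[OF h'(1) h] h'(2) act_id by simp
    finally have "h' \<circ> f \<in> NN" using Gal_comp[OF h'(1) f] by (simp add: NN_def)
    moreover have "f = h \<circ> (h' \<circ> f)" unfolding comp_assoc[symmetric] h'(3) by simp
    ultimately show ?thesis by blast
  qed
  have N: "\<nu> \<in> Gal M" "act \<nu> = id" if "\<nu> \<in> NN" for \<nu> using that by (auto simp: NN_def)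
  show ?thesis
  proof (rule klein.intro)
    show "field_hom g1" "field_hom g2" by (rule Gal_hom[OF g1], rule Gal_hom[OF g2])
    show "field_hom \<nu>" if "\<nu> \<in> NN" for \<nu> by (rule Gal_hom[OF N(1)[OF that]])
    show "id \<in> NN" using Gal_id act_id by (simp add: NN_def)
    show "\<nu> \<circ> \<mu> \<in> NN" if "\<nu> \<in> NN" "\<mu> \<in> NN" for \<nu> \<mu>
      using Gal_comp[OF N(1)[OF that(1)] N(1)[OF that(2)]] act_comp[OF N(1)[OF that(1)] N(1)[OF that(2)]]
      unfolding N(2)[OF that(1)] N(2)[OF that(2)] by (simp add: NN_def)
    show "\<exists>\<mu>\<in>NN. \<mu> \<circ> \<nu> = id" if nu: "\<nu> \<in> NN" for \<nu>
    proof -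
      obtain \<mu> where m: "\<mu> \<in> Gal M" "\<mu> \<circ> \<nu> = id" "\<nu> \<circ> \<mu> = id" using Gal_inverse[OF N(1)[OF nu]] by blast
      have "act \<mu> = id" using act_comp[OF m(1) N(1)[OF nu]] m(2) act_id N(2)[OF nu] by simp
      then show ?thesis using m by (auto simp: NN_def)
    qed
    show "g1 \<circ> g1 \<in> NN" "g2 \<circ> g2 \<in> NN"
      using Gal_comp[OF g1 g1] Gal_comp[OF g2 g2] act_comp[OF g1 g1] act_comp[OF g2 g2] sq
      by (simp_all add: NN_def)
    show "\<exists>\<nu>\<in>NN. g1 \<circ> g2 = g2 \<circ> g1 \<circ> \<nu>"
      by (rule inv[OF Gal_comp[OF g1 g2] Gal_comp[OF g2 g1]]) (simp add: act_comp g1 g2 c)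
    show "\<exists>\<mu>\<in>NN. \<nu> \<circ> g1 = g1 \<circ> \<mu>" if "\<nu> \<in> NN" for \<nu>
      by (rule inv[OF Gal_comp[OF N(1)[OF that] g1] g1]) (simp add: act_comp g1 N[OF that])
    show "\<exists>\<mu>\<in>NN. \<nu> \<circ> g2 = g2 \<circ> \<mu>" if "\<nu> \<in> NN" for \<nu>
      by (rule inv[OF Gal_comp[OF N(1)[OF that] g2] g2]) (simp add: act_comp g2 N[OF that])
  qed
qed

end

theorem theorem1p3:
  fixes \<iota> :: "'k::field \<Rightarrow> 'l::field"
    and K :: "'l set"
    and G H :: "('l \<Rightarrow> 'l) set"
    and \<phi> :: "('l \<Rightarrow> 'l) set \<Rightarrow> 'q::{field,finite} option"
    and j :: "'k \<Rightarrow> 'f::field"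
    and n q l e :: nat
  assumes "field_hom \<iota>"
    and "subextension \<iota> K"
    and "separable_ext \<iota> K"
    and "ext_degree \<iota> K = n"
    and "galois_closure \<iota> K UNIV"
    and "G = Gal (range \<iota>)"
    and "H = Gal K"
    and "n = q + 1"
    and "prime l" and "e \<ge> 1" and "q = l ^ e" and "odd q" and "[q = 1] (mod 4)"
    and "CARD('q) = q"
    and "bij_betw \<phi> (cosets G H) UNIV"
    and "PSL2 \<subseteq> coset_perms G H \<phi>"
    and "coset_perms G H \<phi> \<subseteq> PGammaL2"
    and "field_hom j"
    and "norm_one_torus_function_field \<iota> K j"
  shows "\<not> retract_rational j"
proof -
  interpret iota: field_hom \<iota> by fact
  interpret vs: vector_space "scale_by \<iota>" by (rule vector_space_scale_by) fact
  interpret A: coset_action "range \<iota>" K \<phi> using assms(6,7,15) by unfold_locales simp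
  obtain n' \<omega> \<theta> where basis: "ordered_basis \<iota> K n' \<omega>"
    and hom: "alg_hom frac_const (mpolys_loc n' (norm_poly \<iota> n' \<omega>)) j UNIV \<theta>"
    and ker: "{x \<in> mpolys_loc n' (norm_poly \<iota> n' \<omega>). \<theta> x = 0}
      = {(to_fract (norm_poly \<iota> n' \<omega>) - 1) * y | y. y \<in> mpolys_loc n' (norm_poly \<iota> n' \<omega>)}"
    and frac: "\<forall>z. \<exists>x\<in>mpolys_loc n' (norm_poly \<iota> n' \<omega>). \<exists>y\<in>mpolys_loc n' (norm_poly \<iota> n' \<omega>).
      \<theta> y \<noteq> 0 \<and> z = \<theta> x / \<theta> y"
    using assms(19) unfolding norm_one_torus_function_field_def Let_def by blast
  have b: "inj_on \<omega> {..<n'}" "vs.independent (\<omega> ` {..<n'})" "vs.span (\<omega> ` {..<n'}) = K"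
    using basis by (auto simp: ordered_basis_def)
  \<comment> \<open>The size of the basis hidden in the definition of the function field is
    identified with the degree \<open>n\<close>.\<close>
  have "vs.dim K = card (\<omega> ` {..<n'})"
    by (rule vs.dim_eq_card[OF _ b(2)]) (metis b(3) vs.span_span)
  then have n': "n' = n" using assms(4) card_image[OF b(1)] by (simp add: ext_degree_def)
  have "finite (UNIV :: 'q option set)" by simp
  then obtain pt where pt: "bij_betw pt {0..<CARD('q option)} (UNIV :: 'q option set)"
    using ex_bij_betw_nat_finite by blast
  have cq: "CARD('q option) = n" using assms(8,14) by (simp add: card_UNIV_option)
  have pt: "bij_betw pt {..<n} (UNIV :: 'q option set)" using pt unfolding cq lessThan_atLeast0 .
  have Tiota: "A.T P (\<iota> c) = \<iota> c" for P c using A.T_prop(1)[of P] by (auto simp: Gal_def)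
  have Tdist: "\<exists>x\<in>K. A.T (pt r) x \<noteq> A.T (pt s) x" if rs: "r < n" "s < n" "r \<noteq> s" for r s
  proof (rule ccontr)
    assume "\<not> ?thesis"
    then have "pt r = pt s" by (intro A.T_inj) blast
    then show False using pt rs by (auto simp: bij_betw_def inj_on_def)
  qed
  interpret E: torus_embeddings \<iota> K n \<omega> "\<lambda>r. A.T (pt r)" j \<theta> "norm_poly \<iota> n \<omega>"
  proof (intro torus_embeddings.intro embeddings.intro torus_function_field.intro)
    show "field_hom \<iota>" "subextension \<iota> K" "field_hom j" by fact+
    show "ordered_basis \<iota> K n \<omega>" using basis unfolding n' .
    show "field_hom (A.T (pt r))" for r by (rule Gal_hom[OF A.T_prop(1)])
    show "A.T (pt r) (\<iota> c) = \<iota> c" for r c by (rule Tiota)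
    show "\<exists>x\<in>K. A.T (pt r) x \<noteq> A.T (pt s) x" if "r < n" "s < n" "r \<noteq> s" for r s by (rule Tdist[OF that])
    show "norm_poly \<iota> n \<omega> = norm_poly \<iota> n \<omega>" ..
    show "alg_hom frac_const (mpolys_loc n (norm_poly \<iota> n \<omega>)) j UNIV \<theta>" using hom unfolding n' .
    show "{x \<in> mpolys_loc n (norm_poly \<iota> n \<omega>). \<theta> x = 0}
      = {(to_fract (norm_poly \<iota> n \<omega>) - 1) * y | y. y \<in> mpolys_loc n (norm_poly \<iota> n \<omega>)}"
      using ker unfolding n' .
    show "\<exists>x\<in>mpolys_loc n (norm_poly \<iota> n \<omega>). \<exists>y\<in>mpolys_loc n (norm_poly \<iota> n \<omega>). \<theta> y \<noteq> 0 \<and> z = \<theta> x / \<theta> y" for z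
      using frac unfolding n' by blast
  qed
  have "q mod 4 = 1" using assms(13) by (simp add: cong_def)
  then obtain i :: 'q where i: "i * i = - 1" using sqrt_minus_one_exists assms(14) by metis
  have m1: "(1::'q) \<noteq> - 1" using finite_field_char_not_2 assms(12,14) by metis
  have i0: "i \<noteq> 0" using i by auto
  \<comment> \<open>The entries are scaled by \<open>i\<close>, so that both determinants are
    \<open>- (i * i) = 1\<close> and the maps lie in \<open>PSL2\<close>.\<close>
  define s1 where "s1 = moebius i 0 0 (- i)"
  define s2 where "s2 = moebius 0 i i 0"
  have s1: "s1 None = None" "s1 (Some x) = Some (- x)" for x
    using i0 by (simp_all add: s1_def moebius_def)
  have s2: "s2 None = Some 0" "s2 (Some x) = (if x = 0 then None else Some (inverse x))" for x
    using i0 by (simp_all add: s2_def moebius_def field_simps)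
  have "s1 \<in> PSL2" "s2 \<in> PSL2"
  proof -
    have "i * (- i) - 0 * 0 = 1" "0 * 0 - i * i = 1" using i by simp_all
    then show "s1 \<in> PSL2" "s2 \<in> PSL2" unfolding PSL2_def s1_def s2_def by blast+
  qed
  moreover have "PSL2 \<subseteq> A.act ` Gal (range \<iota>)"
    using assms(16) unfolding assms(6,7) A.coset_perms_eq .
  ultimately obtain g1 g2 where g1: "g1 \<in> Gal (range \<iota>)" "A.act g1 = s1"
    and g2: "g2 \<in> Gal (range \<iota>)" "A.act g2 = s2" by blast
  have ss: "s1 (s1 P) = P" "s2 (s2 P) = P" "s1 (s2 P) = s2 (s1 P)" for P
    by (cases P; simp add: s1 s2)+
  have kl: "klein g1 g2 A.NN"
    by (rule A.klein_act[OF g1(1) g2(1)]) (auto simp: g1(2) g2(2) ss)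
  have fp: "s1 P = P \<longleftrightarrow> P = None \<or> P = Some 0" for P
  proof (cases P)
    case (Some x)
    have "- x = x \<longleftrightarrow> x = 0"
    proof
      assume "- x = x"
      then have "(1 + 1) * x = 0" by (simp add: distrib_right add_eq_0_iff)
      moreover have "(1 + 1 :: 'q) \<noteq> 0" using m1 by (simp add: eq_neg_iff_add_eq_0)
      ultimately show "x = 0" by simp
    qed simp
    then show ?thesis using Some by (simp add: s1)
  qed (simp add: s1)
  \<comment> \<open>So \<open>s2\<close> exchanges \<open>Some i\<close> and
    \<open>Some (- i)\<close>.\<close>
  have ii: "inverse i = - i" using i i0 by (metis inverse_unique minus_mult_right neg_equal_iff_equal minus_minus)
  have in1: "i \<noteq> 1" "i \<noteq> - 1" using i m1 by auto
  have in1': "- i \<noteq> 1" using in1(2) by (metis minus_minus)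
  have in2: "i \<noteq> - i" using fp[of "Some i"] i0 by (auto simp: s1)
  \<comment> \<open>Over a finite \<open>k\<close> the field \<open>K\<close> would be finite, hence
    stable under all its embeddings. As \<open>s1\<close> fixes \<open>None\<close>,
    \<open>g1\<close> would fix the image of \<open>K\<close> under that embedding, which is
    \<open>K\<close> itself; then the embeddings at \<open>1\<close> and \<open>- 1\<close>, which
    \<open>g1\<close> exchanges, would coincide.\<close>
  have inf: "infinite (UNIV :: 'k set)"
  proof
    assume fk: "finite (UNIV :: 'k set)"
    have "K \<subseteq> (\<lambda>c. \<Sum>i<n. \<iota> (c i) * \<omega> i) ` (PiE {..<n} (\<lambda>_. UNIV))"
    proof
      fix x assume x: "x \<in> K"
      have "x = (\<Sum>i<n. \<iota> (restrict (E.rep x) {..<n} i) * \<omega> i)"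
        by (subst E.expand[OF x]) (intro sum.cong refl, simp)
      then show "x \<in> (\<lambda>c. \<Sum>i<n. \<iota> (c i) * \<omega> i) ` (PiE {..<n} (\<lambda>_. UNIV))"
        by (rule image_eqI[where x = "restrict (E.rep x) {..<n}"]) (simp add: restrict_PiE_iff)
    qed
    then have fK: "finite K" using fk by (meson finite_PiE finite_imageI finite_lessThan finite_subset)
    have st: "A.T P ` K = K" for P
      by (rule finite_subfield_stable[OF fK E.K_one E.K_mult Gal_hom[OF A.T_prop(1)]])
    have g1K: "g1 x = x" if x: "x \<in> K" for x
    proof -
      obtain y where y: "y \<in> K" "x = A.T None y" using st[of None] x by blast
      show ?thesis using A.act_T[OF g1(1) y(1), of None] by (simp add: y(2) g1(2) s1)
    qed
    have "A.T (Some 1) x = A.T (Some (- 1)) x" if x: "x \<in> K" for x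
    proof -
      have "A.T (Some 1) x \<in> K" using st[of "Some 1"] x by blast
      then show ?thesis using A.act_T[OF g1(1) x, of "Some 1"] g1K by (simp add: g1(2) s1)
    qed
    then have "Some (1::'q) = Some (- 1)" by (rule A.T_inj)
    then show False using m1 by simp
  qed
  show ?thesis
  proof (rule E.not_retract_rational[OF kl pt, where T = A.T and ?\<pi>1.0 = s1 and ?\<pi>2.0 = s2 and ?p0.0 = None
        and ?p1.0 = "Some 0" and a = "Some 1" and b = "Some (- 1)" and c = "Some i" and d = "Some (- i)"])
    show "g1 (A.T P x) = A.T (s1 P) x" "g2 (A.T P x) = A.T (s2 P) x" if "x \<in> K" for P x
      using A.act_T[OF g1(1) that] A.act_T[OF g2(1) that] by (simp_all add: g1(2) g2(2))
    show "g1 (\<iota> c) = \<iota> c" "g2 (\<iota> c) = \<iota> c" for c using g1(1) g2(1) by (auto simp: Gal_def)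
    show "\<nu> (A.T P x) = A.T P x" if "\<nu> \<in> A.NN" "x \<in> K" for \<nu> P x
      using A.act_T[of \<nu> x P] that by (simp add: A.NN_def)
    show "\<nu> (\<iota> c) = \<iota> c" if "\<nu> \<in> A.NN" for \<nu> c using that by (auto simp: A.NN_def Gal_def)
    show "even n" using assms(8,12) by simp
    show "infinite (UNIV :: 'k set)" by (rule inf)
    show "s1 P = P \<longleftrightarrow> P = None \<or> P = Some 0" for P by (rule fp)
    show "distinct [None, Some 0, Some 1, Some (- 1), Some i, Some (- i)]"
      using m1 i0 in1 in1' in2 by (auto dest: sym)
  qed (simp_all add: ss s1 s2 ii i0)
qed

end
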